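(* Let $(M,\Omega)$ be a symplectic manifold and let $\nabla$ be a symplectic connection on it, with associated operator $\delta^*=\delta^*_\nabla$ on $\widehat{\mathsf S}(M)$. Then: (1) $\delta^*$ is a derivation of the symmetric product $\odot$: $\delta^*(\alpha\odot\beta)=\delta^*\alpha\odot\beta+\alpha\odot\delta^*\beta$ for $\alpha\in\mathsf S^k(M)$, $\beta\in\mathsf S^l(M)$. (2) The Schouten bracket $[\![\cdot,\cdot]\!]$ is the coboundary of $\delta^*$ in the Lie algebra cochain complex of the algebraic bracket $(\cdot,\cdot)$ with coefficients in its adjoint representation; that is, for $\alpha\in\mathsf S^k(M)$, $\beta\in\mathsf S^l(M)$, $$[\![\alpha,\beta]\!]=(\delta^*\alpha,\beta)+(\alpha,\delta^*\beta)-\delta^*(\alpha,\beta).$$ Consequently, $[\![\cdot,\cdot]\!]$ and $(\cdot,\cdot)$ are compatible Lie brackets on $\widehat{\mathsf S}(M)$ (every linear combination of them is a Lie bracket); explicitly, $$0=([\![\alpha,\beta]\!],\gamma)+([\![\beta,\gamma]\!],\alpha)+([\![\gamma,\alpha]\!],\beta)+[\![(\alpha,\beta),\gamma]\!]+[\![(\beta,\gamma),\alpha]\!]+[\![(\gamma,\alpha),\beta]\!].$$ (3) If $\bar\nabla=\nabla+\Pi_{ij}{}^k$ is another symplectic connection, then the associated operator $\delta^*_{\bar\nabla}$ is cohomologous to $\delta^*_\nabla$ in the Lie algebra cochain complex of the algebraic bracket $(\cdot,\cdot)$ with coefficients in its adjoint representation.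
   Context: Abstract indices and the summation convention are used; $(\cdots)$ around indices denotes complete symmetrization. $\Omega^{ij}$ is defined by $\Omega^{ip}\Omega_{pj}=-\delta_j{}^i$; indices are raised/lowered by $X^i=\Omega^{ip}X_p$, $X_i=X^p\Omega_{pi}$, keeping horizontal position. $\mathsf S^k(M)=\Gamma(S^k(T^*M))$ (with $\mathsf S^0(M)=C^\infty(M)$), $\widehat{\mathsf S}(M)=\prod_{k\ge0}\mathsf S^k(M)$ (formal infinite sums of symmetric tensors), with symmetric product $(\alpha\odot\beta)_{i_1\dots i_{k+l}}=\alpha_{(i_1\dots i_k}\beta_{i_{k+1}\dots i_{k+l})}$. A symplectic connection is a torsion-free affine connection $\nabla$ with $\nabla\Omega=0$; $\delta^*_\nabla\alpha_{i_1\dots i_{k+1}}=-\nabla_{(i_1}\alpha_{i_2\dots i_{k+1})}$ for $\alpha\in\mathsf S^k(M)$. For $\alpha\in\mathsf S^k(M)$, $\beta\in\mathsf S^l(M)$: the algebraic bracket is $(\alpha,\beta)_{i_1\dots i_{k+l-2}}=kl\,\alpha_{p(i_1\dots i_{k-1}}\beta_{i_k\dots i_{k+l-2})}{}^p$ (zero if $k=0$ or $l=0$), a Lie bracket; the Schouten bracket is $[\![\alpha,\beta]\!]_{i_1\dots i_{k+l-1}}=-k\alpha_{p(i_1\dots i_{k-1}}\nabla^p\beta_{i_k\dots i_{k+l-1})}+l\beta_{p(i_1\dots i_{l-1}}\nabla^p\alpha_{i_l\dots i_{k+l-1})}$, a Lie bracket independent of the choice of symplectic connection $\nabla$ (it corresponds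 via $\Omega$ to the Schouten bracket of symmetric contravariant tensors, i.e. the canonical Poisson bracket of fiberwise polynomial functions on $T^*M$). Both extend to $\widehat{\mathsf S}(M)$ componentwise. *)

theory Defs
  imports
    "HOL-Analysis.Analysis"
    "HOL-Library.Function_Algebras"
    "HOL-Combinatorics.Combinatorics"
begin

section \<open>Functions into a real vector space\<close>

instantiation "fun" :: (type, real_vector) real_vector
begin

definition scaleR_fun :: "real \<Rightarrow> ('a \<Rightarrow> 'b) \<Rightarrow> 'a \<Rightarrow> 'b"
  where "scaleR_fun r f = (\<lambda>x. r *\<^sub>R f x)"

instance
  by standard (auto simp: scaleR_fun_def fun_eq_iff scaleR_add_right scaleR_add_left)

end


section \<open>Lie brackets and the Chevalley-Eilenberg complex\<close>

definition bilinear_on :: "'v::real_vector set \<Rightarrow> ('v \<Rightarrow> 'v \<Rightarrow> 'v) \<Rightarrow> bool"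
  where "bilinear_on V br \<longleftrightarrow>
    (\<forall>x\<in>V. \<forall>y\<in>V. \<forall>z\<in>V. \<forall>a b.
       br (a *\<^sub>R x + b *\<^sub>R y) z = a *\<^sub>R br x z + b *\<^sub>R br y z \<and>
       br z (a *\<^sub>R x + b *\<^sub>R y) = a *\<^sub>R br z x + b *\<^sub>R br z y)"

definition lie_bracket_on :: "'v::real_vector set \<Rightarrow> ('v \<Rightarrow> 'v \<Rightarrow> 'v) \<Rightarrow> bool"
  where "lie_bracket_on V br \<longleftrightarrow>
    subspace V \<and>
    (\<forall>x\<in>V. \<forall>y\<in>V. br x y \<in> V) \<and>
    bilinear_on V br \<and>
    (\<forall>x\<in>V. br x x = 0) \<and>
    (\<forall>x\<in>V. \<forall>y\<in>V. \<forall>z\<in>V. br (br x y) z + br (br y z) x + br (br z x) y = 0)"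

definition compatible_lie_brackets ::
  "'v::real_vector set \<Rightarrow> ('v \<Rightarrow> 'v \<Rightarrow> 'v) \<Rightarrow> ('v \<Rightarrow> 'v \<Rightarrow> 'v) \<Rightarrow> bool"
  where "compatible_lie_brackets V br1 br2 \<longleftrightarrow>
    (\<forall>s t. lie_bracket_on V (\<lambda>x y. s *\<^sub>R br1 x y + t *\<^sub>R br2 x y))"

text \<open>
  A \<open>p\<close>-cochain with values in the adjoint representation is an alternating \<open>p\<close>-linear map
  from \<open>V\<close> to \<open>V\<close>. Its arguments form a list of length \<open>p\<close>; its values on other lists are
  irrelevant.
\<close>

definition cochains :: "'v::real_vector set \<Rightarrow> nat \<Rightarrow> ('v list \<Rightarrow> 'v) set"
  where "cochains V p = {f. \<forall>xs. set xs \<subseteq> V \<and> length xs = p \<longrightarrow>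
    f xs \<in> V \<and>
    (\<forall>i<p. \<forall>x\<in>V. \<forall>y\<in>V. \<forall>a b.
       f (xs[i := a *\<^sub>R x + b *\<^sub>R y]) = a *\<^sub>R f (xs[i := x]) + b *\<^sub>R f (xs[i := y])) \<and>
    (\<forall>i<p. \<forall>j<p. i \<noteq> j \<and> xs ! i = xs ! j \<longrightarrow> f xs = 0)}"

definition delete_nth :: "nat \<Rightarrow> 'a list \<Rightarrow> 'a list"
  where "delete_nth i xs = take i xs @ drop (Suc i) xs"

definition ce_differential ::
  "('v::real_vector \<Rightarrow> 'v \<Rightarrow> 'v) \<Rightarrow> ('v list \<Rightarrow> 'v) \<Rightarrow> 'v list \<Rightarrow> 'v"
  where "ce_differential br f xs =
    (\<Sum>i<length xs. (-1) ^ i *\<^sub>R br (xs ! i) (f (delete_nth i xs))) +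
    (\<Sum>j<length xs. \<Sum>i<j.
       (-1) ^ (i + j) *\<^sub>R f (br (xs ! i) (xs ! j) # delete_nth i (delete_nth j xs)))"

text \<open>
  Cohomologous \<open>(p + 1)\<close>-cochains differ by a coboundary; they need not be cocycles.
\<close>

definition cohomologous ::
  "'v::real_vector set \<Rightarrow> ('v \<Rightarrow> 'v \<Rightarrow> 'v) \<Rightarrow> nat \<Rightarrow> ('v list \<Rightarrow> 'v) \<Rightarrow> ('v list \<Rightarrow> 'v) \<Rightarrow> bool"
  where "cohomologous V br p f g \<longleftrightarrow>
    f \<in> cochains V (Suc p) \<and> g \<in> cochains V (Suc p) \<and>
    (\<exists>h\<in>cochains V p. \<forall>xs. set xs \<subseteq> V \<and> length xs = Suc p \<longrightarrow>
       f xs - g xs = ce_differential br h xs)"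


section \<open>Smooth manifolds\<close>

fun Ck_on :: "nat \<Rightarrow> 'a::real_normed_vector set \<Rightarrow> ('a \<Rightarrow> 'b::real_normed_vector) \<Rightarrow> bool"
  where
    "Ck_on 0 S f \<longleftrightarrow> continuous_on S f"
  | "Ck_on (Suc k) S f \<longleftrightarrow>
      (\<forall>x\<in>S. f differentiable (at x)) \<and>
      (\<forall>v. Ck_on k S (\<lambda>x. frechet_derivative f (at x) v))"

text \<open>Only meaningful for open \<open>S\<close>, since the derivatives are unrestricted.\<close>

definition smooth_on :: "'a::real_normed_vector set \<Rightarrow> ('a \<Rightarrow> 'b::real_normed_vector) \<Rightarrow> bool"
  where "smooth_on S f \<longleftrightarrow> (\<forall>k. Ck_on k S f)"

record ('m, 'n::finite) chart =
  chart_dom :: "'m set"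
  coords :: "'m \<Rightarrow> real ^ 'n"

definition chart_inv :: "('m, 'n::finite) chart \<Rightarrow> real ^ 'n \<Rightarrow> 'm"
  where "chart_inv c = inv_into (chart_dom c) (coords c)"

text \<open>
  The underlying set of the manifold is the type \<open>'m\<close>. The atlas \<open>A\<close> is not required to be
  maximal; every atlas determines the same smooth tensor fields and connections as its
  maximal extension.
\<close>

locale smooth_manifold =
  fixes A :: "('m::{t2_space, second_countable_topology}, 'n::finite) chart set"
  assumes open_dom: "c \<in> A \<Longrightarrow> open (chart_dom c)"
    and open_image: "c \<in> A \<Longrightarrow> open (coords c ` chart_dom c)"
    and homeo: "c \<in> A \<Longrightarrow>
      homeomorphism (chart_dom c) (coords c ` chart_dom c) (coords c) (chart_inv c)"
    and cover: "(\<Union>c\<in>A. chart_dom c) = UNIV"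
    and transition: "c \<in> A \<Longrightarrow> c' \<in> A \<Longrightarrow>
      smooth_on (coords c ` (chart_dom c \<inter> chart_dom c')) (coords c' \<circ> chart_inv c)"

definition smooth_in_chart :: "('m, 'n::finite) chart \<Rightarrow> ('m \<Rightarrow> real) \<Rightarrow> bool"
  where "smooth_in_chart c f \<longleftrightarrow> smooth_on (coords c ` chart_dom c) (f \<circ> chart_inv c)"

text \<open>\<open>pd c i f x\<close> is \<open>\<partial>f/\<partial>x\<^sup>i\<close> at the point \<open>x\<close>, where \<open>x\<^sup>i\<close> are the coordinates of \<open>c\<close>.\<close>

definition pd :: "('m, 'n::finite) chart \<Rightarrow> 'n \<Rightarrow> ('m \<Rightarrow> real) \<Rightarrow> 'm \<Rightarrow> real"
  where "pd c i f x = frechet_derivative (f \<circ> chart_inv c) (at (coords c x)) (axis i 1)"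

text \<open>\<open>jac c c' a i x\<close> is \<open>\<partial>x\<^sup>a/\<partial>x'\<^sup>i\<close>, with \<open>x\<^sup>a\<close> the coordinates of \<open>c\<close> and \<open>x'\<^sup>i\<close> those of \<open>c'\<close>.\<close>

definition jac :: "('m, 'n::finite) chart \<Rightarrow> ('m, 'n) chart \<Rightarrow> 'n \<Rightarrow> 'n \<Rightarrow> 'm \<Rightarrow> real"
  where "jac c c' a i = pd c' i (\<lambda>z. coords c z $ a)"


section \<open>Covariant tensor fields\<close>

text \<open>
  A tensor field is given by its components \<open>\<alpha> c x [i\<^sub>1, \<dots>, i\<^sub>k]\<close> at each point \<open>x\<close> in each
  chart \<open>c\<close> around \<open>x\<close>. The components transform by the tensor law under change of charts.
  All values outside this range of arguments are set to \<open>0\<close>, so that tensor fields are equal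
  iff they are equal as HOL functions.
\<close>

type_synonym ('m, 'n) tensor = "('m, 'n) chart \<Rightarrow> 'm \<Rightarrow> 'n list \<Rightarrow> real"

definition restrict_tensor ::
  "('m, 'n::finite) chart set \<Rightarrow> nat \<Rightarrow> ('m, 'n) tensor \<Rightarrow> ('m, 'n) tensor"
  where "restrict_tensor A k \<alpha> =
    (\<lambda>c x is. if c \<in> A \<and> x \<in> chart_dom c \<and> length is = k then \<alpha> c x is else 0)"

definition tensor_fields :: "('m, 'n::finite) chart set \<Rightarrow> nat \<Rightarrow> ('m, 'n) tensor set"
  where "tensor_fields A k = {\<alpha>.
    restrict_tensor A k \<alpha> = \<alpha> \<and>
    (\<forall>c\<in>A. \<forall>is. length is = k \<longrightarrow> smooth_in_chart c (\<lambda>x. \<alpha> c x is)) \<and>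
    (\<forall>c\<in>A. \<forall>c'\<in>A. \<forall>x\<in>chart_dom c \<inter> chart_dom c'. \<forall>is. length is = k \<longrightarrow>
       \<alpha> c' x is = (\<Sum>as | length as = k. (\<Prod>r<k. jac c c' (as ! r) (is ! r) x) * \<alpha> c x as))}"

text \<open>\<open>\<S>\<^sup>k(M)\<close> and the product of all \<open>\<S>\<^sup>k(M)\<close>.\<close>

definition sym_tensors :: "('m, 'n::finite) chart set \<Rightarrow> nat \<Rightarrow> ('m, 'n) tensor set"
  where "sym_tensors A k =
    {\<alpha> \<in> tensor_fields A k. \<forall>c x is js. mset is = mset js \<longrightarrow> \<alpha> c x is = \<alpha> c x js}"

definition hat_sym_tensors :: "('m, 'n::finite) chart set \<Rightarrow> (nat \<Rightarrow> ('m, 'n) tensor) set"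
  where "hat_sym_tensors A = {\<alpha>. \<forall>k. \<alpha> k \<in> sym_tensors A k}"

definition symmetrize :: "('n list \<Rightarrow> real) \<Rightarrow> 'n list \<Rightarrow> real"
  where "symmetrize T is =
    (\<Sum>\<sigma> | \<sigma> permutes {..<length is}. T (permute_list \<sigma> is)) / fact (length is)"

text \<open>
  As degrees cannot be recovered from the components (of the zero tensor, for instance),
  the operations below take them as arguments.
\<close>

definition sym_prod ::
  "('m, 'n::finite) chart set \<Rightarrow> nat \<Rightarrow> nat \<Rightarrow> ('m, 'n) tensor \<Rightarrow> ('m, 'n) tensor \<Rightarrow> ('m, 'n) tensor"
  where "sym_prod A k l \<alpha> \<beta> = restrict_tensor A (k + l)
    (\<lambda>c x. symmetrize (\<lambda>is. \<alpha> c x (take k is) * \<beta> c x (drop k is)))"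

definition hat_sym_prod ::
  "('m, 'n::finite) chart set \<Rightarrow>
   (nat \<Rightarrow> ('m, 'n) tensor) \<Rightarrow> (nat \<Rightarrow> ('m, 'n) tensor) \<Rightarrow> nat \<Rightarrow> ('m, 'n) tensor"
  where "hat_sym_prod A \<alpha> \<beta> m = (\<Sum>k\<le>m. sym_prod A k (m - k) (\<alpha> k) (\<beta> (m - k)))"


section \<open>Symplectic manifolds and symplectic connections\<close>

definition form_matrix :: "('m, 'n::finite) tensor \<Rightarrow> ('m, 'n) chart \<Rightarrow> 'm \<Rightarrow> real ^ 'n ^ 'n"
  where "form_matrix \<Omega> c x = (\<chi> i j. \<Omega> c x [i, j])"

locale symplectic_manifold = smooth_manifold A
  for A :: "('m::{t2_space, second_countable_topology}, 'n::finite) chart set" +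
  fixes \<Omega> :: "('m, 'n) tensor"
  assumes form_tensor: "\<Omega> \<in> tensor_fields A 2"
    and form_skew: "\<Omega> c x [i, j] = - \<Omega> c x [j, i]"
    and form_nondegenerate: "c \<in> A \<Longrightarrow> x \<in> chart_dom c \<Longrightarrow> invertible (form_matrix \<Omega> c x)"
    and form_closed: "c \<in> A \<Longrightarrow> x \<in> chart_dom c \<Longrightarrow>
      pd c i (\<lambda>z. \<Omega> c z [j, k]) x + pd c j (\<lambda>z. \<Omega> c z [k, i]) x
        + pd c k (\<lambda>z. \<Omega> c z [i, j]) x = 0"

text \<open>\<open>\<Omega>\<^sup>i\<^sup>j\<close>, with the sign convention \<open>\<Omega>\<^sup>i\<^sup>p \<Omega>\<^sub>p\<^sub>j = - \<delta>\<^sub>j\<^sup>i\<close>.\<close>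

definition form_up :: "('m, 'n::finite) tensor \<Rightarrow> ('m, 'n) chart \<Rightarrow> 'm \<Rightarrow> 'n \<Rightarrow> 'n \<Rightarrow> real"
  where "form_up \<Omega> c x i j = - matrix_inv (form_matrix \<Omega> c x) $ i $ j"

text \<open>
  An affine connection is given by its Christoffel symbols, \<open>\<Gamma> c x i j k\<close> being \<open>\<Gamma>\<^sub>i\<^sub>j\<^sup>k\<close> in
  \<open>\<nabla>\<^sub>i \<partial>\<^sub>j = \<Gamma>\<^sub>i\<^sub>j\<^sup>k \<partial>\<^sub>k\<close> at the point \<open>x\<close>. With primes denoting the chart \<open>c'\<close>, the transformation
  law is
  \<open>\<Gamma>'\<^sub>i\<^sub>j\<^sup>k = \<partial>x'\<^sup>k/\<partial>x\<^sup>d (\<partial>x\<^sup>a/\<partial>x'\<^sup>i \<partial>x\<^sup>b/\<partial>x'\<^sup>j \<Gamma>\<^sub>a\<^sub>b\<^sup>d + \<partial>\<^sup>2x\<^sup>d/\<partial>x'\<^sup>i\<partial>x'\<^sup>j)\<close>.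
\<close>

type_synonym ('m, 'n) christoffel = "('m, 'n) chart \<Rightarrow> 'm \<Rightarrow> 'n \<Rightarrow> 'n \<Rightarrow> 'n \<Rightarrow> real"

definition affine_connection ::
  "('m, 'n::finite) chart set \<Rightarrow> ('m, 'n) christoffel \<Rightarrow> bool"
  where "affine_connection A \<Gamma> \<longleftrightarrow>
    (\<forall>c\<in>A. \<forall>i j k. smooth_in_chart c (\<lambda>x. \<Gamma> c x i j k)) \<and>
    (\<forall>c\<in>A. \<forall>c'\<in>A. \<forall>x\<in>chart_dom c \<inter> chart_dom c'. \<forall>i j k.
       \<Gamma> c' x i j k =
         (\<Sum>d\<in>UNIV. jac c' c k d x *
            ((\<Sum>a\<in>UNIV. \<Sum>b\<in>UNIV. jac c c' a i x * jac c c' b j x * \<Gamma> c x a b d)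
              + pd c' i (jac c c' d j) x)))"

definition torsion_free :: "('m, 'n::finite) chart set \<Rightarrow> ('m, 'n) christoffel \<Rightarrow> bool"
  where "torsion_free A \<Gamma> \<longleftrightarrow>
    (\<forall>c\<in>A. \<forall>x\<in>chart_dom c. \<forall>i j k. \<Gamma> c x i j k = \<Gamma> c x j i k)"

text \<open>\<open>cov_deriv \<Gamma> \<alpha> c x i [j\<^sub>1, \<dots>, j\<^sub>k]\<close> is \<open>\<nabla>\<^sub>i \<alpha>\<close> with tensor indices \<open>j\<^sub>1 \<dots> j\<^sub>k\<close>.\<close>

definition cov_deriv ::
  "('m, 'n::finite) christoffel \<Rightarrow> ('m, 'n) tensor \<Rightarrow> ('m, 'n) chart \<Rightarrow> 'm \<Rightarrow> 'n \<Rightarrow> 'n list \<Rightarrow> real"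
  where "cov_deriv \<Gamma> \<alpha> c x i js =
    pd c i (\<lambda>z. \<alpha> c z js) x
      - (\<Sum>r<length js. \<Sum>m\<in>UNIV. \<Gamma> c x i (js ! r) m * \<alpha> c x (js[r := m]))"

definition symplectic_connection ::
  "('m, 'n::finite) chart set \<Rightarrow> ('m, 'n) tensor \<Rightarrow> ('m, 'n) christoffel \<Rightarrow> bool"
  where "symplectic_connection A \<Omega> \<Gamma> \<longleftrightarrow>
    affine_connection A \<Gamma> \<and> torsion_free A \<Gamma> \<and>
    (\<forall>c\<in>A. \<forall>x\<in>chart_dom c. \<forall>i j k. cov_deriv \<Gamma> \<Omega> c x i [j, k] = 0)"


section \<open>The operator \<open>\<delta>\<^sup>*\<close> and the two brackets\<close>

definition delta_star ::
  "('m, 'n::finite) chart set \<Rightarrow> ('m, 'n) christoffel \<Rightarrow> nat \<Rightarrow> ('m, 'n) tensor \<Rightarrow> ('m, 'n) tensor"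
  where "delta_star A \<Gamma> k \<alpha> = restrict_tensor A (k + 1)
    (\<lambda>c x is. - symmetrize (\<lambda>is. cov_deriv \<Gamma> \<alpha> c x (hd is) (tl is)) is)"

text \<open>
  In a list \<open>is\<close> of free indices, those of the first factor are \<open>take (k - 1) is\<close>. If \<open>k = 0\<close>
  or \<open>l = 0\<close>, the truncated subtractions are harmless because of the numerical factors
  \<open>k\<close> and \<open>l\<close>.
\<close>

definition alg_bracket ::
  "('m, 'n::finite) chart set \<Rightarrow> ('m, 'n) tensor \<Rightarrow> nat \<Rightarrow> nat \<Rightarrow>
   ('m, 'n) tensor \<Rightarrow> ('m, 'n) tensor \<Rightarrow> ('m, 'n) tensor"
  where "alg_bracket A \<Omega> k l \<alpha> \<beta> = restrict_tensor A (k + l - 2)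
    (\<lambda>c x is. real k * real l * symmetrize (\<lambda>is.
       \<Sum>p\<in>UNIV. \<alpha> c x (p # take (k - 1) is) *
         (\<Sum>q\<in>UNIV. form_up \<Omega> c x p q * \<beta> c x (drop (k - 1) is @ [q]))) is)"

text \<open>
  \<open>contract_nabla \<Omega> \<Gamma> k \<alpha> \<beta>\<close> is \<open>\<alpha>\<^sub>p\<^sub>(\<^sub>i\<^sub>1\<^sub>\<dots> \<nabla>\<^sup>p \<beta>\<^sub>\<dots>\<^sub>)\<close>, where \<open>\<alpha>\<close> has degree \<open>k\<close> and \<open>\<nabla>\<^sup>p = \<Omega>\<^sup>p\<^sup>q \<nabla>\<^sub>q\<close>.
\<close>

definition contract_nabla ::
  "('m, 'n::finite) tensor \<Rightarrow> ('m, 'n) christoffel \<Rightarrow> nat \<Rightarrow>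
   ('m, 'n) tensor \<Rightarrow> ('m, 'n) tensor \<Rightarrow> ('m, 'n) tensor"
  where "contract_nabla \<Omega> \<Gamma> k \<alpha> \<beta> c x = symmetrize (\<lambda>is.
    \<Sum>p\<in>UNIV. \<alpha> c x (p # take (k - 1) is) *
      (\<Sum>q\<in>UNIV. form_up \<Omega> c x p q * cov_deriv \<Gamma> \<beta> c x q (drop (k - 1) is)))"

definition schouten ::
  "('m, 'n::finite) chart set \<Rightarrow> ('m, 'n) tensor \<Rightarrow> ('m, 'n) christoffel \<Rightarrow> nat \<Rightarrow> nat \<Rightarrow>
   ('m, 'n) tensor \<Rightarrow> ('m, 'n) tensor \<Rightarrow> ('m, 'n) tensor"
  where "schouten A \<Omega> \<Gamma> k l \<alpha> \<beta> = restrict_tensor A (k + l - 1)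
    (\<lambda>c x is. - real k * contract_nabla \<Omega> \<Gamma> k \<alpha> \<beta> c x is
               + real l * contract_nabla \<Omega> \<Gamma> l \<beta> \<alpha> c x is)"

fun hat_delta_star ::
  "('m, 'n::finite) chart set \<Rightarrow> ('m, 'n) christoffel \<Rightarrow>
   (nat \<Rightarrow> ('m, 'n) tensor) \<Rightarrow> nat \<Rightarrow> ('m, 'n) tensor"
  where
    "hat_delta_star A \<Gamma> \<alpha> 0 = 0"
  | "hat_delta_star A \<Gamma> \<alpha> (Suc k) = delta_star A \<Gamma> k (\<alpha> k)"

definition hat_alg_bracket ::
  "('m, 'n::finite) chart set \<Rightarrow> ('m, 'n) tensor \<Rightarrow>
   (nat \<Rightarrow> ('m, 'n) tensor) \<Rightarrow> (nat \<Rightarrow> ('m, 'n) tensor) \<Rightarrow> nat \<Rightarrow> ('m, 'n) tensor"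
  where "hat_alg_bracket A \<Omega> \<alpha> \<beta> m =
    (\<Sum>k\<le>m + 2. alg_bracket A \<Omega> k (m + 2 - k) (\<alpha> k) (\<beta> (m + 2 - k)))"

definition hat_schouten ::
  "('m, 'n::finite) chart set \<Rightarrow> ('m, 'n) tensor \<Rightarrow> ('m, 'n) christoffel \<Rightarrow>
   (nat \<Rightarrow> ('m, 'n) tensor) \<Rightarrow> (nat \<Rightarrow> ('m, 'n) tensor) \<Rightarrow> nat \<Rightarrow> ('m, 'n) tensor"
  where "hat_schouten A \<Omega> \<Gamma> \<alpha> \<beta> m =
    (\<Sum>k\<le>m + 1. schouten A \<Omega> \<Gamma> k (m + 1 - k) (\<alpha> k) (\<beta> (m + 1 - k)))"

text \<open>Unary and binary operations, viewed as maps on lists of one or two arguments.\<close>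

definition cochain1 :: "('v \<Rightarrow> 'v) \<Rightarrow> 'v list \<Rightarrow> 'v"
  where "cochain1 f xs = f (xs ! 0)"

definition cochain2 :: "('v \<Rightarrow> 'v \<Rightarrow> 'v) \<Rightarrow> 'v list \<Rightarrow> 'v"
  where "cochain2 f xs = f (xs ! 0) (xs ! 1)"

end

theory Submission
  imports Defs
begin

text \<open>
  In a chart with coordinates \<open>x\<close>, and with the induced fibre coordinates \<open>y\<close> on the tangent bundle, a
  symmetric tensor \<open>\<alpha>\<close> of degree \<open>k\<close> is the function \<open>\<alpha>\<^sub>i\<^sub>1\<^sub>\<dots>\<^sub>i\<^sub>k y\<^sup>i\<^sup>1 \<cdots> y\<^sup>i\<^sup>k\<close>, which is polynomial in \<open>y\<close>.
  An element of the completed space becomes a power series, with the degree as exponent, whose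
  coefficients are such functions. Symmetrization disappears in this picture, the product of tensors
  becomes the product of series, and contraction with an index \<open>p\<close> becomes \<open>\<partial>/\<partial>y\<^sup>p\<close>. With the horizontal
  derivatives \<open>\<nabla>\<^sub>i = \<partial>/\<partial>x\<^sup>i - \<Gamma>\<^sub>i\<^sub>j\<^sup>m y\<^sup>j \<partial>/\<partial>y\<^sup>m\<close> one has

  \<open>\<delta>\<^sup>* \<alpha> = - y\<^sup>i \<nabla>\<^sub>i \<alpha>\<close>,

  \<open>(\<alpha>, \<beta>) = \<Omega>\<^sup>p\<^sup>q \<partial>\<^sub>p\<alpha> \<partial>\<^sub>q\<beta>\<close>,

  \<open>[[\<alpha>, \<beta>]] = \<Omega>\<^sup>p\<^sup>q (\<partial>\<^sub>p\<beta> \<nabla>\<^sub>q\<alpha> - \<partial>\<^sub>p\<alpha> \<nabla>\<^sub>q\<beta>)\<close>,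

  where \<open>\<partial>\<^sub>p = \<partial>/\<partial>y\<^sup>p\<close>. So \<open>\<delta>\<^sup>*\<close> is a vector field, hence a derivation (\<open>hat_delta_star_sym_prod\<close>).

  In \<open>(\<delta>\<^sup>*\<alpha>, \<beta>)\<close> the derivative \<open>\<partial>\<^sub>p\<close> either hits the factor \<open>y\<^sup>i\<close> of \<open>\<delta>\<^sup>*\<close>, which gives one half of the Schouten
  bracket, or it leaves it alone. Because of \<open>\<nabla>\<Omega> = 0\<close> the terms of the latter kind in \<open>(\<delta>\<^sup>*\<alpha>, \<beta>) + (\<alpha>, \<delta>\<^sup>*\<beta>)\<close>
  add up to \<open>\<delta>\<^sup>*(\<alpha>, \<beta>)\<close>. This is the coboundary formula (\<open>hat_schouten_coboundary\<close>).

  For the Jacobi identities, consider \<open>s [[\<cdot>, \<cdot>]] + t (\<cdot>, \<cdot>)\<close>. It is the bracket of a bivector field on the tangent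
  bundle, and by \<open>\<nabla>\<Omega> = 0\<close> and the absence of torsion all Christoffel symbols cancel from the coefficients
  (\<open>gen_pencil\<close>):

  \<open>{x, x} = 0\<close>, \<open>{x\<^sup>q, y\<^sup>p} = s \<Omega>\<^sup>p\<^sup>q\<close>, \<open>{y\<^sup>p, y\<^sup>r} = t \<Omega>\<^sup>p\<^sup>r - s y\<^sup>j \<partial>\<Omega>\<^sup>p\<^sup>r/\<partial>x\<^sup>j\<close>.

  Such a bracket satisfies the Jacobi identity if it does so on coordinate functions (\<open>bivector_jacobi\<close>). There
  the identity reduces to the Poisson condition for \<open>\<Omega>\<^sup>p\<^sup>q\<close> and to its derivatives along the \<open>x\<^sup>j\<close>. The Poisson
  condition is again a consequence of \<open>\<nabla>\<Omega> = 0\<close> for a connection without torsion (\<open>upper_poisson\<close>).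
  The explicit compatibility identity is the \<open>s t\<close> part of the Jacobi identity of the pencil.

  If \<open>\<Pi>\<close> is the difference of two symplectic connections, \<open>\<Omega>\<^sub>r\<^sub>p \<Pi>\<^sub>i\<^sub>j\<^sup>p\<close> is symmetric in all three indices, and
  contracting the cubic form \<open>h = - 1/3 \<Omega>\<^sub>r\<^sub>p \<Pi>\<^sub>i\<^sub>j\<^sup>p y\<^sup>i y\<^sup>j y\<^sup>r\<close> shows that the difference of the two operators
  \<open>\<delta>\<^sup>*\<close> is \<open>\<alpha> \<mapsto> (\<alpha>, h)\<close>, which is the coboundary of \<open>h\<close> (\<open>delta_star_diff\<close>).

  The passage between tensors and series rests on two facts. A symmetric tensor is determined by its
  polynomial (\<open>ev_eq_zeroD\<close>), so that equations can be checked on series in one chart. And the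
  transformation law of tensors says that the series is a function on the tangent bundle, that is, is
  invariant under \<open>y \<mapsto> J y\<close> for the Jacobian \<open>J\<close> (\<open>tensor_transformation\<close>, \<open>hat_sym_tensorsI\<close>); this
  is how the operations are seen to produce tensor fields again.
\<close>

text \<open>
  Below, \<open>\<Sum>i j. f i j\<close> is the sum over all values of the indices \<open>i\<close> and \<open>j\<close>, as in the summation
  convention.
\<close>

no_notation suminf (binder "\<Sum>" 10)

abbreviation sum_all :: "('i::finite \<Rightarrow> 'a::comm_monoid_add) \<Rightarrow> 'a" (binder "\<Sum>" 10)
  where "sum_all f \<equiv> sum f UNIV"

section \<open>Calculus of smooth functions on open sets\<close>

lemma Ck_on_cong:
  assumes "open S" "\<And>x. x \<in> S \<Longrightarrow> f x = g x" "Ck_on k S f"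
  shows "Ck_on k S g"
  using assms(2,3)
proof (induction k arbitrary: f g)
  case 0
  then show ?case using continuous_on_cong[of S S f g] by simp
next
  case (Suc k)
  have d: "f differentiable (at x)" if "x \<in> S" for x using Suc.prems that by simp
  have D: "(g has_derivative frechet_derivative f (at x)) (at x)" if "x \<in> S" for x
    using has_derivative_transform_within_open[of f "frechet_derivative f (at x)" x UNIV S g]
      d[OF that] frechet_derivative_works[of f "at x"] assms(1) that Suc.prems(1) by auto
  have e: "frechet_derivative f (at x) v = frechet_derivative g (at x) v" if "x \<in> S" for x v
    using frechet_derivative_at[OF D[OF that]] by simp
  have "Ck_on k S (\<lambda>x. frechet_derivative g (at x) v)" for v
    using Suc.IH[of "\<lambda>x. frechet_derivative f (at x) v"] e Suc.prems(2) by simp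
  then show ?case using differentiableI[OF D] by auto
qed

lemma smooth_on_cong:
  assumes "open S" "\<And>x. x \<in> S \<Longrightarrow> f x = g x" "smooth_on S f"
  shows "smooth_on S g"
  using assms Ck_on_cong unfolding smooth_on_def by blast

lemma Ck_on_pred: "Ck_on (Suc k) S f \<Longrightarrow> Ck_on k S f"
proof (induction k arbitrary: f)
  case 0
  then show ?case
    by (auto intro!: continuous_at_imp_continuous_on differentiable_imp_continuous_within)
next
  case (Suc k)
  then show ?case by simp
qed

lemma Ck_on_const: "Ck_on k S (\<lambda>x. a)"
  by (induction k arbitrary: a) auto

text \<open>
  As the derivatives in the definition of \<open>Ck_on\<close> are the ones chosen by \<open>frechet_derivative\<close>,
  a formula for the derivative has to be transported to them first.
\<close>

lemma Ck_on_SucI: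
  assumes "open S" "\<And>x. x \<in> S \<Longrightarrow> (f has_derivative D x) (at x)" "\<And>v. Ck_on k S (\<lambda>x. D x v)"
  shows "Ck_on (Suc k) S f"
proof -
  have "Ck_on k S (\<lambda>x. frechet_derivative f (at x) v)" for v
    by (rule Ck_on_cong[OF assms(1) _ assms(3)[of v]])
      (simp add: frechet_derivative_at[OF assms(2), symmetric])
  then show ?thesis using differentiableI[OF assms(2)] by auto
qed

lemma Ck_on_add:
  assumes "open S" "Ck_on k S f" "Ck_on k S g"
  shows "Ck_on k S (\<lambda>x. f x + g x)"
  using assms(2,3)
proof (induction k arbitrary: f g)
  case 0
  then show ?case by (simp add: continuous_on_add)
next
  case (Suc k)
  show ?case
  proof (rule Ck_on_SucI[OF assms(1)])
    show "((\<lambda>x. f x + g x) has_derivative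
        (\<lambda>v. frechet_derivative f (at x) v + frechet_derivative g (at x) v)) (at x)" if "x \<in> S" for x
      using Suc.prems that frechet_derivative_works by (auto intro!: derivative_eq_intros)
  qed (use Suc in simp)
qed

lemma Ck_on_mult:
  fixes f g :: "'a::real_normed_vector \<Rightarrow> real"
  assumes "open S" "Ck_on k S f" "Ck_on k S g"
  shows "Ck_on k S (\<lambda>x. f x * g x)"
  using assms(2,3)
proof (induction k arbitrary: f g)
  case 0
  then show ?case by (simp add: continuous_on_mult)
next
  case (Suc k)
  show ?case
  proof (rule Ck_on_SucI[OF assms(1)])
    show "((\<lambda>x. f x * g x) has_derivative
        (\<lambda>v. f x * frechet_derivative g (at x) v + frechet_derivative f (at x) v * g x)) (at x)"
      if "x \<in> S" for x
      using Suc.prems that frechet_derivative_works by (auto intro!: derivative_eq_intros)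
    show "Ck_on k S (\<lambda>x. f x * frechet_derivative g (at x) v + frechet_derivative f (at x) v * g x)" for v
      using Suc Ck_on_pred[OF Suc.prems(1)] Ck_on_pred[OF Suc.prems(2)]
      by (intro Ck_on_add assms(1)) auto
  qed
qed

lemma Ck_on_inverse:
  fixes f :: "'a::real_normed_vector \<Rightarrow> real"
  assumes "open S" "Ck_on k S f" "\<And>x. x \<in> S \<Longrightarrow> f x \<noteq> 0"
  shows "Ck_on k S (\<lambda>x. inverse (f x))"
  using assms(2,3)
proof (induction k arbitrary: f)
  case 0
  then show ?case by (auto intro!: continuous_intros)
next
  case (Suc k)
  show ?case
  proof (rule Ck_on_SucI[OF assms(1)])
    show "((\<lambda>x. inverse (f x)) has_derivative
        (\<lambda>v. - 1 * (inverse (f x) * (frechet_derivative f (at x) v * inverse (f x))))) (at x)"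
      if "x \<in> S" for x
      using Suc.prems that frechet_derivative_works
      by (auto intro!: derivative_eq_intros simp: algebra_simps)
    show "Ck_on k S (\<lambda>x. - 1 * (inverse (f x) * (frechet_derivative f (at x) v * inverse (f x))))" for v
      using Suc.IH[OF Ck_on_pred[OF Suc.prems(1)] Suc.prems(2)] Suc.prems(1)
      by (intro Ck_on_mult Ck_on_const assms(1)) auto
  qed
qed

lemma Ck_on_component:
  fixes f :: "'a::real_normed_vector \<Rightarrow> real ^ 'n"
  assumes "open S" "Ck_on k S f"
  shows "Ck_on k S (\<lambda>x. f x $ i)"
  using assms(2)
proof (induction k arbitrary: f)
  case 0
  then show ?case by (auto intro!: continuous_intros)
next
  case (Suc k)
  show ?case
  proof (rule Ck_on_SucI[OF assms(1)])
    show "((\<lambda>x. f x $ i) has_derivative (\<lambda>v. frechet_derivative f (at x) v $ i)) (at x)" if "x \<in> S" for x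
      using Suc.prems that frechet_derivative_works
      by (auto intro!: bounded_linear.has_derivative[OF bounded_linear_vec_nth])
  qed (use Suc in simp)
qed

lemma smooth_on_const: "smooth_on S (\<lambda>x. a)"
  by (simp add: smooth_on_def Ck_on_const)

lemma smooth_on_add:
  "open S \<Longrightarrow> smooth_on S f \<Longrightarrow> smooth_on S g \<Longrightarrow> smooth_on S (\<lambda>x. f x + g x)"
  by (simp add: smooth_on_def Ck_on_add)

lemma smooth_on_mult:
  fixes f g :: "'a::real_normed_vector \<Rightarrow> real"
  shows "open S \<Longrightarrow> smooth_on S f \<Longrightarrow> smooth_on S g \<Longrightarrow> smooth_on S (\<lambda>x. f x * g x)"
  by (simp add: smooth_on_def Ck_on_mult)

lemma smooth_on_inverse:
  fixes f :: "'a::real_normed_vector \<Rightarrow> real"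
  shows "open S \<Longrightarrow> smooth_on S f \<Longrightarrow> (\<And>x. x \<in> S \<Longrightarrow> f x \<noteq> 0) \<Longrightarrow> smooth_on S (\<lambda>x. inverse (f x))"
  by (simp add: smooth_on_def Ck_on_inverse)

lemma smooth_on_component:
  fixes f :: "'a::real_normed_vector \<Rightarrow> real ^ 'n"
  shows "open S \<Longrightarrow> smooth_on S f \<Longrightarrow> smooth_on S (\<lambda>x. f x $ i)"
  by (simp add: smooth_on_def Ck_on_component)

lemma smooth_on_differentiable: "smooth_on S f \<Longrightarrow> x \<in> S \<Longrightarrow> f differentiable (at x)"
  unfolding smooth_on_def by (metis Ck_on.simps(2))

lemma smooth_on_frechet_derivative:
  "smooth_on S f \<Longrightarrow> smooth_on S (\<lambda>x. frechet_derivative f (at x) v)"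
  unfolding smooth_on_def by (metis Ck_on.simps(2))

lemma smooth_on_continuous_on: "smooth_on S f \<Longrightarrow> continuous_on S f"
  unfolding smooth_on_def by (metis Ck_on.simps(1))

lemma has_real_derivative_along_line:
  fixes f :: "'a::real_normed_vector \<Rightarrow> real"
  assumes "f differentiable (at (p + s *\<^sub>R v))"
  shows "((\<lambda>s. f (p + s *\<^sub>R v)) has_real_derivative frechet_derivative f (at (p + s *\<^sub>R v)) v) (at s)"
proof -
  have D: "(f has_derivative frechet_derivative f (at (p + s *\<^sub>R v))) (at (p + s *\<^sub>R v))"
    using assms frechet_derivative_works by blast
  have "((\<lambda>s. p + s *\<^sub>R v) has_derivative (\<lambda>h. h *\<^sub>R v)) (at s)"
    by (auto intro!: derivative_eq_intros)
  from diff_chain_at[OF this D]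
  have "((\<lambda>s. f (p + s *\<^sub>R v)) has_derivative
      (\<lambda>h. frechet_derivative f (at (p + s *\<^sub>R v)) (h *\<^sub>R v))) (at s)"
    by (simp add: o_def)
  moreover have "frechet_derivative f (at (p + s *\<^sub>R v)) (h *\<^sub>R v) =
      frechet_derivative f (at (p + s *\<^sub>R v)) v * h" for h
    using linear_frechet_derivative[OF assms] by (simp add: linear_scale)
  ultimately show ?thesis by (simp add: has_field_derivative_def)
qed

text \<open>
  Two applications of the mean value theorem express the second difference of \<open>f\<close> over the
  parallelogram spanned by \<open>h v\<close> and \<open>h w\<close> by one value of \<open>\<partial>\<^sub>w \<partial>\<^sub>v f\<close> inside it. As the second
  difference is symmetric in \<open>v\<close> and \<open>w\<close>, letting \<open>h\<close> tend to \<open>0\<close> gives the symmetry of second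
  derivatives.
\<close>

lemma second_difference_mean_value:
  fixes f :: "'a::real_normed_vector \<Rightarrow> real"
  assumes sm: "smooth_on S f" and h: "h > 0"
    and para: "\<And>s t. 0 \<le> s \<Longrightarrow> s \<le> h \<Longrightarrow> 0 \<le> t \<Longrightarrow> t \<le> h \<Longrightarrow> x + s *\<^sub>R v + t *\<^sub>R w \<in> S"
  shows "\<exists>s t. 0 < s \<and> s < h \<and> 0 < t \<and> t < h \<and>
    f (x + h *\<^sub>R v + h *\<^sub>R w) - f (x + h *\<^sub>R v) - f (x + h *\<^sub>R w) + f x =
      h * h * frechet_derivative (\<lambda>z. frechet_derivative f (at z) v) (at (x + s *\<^sub>R v + t *\<^sub>R w)) w"
proof -
  define g where "g = (\<lambda>z. frechet_derivative f (at z) v)"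
  have df: "f differentiable (at (x + s *\<^sub>R v + t *\<^sub>R w))"
    and dg: "g differentiable (at (x + s *\<^sub>R v + t *\<^sub>R w))"
    if "0 \<le> s" "s \<le> h" "0 \<le> t" "t \<le> h" for s t
    using smooth_on_differentiable[OF sm] smooth_on_differentiable[OF smooth_on_frechet_derivative[OF sm]]
      para[OF that] unfolding g_def by auto
  define \<phi> where "\<phi> = (\<lambda>s. f (x + s *\<^sub>R v + h *\<^sub>R w) - f (x + s *\<^sub>R v))"
  have "(\<phi> has_real_derivative g (x + s *\<^sub>R v + h *\<^sub>R w) - g (x + s *\<^sub>R v)) (at s)"
    if "0 \<le> s" "s \<le> h" for s
    using has_real_derivative_along_line[of f "x + h *\<^sub>R w" s v]
      has_real_derivative_along_line[of f x s v] df[of s h] df[of s 0] that h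
    unfolding \<phi>_def g_def by (intro DERIV_diff) (auto simp: add_ac)
  from MVT2[OF h this] obtain s where s: "0 < s" "s < h"
    "\<phi> h - \<phi> 0 = h * (g (x + s *\<^sub>R v + h *\<^sub>R w) - g (x + s *\<^sub>R v))" by auto
  have "((\<lambda>t. g (x + s *\<^sub>R v + t *\<^sub>R w)) has_real_derivative
      frechet_derivative g (at (x + s *\<^sub>R v + t *\<^sub>R w)) w) (at t)" if "0 \<le> t" "t \<le> h" for t
    using has_real_derivative_along_line[of g "x + s *\<^sub>R v" t w] dg[of s t] that s by auto
  from MVT2[OF h this] obtain t where t: "0 < t" "t < h"
    "g (x + s *\<^sub>R v + h *\<^sub>R w) - g (x + s *\<^sub>R v + 0 *\<^sub>R w) =
      h * frechet_derivative g (at (x + s *\<^sub>R v + t *\<^sub>R w)) w" by auto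
  have "f (x + h *\<^sub>R v + h *\<^sub>R w) - f (x + h *\<^sub>R v) - f (x + h *\<^sub>R w) + f x = \<phi> h - \<phi> 0"
    by (simp add: \<phi>_def)
  also have "\<dots> = h * h * frechet_derivative g (at (x + s *\<^sub>R v + t *\<^sub>R w)) w"
    using s(3) t(3) by simp
  finally show ?thesis using s t unfolding g_def by blast
qed

lemma frechet_derivative_commute:
  fixes f :: "'a::real_normed_vector \<Rightarrow> real"
  assumes "open S" "smooth_on S f" "x \<in> S"
  shows "frechet_derivative (\<lambda>z. frechet_derivative f (at z) v) (at x) w =
    frechet_derivative (\<lambda>z. frechet_derivative f (at z) w) (at x) v"
proof (rule ccontr)
  define G where "G = (\<lambda>v w x. frechet_derivative (\<lambda>z. frechet_derivative f (at z) v) (at x) w)"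
  assume "\<not> ?thesis"
  then have ne: "G v w x \<noteq> G w v x" by (simp add: G_def)
  define e where "e = \<bar>G v w x - G w v x\<bar> / 2"
  have e: "e > 0" using ne by (simp add: e_def)
  have cont: "continuous_on S (G a b)" for a b
    unfolding G_def by (intro smooth_on_continuous_on smooth_on_frechet_derivative assms(2))
  have near: "\<exists>d>0. \<forall>y. dist y x < d \<longrightarrow> dist (G a b y) (G a b x) < e" for a b
    using cont[of a b] assms(1,3) e
    by (metis continuous_on_eq_continuous_at continuous_at_eps_delta)
  obtain d1 where d1: "d1 > 0" "\<And>y. dist y x < d1 \<Longrightarrow> dist (G v w y) (G v w x) < e"
    using near[of v w] by blast
  obtain d2 where d2: "d2 > 0" "\<And>y. dist y x < d2 \<Longrightarrow> dist (G w v y) (G w v x) < e"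
    using near[of w v] by blast
  obtain d3 where d3: "d3 > 0" "ball x d3 \<subseteq> S"
    using assms(1,3) openE by blast
  define d where "d = min d1 (min d2 d3)"
  have d: "d > 0" using d1 d2 d3 by (simp add: d_def)
  \<comment> \<open>small enough for the parallelogram to lie in the ball of radius \<open>d\<close> around \<open>x\<close>\<close>
  define h where "h = d / (2 * (norm v + norm w + 1))"
  have h: "h > 0" using d by (simp add: h_def add_nonneg_pos)
  have close: "dist (x + s *\<^sub>R a + t *\<^sub>R b) x < d"
    if "0 \<le> s" "s \<le> h" "0 \<le> t" "t \<le> h" "norm a + norm b = norm v + norm w" for s t a b
  proof -
    have "dist (x + s *\<^sub>R a + t *\<^sub>R b) x \<le> s * norm a + t * norm b"
      using norm_triangle_ineq[of "s *\<^sub>R a" "t *\<^sub>R b"] that by (simp add: dist_norm add.assoc)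
    also have "\<dots> \<le> h * norm a + h * norm b"
      using that by (intro add_mono mult_right_mono) auto
    also have "\<dots> = h * (norm v + norm w)" using that by (simp add: distrib_left[symmetric])
    also have "\<dots> < h * (2 * (norm v + norm w + 1))"
      using h by (intro mult_strict_left_mono) (auto simp: add_nonneg_pos)
    also have "\<dots> = d"
    proof -
      have "2 * (norm v + norm w + 1) > 0"
        by (simp add: add_nonneg_pos)
      then have "2 * (norm v + norm w + 1) \<noteq> 0" by simp
      then show ?thesis
        by (simp only: h_def times_divide_eq_left nonzero_mult_div_cancel_right simp_thms)
    qed
    finally show ?thesis .
  qed
  have inS: "x + s *\<^sub>R a + t *\<^sub>R b \<in> S"
    if "0 \<le> s" "s \<le> h" "0 \<le> t" "t \<le> h" "norm a + norm b = norm v + norm w" for s t a b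
    using close[OF that] d3 by (auto simp: d_def dist_commute subset_iff)
  obtain s t where st: "0 < s" "s < h" "0 < t" "t < h"
    "f (x + h *\<^sub>R v + h *\<^sub>R w) - f (x + h *\<^sub>R v) - f (x + h *\<^sub>R w) + f x =
      h * h * G v w (x + s *\<^sub>R v + t *\<^sub>R w)"
    using second_difference_mean_value[OF assms(2) h, of x v w] inS unfolding G_def by blast
  obtain s' t' where st': "0 < s'" "s' < h" "0 < t'" "t' < h"
    "f (x + h *\<^sub>R w + h *\<^sub>R v) - f (x + h *\<^sub>R w) - f (x + h *\<^sub>R v) + f x =
      h * h * G w v (x + s' *\<^sub>R w + t' *\<^sub>R v)"
    using second_difference_mean_value[OF assms(2) h, of x w v] inS unfolding G_def
    by (metis add.commute)
  have "h * h * G v w (x + s *\<^sub>R v + t *\<^sub>R w) = h * h * G w v (x + s' *\<^sub>R w + t' *\<^sub>R v)"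
    using st(5) st'(5) by (simp add: algebra_simps)
  then have eq: "G v w (x + s *\<^sub>R v + t *\<^sub>R w) = G w v (x + s' *\<^sub>R w + t' *\<^sub>R v)" using h by simp
  have "dist (x + s *\<^sub>R v + t *\<^sub>R w) x < d" "dist (x + s' *\<^sub>R w + t' *\<^sub>R v) x < d"
    using close[of s t v w] close[of s' t' w v] st st' by auto
  then have "\<bar>G v w (x + s *\<^sub>R v + t *\<^sub>R w) - G v w x\<bar> < e" "\<bar>G w v (x + s' *\<^sub>R w + t' *\<^sub>R v) - G w v x\<bar> < e"
    using d1(2)[of "x + s *\<^sub>R v + t *\<^sub>R w"] d2(2)[of "x + s' *\<^sub>R w + t' *\<^sub>R v"]
    by (auto simp: d_def dist_real_def)
  then show False using eq unfolding e_def by (auto simp: field_simps abs_if split: if_splits)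
qed

section \<open>Partial derivatives in charts\<close>

definition diff_at :: "('m, 'n::finite) chart \<Rightarrow> ('m \<Rightarrow> real) \<Rightarrow> 'm \<Rightarrow> bool"
  where "diff_at c f x \<longleftrightarrow> (f \<circ> chart_inv c) differentiable (at (coords c x))"

definition coord_line :: "('m, 'n::finite) chart \<Rightarrow> 'n \<Rightarrow> 'm \<Rightarrow> real \<Rightarrow> 'm"
  where "coord_line c i x t = chart_inv c (coords c x + t *\<^sub>R axis i 1)"

text \<open>
  Partial derivatives are derivatives along coordinate lines. In this form the product and chain
  rules for real functions of one real variable apply to them.
\<close>

lemma DERIV_coord_line:
  assumes "diff_at c f x"
  shows "((\<lambda>t. f (coord_line c i x t)) has_real_derivative pd c i f x) (at 0)"
  using has_real_derivative_along_line[of "f \<circ> chart_inv c" "coords c x" 0 "axis i 1"] assms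
  by (simp add: diff_at_def pd_def coord_line_def)

lemma pd_eqI:
  assumes "diff_at c f x" "((\<lambda>t. f (coord_line c i x t)) has_real_derivative D) (at 0)"
  shows "pd c i f x = D"
  using DERIV_unique[OF DERIV_coord_line[OF assms(1)] assms(2)] .

context smooth_manifold
begin

lemma chart_inv_coords [simp]: "c \<in> A \<Longrightarrow> x \<in> chart_dom c \<Longrightarrow> chart_inv c (coords c x) = x"
  using homeomorphism_apply1[OF homeo] by blast

lemma coords_chart_inv [simp]:
  "c \<in> A \<Longrightarrow> u \<in> coords c ` chart_dom c \<Longrightarrow> coords c (chart_inv c u) = u"
  using homeomorphism_apply2[OF homeo] by blast

lemma chart_inv_in_dom: "c \<in> A \<Longrightarrow> u \<in> coords c ` chart_dom c \<Longrightarrow> chart_inv c u \<in> chart_dom c"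
  by auto

lemma coord_line_0 [simp]: "c \<in> A \<Longrightarrow> x \<in> chart_dom c \<Longrightarrow> coord_line c i x 0 = x"
  by (simp add: coord_line_def)

lemma eventually_coord_line_in:
  assumes "c \<in> A" "x \<in> chart_dom c" "open U" "x \<in> U"
  shows "\<forall>\<^sub>F t in nhds 0. coord_line c i x t \<in> U"
proof -
  have "continuous_on (coords c ` chart_dom c) (chart_inv c)"
    using homeo[OF assms(1)] homeomorphism_cont2 by blast
  then have "isCont (chart_inv c) (coords c x + 0 *\<^sub>R axis i 1)"
    using open_image[OF assms(1)] assms(2) continuous_on_eq_continuous_at by auto
  moreover have "isCont (\<lambda>t. coords c x + t *\<^sub>R axis i 1) 0"
    by (intro continuous_intros)
  ultimately have "isCont (coord_line c i x) 0"
    using isCont_o2[of 0 "\<lambda>t. coords c x + t *\<^sub>R axis i 1" "chart_inv c"]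
    by (simp add: coord_line_def[abs_def])
  then have "(coord_line c i x \<longlongrightarrow> x) (nhds 0)"
    using assms(1,2) tendsto_at_iff_tendsto_nhds[of "coord_line c i x" 0]
    by (simp add: isCont_def)
  then show ?thesis using assms(3,4) by (rule topological_tendstoD)
qed

lemma smooth_in_chart_cong:
  assumes "c \<in> A" "\<And>x. x \<in> chart_dom c \<Longrightarrow> f x = g x" "smooth_in_chart c f"
  shows "smooth_in_chart c g"
  unfolding smooth_in_chart_def
proof (rule smooth_on_cong[OF open_image[OF assms(1)]])
  show "smooth_on (coords c ` chart_dom c) (f \<circ> chart_inv c)"
    using assms(3) by (simp add: smooth_in_chart_def)
qed (simp add: assms(2) chart_inv_in_dom[OF assms(1)])

lemma smooth_in_chart_const: "smooth_in_chart c (\<lambda>x. a)"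
  by (simp add: smooth_in_chart_def o_def smooth_on_const)

lemma smooth_in_chart_add:
  "c \<in> A \<Longrightarrow> smooth_in_chart c f \<Longrightarrow> smooth_in_chart c g \<Longrightarrow> smooth_in_chart c (\<lambda>x. f x + g x)"
  by (simp add: smooth_in_chart_def o_def smooth_on_add open_image)

lemma smooth_in_chart_mult:
  "c \<in> A \<Longrightarrow> smooth_in_chart c f \<Longrightarrow> smooth_in_chart c g \<Longrightarrow> smooth_in_chart c (\<lambda>x. f x * g x)"
  by (simp add: smooth_in_chart_def o_def smooth_on_mult open_image)

lemma smooth_in_chart_inverse:
  "c \<in> A \<Longrightarrow> smooth_in_chart c f \<Longrightarrow> (\<And>x. x \<in> chart_dom c \<Longrightarrow> f x \<noteq> 0) \<Longrightarrow>
    smooth_in_chart c (\<lambda>x. inverse (f x))"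
  unfolding smooth_in_chart_def o_def
  by (rule smooth_on_inverse) (auto simp: open_image)

lemma smooth_in_chart_minus:
  "c \<in> A \<Longrightarrow> smooth_in_chart c f \<Longrightarrow> smooth_in_chart c (\<lambda>x. - f x)"
  using smooth_in_chart_mult[OF _ smooth_in_chart_const[of c "-1"], of f] by simp

lemma smooth_in_chart_diff:
  "c \<in> A \<Longrightarrow> smooth_in_chart c f \<Longrightarrow> smooth_in_chart c g \<Longrightarrow> smooth_in_chart c (\<lambda>x. f x - g x)"
  using smooth_in_chart_add[OF _ _ smooth_in_chart_minus, of c f g] by simp

lemma smooth_in_chart_sum:
  "c \<in> A \<Longrightarrow> (\<And>i. i \<in> I \<Longrightarrow> smooth_in_chart c (f i)) \<Longrightarrow> smooth_in_chart c (\<lambda>x. \<Sum>i\<in>I. f i x)"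
  by (induction I rule: infinite_finite_induct)
    (simp_all add: smooth_in_chart_const smooth_in_chart_add)

lemma smooth_in_chart_prod:
  "c \<in> A \<Longrightarrow> (\<And>i. i \<in> I \<Longrightarrow> smooth_in_chart c (f i)) \<Longrightarrow> smooth_in_chart c (\<lambda>x. \<Prod>i\<in>I. f i x)"
  by (induction I rule: infinite_finite_induct)
    (simp_all add: smooth_in_chart_const smooth_in_chart_mult)

lemma smooth_in_chart_diff_at: "smooth_in_chart c f \<Longrightarrow> x \<in> chart_dom c \<Longrightarrow> diff_at c f x"
  unfolding smooth_in_chart_def diff_at_def by (auto intro: smooth_on_differentiable)

lemma pd_chart_inv:
  "c \<in> A \<Longrightarrow> u \<in> coords c ` chart_dom c \<Longrightarrow>
    pd c i f (chart_inv c u) = frechet_derivative (f \<circ> chart_inv c) (at u) (axis i 1)"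
  by (simp add: pd_def)

lemma smooth_in_chart_pd:
  assumes "c \<in> A" "smooth_in_chart c f"
  shows "smooth_in_chart c (pd c i f)"
  unfolding smooth_in_chart_def
proof (rule smooth_on_cong[OF open_image[OF assms(1)]])
  show "smooth_on (coords c ` chart_dom c)
      (\<lambda>u. frechet_derivative (f \<circ> chart_inv c) (at u) (axis i 1))"
    using assms(2) by (simp add: smooth_in_chart_def smooth_on_frechet_derivative)
qed (simp add: pd_chart_inv[OF assms(1), symmetric])

lemma pd_local:
  assumes "c \<in> A" "x \<in> chart_dom c" "diff_at c f x"
    and "\<And>z. z \<in> chart_dom c \<Longrightarrow> f z = g z"
  shows "pd c i f x = pd c i g x"
proof -
  have "frechet_derivative (f \<circ> chart_inv c) (at (coords c x)) =
      frechet_derivative (g \<circ> chart_inv c) (at (coords c x))"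
    using assms(3) unfolding diff_at_def
    by (rule frechet_derivative_transform_within_open[OF _ open_image[OF assms(1)]])
      (use assms in auto)
  then show ?thesis by (simp add: pd_def)
qed

lemma pd_commute:
  assumes "c \<in> A" "x \<in> chart_dom c" "smooth_in_chart c f"
  shows "pd c i (pd c j f) x = pd c j (pd c i f) x"
proof -
  let ?F = "f \<circ> chart_inv c" and ?S = "coords c ` chart_dom c"
  have sm: "smooth_on ?S ?F" using assms(3) by (simp add: smooth_in_chart_def)
  have "pd c i (pd c j f) x =
      frechet_derivative (\<lambda>u. frechet_derivative ?F (at u) (axis j 1)) (at (coords c x)) (axis i 1)"
    for i j
  proof -
    have "frechet_derivative (\<lambda>u. frechet_derivative ?F (at u) (axis j 1)) (at (coords c x)) =
        frechet_derivative (pd c j f \<circ> chart_inv c) (at (coords c x))"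
      by (rule frechet_derivative_transform_within_open[OF _ open_image[OF assms(1)]])
        (use assms sm in \<open>auto intro!: smooth_on_differentiable[OF smooth_on_frechet_derivative[OF sm]]
          simp: pd_chart_inv\<close>)
    then show ?thesis by (simp add: pd_def)
  qed
  then show ?thesis
    using frechet_derivative_commute[OF open_image[OF assms(1)] sm] assms(2) by auto
qed


subsection \<open>Change of charts\<close>

lemma open_overlap_image:
  assumes "c \<in> A" "c' \<in> A"
  shows "open (coords c ` (chart_dom c \<inter> chart_dom c'))"
proof -
  have "openin (top_of_set (coords c ` chart_dom c)) (coords c ` (chart_dom c \<inter> chart_dom c'))"
    using homeomorphism_imp_open_map[OF homeo[OF assms(1)]] open_dom[OF assms(2)]
    by (auto simp: openin_open)
  then show ?thesis using open_image[OF assms(1)] openin_open_trans by blast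
qed

lemma smooth_on_coords:
  assumes "c \<in> A" "c' \<in> A"
  shows "smooth_on (coords c' ` (chart_dom c' \<inter> chart_dom c)) ((\<lambda>z. coords c z $ a) \<circ> chart_inv c')"
  using smooth_on_component[OF open_overlap_image[OF assms(2,1)] transition[OF assms(2,1)], of a]
  by (simp add: o_def)

lemma diff_at_coords:
  assumes "c \<in> A" "c' \<in> A" "x \<in> chart_dom c" "x \<in> chart_dom c'"
  shows "diff_at c' (\<lambda>z. coords c z $ a) x"
  unfolding diff_at_def by (rule smooth_on_differentiable[OF smooth_on_coords[OF assms(1,2)]])
    (use assms in auto)

lemma diff_at_jac:
  assumes "c \<in> A" "c' \<in> A" "x \<in> chart_dom c" "x \<in> chart_dom c'"
  shows "diff_at c' (jac c c' a j) x"
proof -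
  let ?W = "coords c' ` (chart_dom c' \<inter> chart_dom c)"
  let ?\<phi> = "(\<lambda>z. coords c z $ a) \<circ> chart_inv c'"
  have "smooth_on ?W (jac c c' a j \<circ> chart_inv c')"
  proof (rule smooth_on_cong[OF open_overlap_image[OF assms(2,1)]])
    show "smooth_on ?W (\<lambda>u. frechet_derivative ?\<phi> (at u) (axis j 1))"
      by (rule smooth_on_frechet_derivative[OF smooth_on_coords[OF assms(1,2)]])
  qed (use assms(2) in \<open>auto simp: jac_def pd_def\<close>)
  then show ?thesis unfolding diff_at_def
    by (rule smooth_on_differentiable) (use assms in auto)
qed

text \<open>
  The transition map is smooth near the point, and its derivative has the entries \<open>jac c c'\<close>.
\<close>

lemma chain_rule:
  assumes "c \<in> A" "c' \<in> A" "x \<in> chart_dom c" "x \<in> chart_dom c'" "diff_at c f x"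
  shows "diff_at c' f x"
    and "pd c' i f x = (\<Sum>a. jac c c' a i x * pd c a f x)"
proof -
  let ?W = "coords c' ` (chart_dom c' \<inter> chart_dom c)"
  let ?u = "coords c' x"
  define \<phi> where "\<phi> = coords c \<circ> chart_inv c'"
  define F where "F = f \<circ> chart_inv c"
  let ?\<phi>' = "frechet_derivative \<phi> (at ?u)"
  let ?F' = "frechet_derivative F (at (coords c x))"
  have W: "?u \<in> ?W" using assms by auto
  have d\<phi>: "\<phi> differentiable (at ?u)"
    unfolding \<phi>_def by (rule smooth_on_differentiable[OF transition[OF assms(2,1)] W])
  have D\<phi>: "(\<phi> has_derivative ?\<phi>') (at ?u)"
    using d\<phi> frechet_derivative_works by blast
  have u: "\<phi> ?u = coords c x" using assms by (simp add: \<phi>_def)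
  have dF: "F differentiable (at (\<phi> ?u))" using assms(5) u by (simp add: F_def diff_at_def)
  have DF: "(F has_derivative ?F') (at (\<phi> ?u))"
    using dF frechet_derivative_works u by metis
  have D: "(f \<circ> chart_inv c' has_derivative ?F' \<circ> ?\<phi>') (at ?u)"
    using diff_chain_at[OF D\<phi> DF]
  proof (rule has_derivative_transform_within_open[OF _ open_overlap_image[OF assms(2,1)] W])
    fix u assume "u \<in> ?W"
    then show "(F \<circ> \<phi>) u = (f \<circ> chart_inv c') u" using assms(1,2) by (auto simp: F_def \<phi>_def)
  qed
  show "diff_at c' f x" unfolding diff_at_def by (rule differentiableI[OF D])
  have pd: "pd c' i f x = ?F' (?\<phi>' (axis i 1))"
    unfolding pd_def frechet_derivative_at[OF D, symmetric] by simp
  have lin: "linear ?F'" using linear_frechet_derivative[OF dF] u by simp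
  have j: "jac c c' a i x = ?\<phi>' (axis i 1) $ a" for a
  proof -
    have "((\<lambda>u. \<phi> u $ a) has_derivative (\<lambda>v. ?\<phi>' v $ a)) (at ?u)"
      by (rule bounded_linear.has_derivative[OF bounded_linear_vec_nth D\<phi>])
    from fun_cong[OF frechet_derivative_at[OF this], of "axis i 1"] show ?thesis
      unfolding jac_def pd_def \<phi>_def o_def by (rule sym)
  qed
  have "?F' (?\<phi>' (axis i 1)) = ?F' (\<Sum>a. (?\<phi>' (axis i 1) $ a) *\<^sub>R axis a 1)"
    unfolding basis_expansion[of "?\<phi>' (axis i 1)", unfolded scalar_mult_eq_scaleR] ..
  also have "\<dots> = (\<Sum>a. jac c c' a i x * ?F' (axis a 1))"
    using lin by (simp add: linear_sum linear_scale j)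
  also have "\<dots> = (\<Sum>a. jac c c' a i x * pd c a f x)"
    by (simp add: pd_def F_def)
  finally show "pd c' i f x = (\<Sum>a. jac c c' a i x * pd c a f x)" using pd by simp
qed

lemma jac_inverse:
  assumes "c \<in> A" "c' \<in> A" "x \<in> chart_dom c" "x \<in> chart_dom c'"
  shows "(\<Sum>a. jac c c' a i x * jac c' c k a x) = (if i = k then 1 else 0)"
proof -
  have "(\<Sum>a. jac c c' a i x * jac c' c k a x) = pd c' i (\<lambda>z. coords c' z $ k) x"
    unfolding jac_def[of c' c]
    by (rule chain_rule(2)[OF assms diff_at_coords, symmetric]) (use assms in auto)
  also have "\<dots> = frechet_derivative (\<lambda>u. u $ k) (at (coords c' x)) (axis i 1)"
  proof -
    have "frechet_derivative (\<lambda>u. u $ k) (at (coords c' x)) =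
        frechet_derivative ((\<lambda>z. coords c' z $ k) \<circ> chart_inv c') (at (coords c' x))"
      by (rule frechet_derivative_transform_within_open[OF _ open_image[OF assms(2)]])
        (use assms in \<open>auto simp: bounded_linear_imp_differentiable bounded_linear_vec_nth\<close>)
    then show ?thesis by (simp add: pd_def)
  qed
  also have "\<dots> = axis i 1 $ k"
    using fun_cong[OF frechet_derivative_at[OF bounded_linear_imp_has_derivative[OF
      bounded_linear_vec_nth[of k]], of "coords c' x"], of "axis i (1::real)"] by simp
  finally show ?thesis by (simp add: axis_def)
qed

end

section \<open>Symmetric multilinear forms as homogeneous polynomials\<close>

text \<open>
  The polynomial \<open>\<Sum> T [i\<^sub>1, \<dots>, i\<^sub>k] y\<^sub>i\<^sub>1 \<cdots> y\<^sub>i\<^sub>k\<close>, summed one index at a time. The recursion allows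
  inductive proofs without sums over lists; \<open>ev_eq_sum\<close> recovers those.
\<close>

fun ev :: "nat \<Rightarrow> ('n::finite list \<Rightarrow> real) \<Rightarrow> ('n \<Rightarrow> real) \<Rightarrow> real"
  where
    "ev 0 T y = T []"
  | "ev (Suc k) T y = (\<Sum>i. y i * ev k (\<lambda>is. T (i # is)) y)"

definition sym_fun :: "('n list \<Rightarrow> real) \<Rightarrow> bool"
  where "sym_fun T \<longleftrightarrow> (\<forall>is js. mset is = mset js \<longrightarrow> T is = T js)"

lemma sym_funD: "sym_fun T \<Longrightarrow> mset is = mset js \<Longrightarrow> T is = T js"
  unfolding sym_fun_def by blast

lemma sym_fun_Cons: "sym_fun T \<Longrightarrow> sym_fun (\<lambda>is. T (i # is))"
  unfolding sym_fun_def by (metis mset.simps(2))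

lemma sym_fun_swap: "sym_fun T \<Longrightarrow> T (i # j # is) = T (j # i # is)"
  by (rule sym_funD) auto

lemma ev_cong: "(\<And>is. length is = k \<Longrightarrow> T is = T' is) \<Longrightarrow> ev k T y = ev k T' y"
proof (induction k arbitrary: T T')
  case (Suc k)
  have "ev k (\<lambda>is. T (i # is)) y = ev k (\<lambda>is. T' (i # is)) y" for i
    by (rule Suc.IH) (simp add: Suc.prems)
  then show ?case by simp
qed simp

lemma ev_zero [simp]: "ev k (\<lambda>is. 0) y = 0"
  by (induction k) auto

lemma ev_scale: "ev k (\<lambda>is. a * T is) y = a * ev k T y"
  by (induction k arbitrary: T) (auto simp: sum_distrib_left mult_ac)

lemma ev_add: "ev k (\<lambda>is. S is + T is) y = ev k S y + ev k T y"
  by (induction k arbitrary: S T) (auto simp: sum.distrib distrib_left)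

lemma ev_minus: "ev k (\<lambda>is. - T is) y = - ev k T y"
  using ev_scale[of k "-1" T y] by simp

lemma ev_diff: "ev k (\<lambda>is. S is - T is) y = ev k S y - ev k T y"
  using ev_add[of k S "\<lambda>is. - T is" y] by (simp add: ev_minus)

lemma ev_sum: "ev k (\<lambda>is. \<Sum>i\<in>I. T i is) y = (\<Sum>i\<in>I. ev k (T i) y)"
  by (induction I rule: infinite_finite_induct) (auto simp: ev_add)

lemma ev_linear_combination: "ev k (\<lambda>is. \<Sum>i\<in>I. a i * T i is) y = (\<Sum>i\<in>I. a i * ev k (T i) y)"
  by (simp add: ev_sum ev_scale)

lemma sum_lists_Suc:
  "(\<Sum>is | length is = Suc k. f is) = (\<Sum>i. \<Sum>is | length is = k. f ((i :: 'n::finite) # is))"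
proof -
  have "{is :: 'n list. length is = Suc k} = (\<lambda>(i, is). i # is) ` (UNIV \<times> {is. length is = k})"
    by (auto simp: length_Suc_conv image_iff)
  then have "(\<Sum>is | length is = Suc k. f is) =
      (\<Sum>p\<in>UNIV \<times> {is :: 'n list. length is = k}. f ((\<lambda>(i, is). i # is) p))"
    by (simp add: sum.reindex inj_on_def)
  then show ?thesis by (simp add: sum.cartesian_product case_prod_beta)
qed

lemma ev_eq_sum: "ev k T y = (\<Sum>is | length is = k. prod_list (map y is) * T is)"
  by (induction k arbitrary: T) (simp_all add: sum_lists_Suc sum_distrib_left mult_ac)

lemma ev_mult: "ev (k + l) (\<lambda>is. S (take k is) * T (drop k is)) y = ev k S y * ev l T y"
proof (induction k arbitrary: S)
  case (Suc k)
  show ?case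
    using Suc.IH[of "\<lambda>is. S (i # is)" for i] by (simp add: sum_distrib_right mult.assoc)
qed (simp add: ev_scale)

lemma permute_list_inverse:
  assumes "\<sigma> permutes {..<length is}"
  shows "permute_list (inv \<sigma>) (permute_list \<sigma> is) = is"
  using permute_list_compose[OF assms, of "inv \<sigma>"] permutes_inv_o[OF assms]
    permute_list_compose[OF permutes_inv[OF assms], of \<sigma>] by simp

lemma bij_betw_permute_list:
  assumes "\<sigma> permutes {..<k}"
  shows "bij_betw (permute_list \<sigma>) {is. length is = k} {is. length is = k}"
  by (rule bij_betw_byWitness[where f' = "permute_list (inv \<sigma>)"])
    (use assms permute_list_inverse[of \<sigma>] permute_list_inverse[of "inv \<sigma>"]
      permutes_inv[OF assms] permutes_inv_inv[OF assms] in auto)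

lemma ev_permute:
  assumes "\<sigma> permutes {..<k}"
  shows "ev k (\<lambda>is. T (permute_list \<sigma> is)) y = ev k T y"
proof -
  have m: "prod_list (map y (permute_list \<sigma> is)) = prod_list (map y is)" if "length is = k" for "is"
    using assms that by (metis mset_permute_list mset_map prod_mset_prod_list)
  from sum.reindex_bij_betw[OF bij_betw_permute_list[OF assms], of "\<lambda>is. prod_list (map y is) * T is"] show ?thesis
    by (simp add: ev_eq_sum m)
qed

text \<open>
  Symmetrization is invisible to the polynomial, so that the symmetrized products and
  contractions of tensors become plain products of polynomials.
\<close>

lemma ev_symmetrize: "ev k (symmetrize T) y = ev k T y"
proof -
  have "ev k (symmetrize T) y =
      ev k (\<lambda>is. inverse (fact k) * (\<Sum>\<sigma> | \<sigma> permutes {..<k}. T (permute_list \<sigma> is))) y"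
    by (rule ev_cong) (simp add: symmetrize_def field_simps)
  also have "\<dots> = inverse (fact k) * (\<Sum>\<sigma> | \<sigma> permutes {..<k}. ev k T y)"
    by (simp add: ev_scale ev_sum ev_permute)
  also have "\<dots> = ev k T y"
    using card_permutations[of "{..<k}" k] by simp
  finally show ?thesis .
qed

lemma sym_fun_symmetrize: "sym_fun (symmetrize T)"
  unfolding sym_fun_def
proof (intro allI impI)
  fix "is" js :: "'a list" assume "mset is = mset js"
  then obtain \<pi> where \<pi>: "\<pi> permutes {..<length js}" "permute_list \<pi> js = is"
    using mset_eq_permutation by blast
  then have l: "length is = length js" by auto
  have "(\<Sum>\<sigma> | \<sigma> permutes {..<length js}. T (permute_list \<sigma> is)) =
      (\<Sum>\<sigma> | \<sigma> permutes {..<length js}. T (permute_list (\<pi> \<circ> \<sigma>) js))"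
    by (rule sum.cong) (auto simp: permute_list_compose \<pi>(2)[symmetric])
  also have "\<dots> = (\<Sum>\<sigma> | \<sigma> permutes {..<length js}. T (permute_list \<sigma> js))"
    by (rule setum_permutations_compose_left[OF \<pi>(1), symmetric])
  finally show "symmetrize T is = symmetrize T js" by (simp add: symmetrize_def l)
qed

lemma sum_ev_Cons_swap:
  assumes "sym_fun T"
  shows "(\<Sum>i. y i * (\<Sum>b. z b * (real k * ev (k - 1) (\<lambda>is. T (i # b # is)) y))) =
    (\<Sum>b. z b * (real k * ev k (\<lambda>is. T (b # is)) y))"
proof (cases k)
  case (Suc m)
  have "(\<Sum>i. y i * (\<Sum>b. z b * (real k * ev m (\<lambda>is. T (i # b # is)) y))) =
      (\<Sum>b i. y i * (z b * (real k * ev m (\<lambda>is. T (i # b # is)) y)))"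
    unfolding sum_distrib_left by (rule sum.swap)
  also have "\<dots> = (\<Sum>b. z b * (real k * (\<Sum>i. y i * ev m (\<lambda>is. T (b # i # is)) y)))"
    unfolding sum_distrib_left by (simp add: sym_fun_swap[OF assms] mult_ac)
  finally show ?thesis by (simp add: Suc)
qed simp

text \<open>
  By symmetry all \<open>k\<close> slots contribute equally to the derivative of the polynomial in the direction \<open>y'\<close>.
  Both the tensor and the argument depend on \<open>t\<close>: the derivatives in the base, in the fibre, and along
  a curve seen from another chart are all instances.
\<close>

lemma DERIV_ev:
  assumes "\<And>is. length is = k \<Longrightarrow> ((\<lambda>t. T t is) has_real_derivative T' is) (at s)"
    and "\<And>b. ((\<lambda>t. y t b) has_real_derivative y' b) (at s)"
    and "sym_fun (T s)"
  shows "((\<lambda>t. ev k (T t) (y t)) has_real_derivative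
    ev k T' (y s) + (\<Sum>b. y' b * (real k * ev (k - 1) (\<lambda>is. T s (b # is)) (y s)))) (at s)"
  using assms(1,3)
proof (induction k arbitrary: T T')
  case (Suc k)
  have "((\<lambda>t. ev k (\<lambda>is. T t (i # is)) (y t)) has_real_derivative
      ev k (\<lambda>is. T' (i # is)) (y s) +
      (\<Sum>b. y' b * (real k * ev (k - 1) (\<lambda>is. T s (i # b # is)) (y s)))) (at s)" for i
    by (rule Suc.IH) (simp_all add: Suc.prems sym_fun_Cons)
  then have "((\<lambda>t. \<Sum>i. y t i * ev k (\<lambda>is. T t (i # is)) (y t)) has_real_derivative
      (\<Sum>i. y' i * ev k (\<lambda>is. T s (i # is)) (y s) + (ev k (\<lambda>is. T' (i # is)) (y s) +
      (\<Sum>b. y' b * (real k * ev (k - 1) (\<lambda>is. T s (i # b # is)) (y s)))) * y s i)) (at s)"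
    by (intro DERIV_sum DERIV_mult assms(2))
  then show ?case
    using sum_ev_Cons_swap[OF Suc.prems(2), of "y s" y' k]
    by (simp add: sum.distrib distrib_left distrib_right mult_ac add_ac)
qed simp

text \<open>
  Polarization: by \<open>DERIV_ev\<close>, the derivatives of a vanishing polynomial show that all tensors
  \<open>T (p # _)\<close> have vanishing polynomials too.
\<close>

lemma ev_eq_zeroD:
  assumes "sym_fun T" "\<And>y. ev k T y = 0" "length is = k"
  shows "T is = 0"
  using assms
proof (induction k arbitrary: T "is")
  case (Suc k)
  then obtain p js where js: "is = p # js" "length js = k" by (metis length_Suc_conv)
  have "ev k (\<lambda>is. T (p # is)) y = 0" for y
  proof -
    have "((\<lambda>t. ev (Suc k) T (\<lambda>b. y b + t * (if b = p then 1 else 0))) has_real_derivative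
        ev (Suc k) (\<lambda>is. 0) (\<lambda>b. y b + 0 * (if b = p then 1 else 0)) +
        (\<Sum>b. (if b = p then 1 else 0) * (real (Suc k) * ev (Suc k - 1) (\<lambda>is. T (b # is))
          (\<lambda>b. y b + 0 * (if b = p then 1 else 0))))) (at 0)"
      by (rule DERIV_ev) (auto intro!: derivative_eq_intros Suc.prems)
    then have "((\<lambda>t. 0) has_real_derivative real (Suc k) * ev k (\<lambda>is. T (p # is)) y) (at 0)"
      by (simp only: Suc.prems(2)) (simp add: if_distrib if_distribR cong: if_cong)
    from DERIV_unique[OF this DERIV_const] show ?thesis by simp
  qed
  from Suc.IH[OF sym_fun_Cons[OF Suc.prems(1)] this js(2)] show ?case by (simp add: js)
qed simp

text \<open>
  The transformation law of covariant tensors is the substitution \<open>y \<mapsto> J y\<close> in the polynomial.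
\<close>

lemma ev_substitution:
  "ev k (\<lambda>is. \<Sum>as | length as = k. (\<Prod>r<k. J (as ! r) (is ! r)) * T as) y =
    ev k T (\<lambda>a. \<Sum>i. J a i * y i)"
proof (induction k arbitrary: T)
  case (Suc k)
  have "ev (Suc k) (\<lambda>is. \<Sum>as | length as = Suc k. (\<Prod>r<Suc k. J (as ! r) (is ! r)) * T as) y =
      (\<Sum>i. y i * ev k (\<lambda>is. \<Sum>a. J a i *
        (\<Sum>as | length as = k. (\<Prod>r<k. J (as ! r) (is ! r)) * T (a # as))) y)"
    by (simp add: sum_lists_Suc prod.lessThan_Suc_shift sum_distrib_left mult.assoc
        del: prod.lessThan_Suc)
  also have "\<dots> = (\<Sum>i a. y i * (J a i *
      ev k (\<lambda>as. T (a # as)) (\<lambda>a. \<Sum>i. J a i * y i)))"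
    by (simp only: ev_linear_combination Suc.IH[of "\<lambda>as. T (a # as)" for a])
      (simp only: sum_distrib_left)
  also have "\<dots> = ev (Suc k) T (\<lambda>a. \<Sum>i. J a i * y i)"
    by (subst sum.swap) (simp add: sum_distrib_right mult_ac)
  finally show ?case .
qed simp

text \<open>
  The correction terms of the covariant derivative, one for each index, add up to the action of the
  vector field \<open>y\<^sup>j G\<^sub>j\<^sup>m \<partial>/\<partial>y\<^sup>m\<close> on the polynomial.
\<close>

lemma ev_derivation:
  assumes "sym_fun T"
  shows "ev k (\<lambda>js. \<Sum>r<length js. \<Sum>m. G (js ! r) m * T (js[r := m])) y =
    (\<Sum>m. (\<Sum>j. y j * G j m) * (real k * ev (k - 1) (\<lambda>is. T (m # is)) y))"
  using assms
proof (induction k arbitrary: T)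
  case (Suc k)
  let ?z = "\<lambda>m. \<Sum>j. y j * G j m"
  have "ev (Suc k) (\<lambda>js. \<Sum>r<length js. \<Sum>m. G (js ! r) m * T (js[r := m])) y =
      (\<Sum>j. y j * ((\<Sum>m. G j m * ev k (\<lambda>js. T (m # js)) y) +
        ev k (\<lambda>js. \<Sum>r<length js. \<Sum>m. G (js ! r) m * T (j # js[r := m])) y))"
    by (simp add: sum.lessThan_Suc_shift ev_add ev_sum ev_scale del: sum.lessThan_Suc)
  also have "\<dots> = (\<Sum>j m. y j * (G j m * ev k (\<lambda>js. T (m # js)) y)) +
      (\<Sum>j. y j * (\<Sum>m. ?z m * (real k * ev (k - 1) (\<lambda>is. T (j # m # is)) y)))"
    using Suc.IH[OF sym_fun_Cons[OF Suc.prems]]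
    by (simp add: distrib_left sum.distrib sum_distrib_left)
  also have "(\<Sum>j m. y j * (G j m * ev k (\<lambda>js. T (m # js)) y)) =
      (\<Sum>m. ?z m * ev k (\<lambda>js. T (m # js)) y)"
    by (subst sum.swap) (simp add: sum_distrib_left sum_distrib_right mult_ac)
  also note sum_ev_Cons_swap[OF Suc.prems]
  also have "(\<Sum>m. ?z m * ev k (\<lambda>js. T (m # js)) y) +
      (\<Sum>m. ?z m * (real k * ev k (\<lambda>is. T (m # is)) y)) =
      (\<Sum>m. ?z m * (real (Suc k) * ev (Suc k - 1) (\<lambda>is. T (m # is)) y))"
    by (simp add: sum.distrib[symmetric] algebra_simps)
  finally show ?case .
qed simp

section \<open>Generating series on the tangent bundle\<close>

text \<open>
  A field is a sequence of tensor fields in one fixed chart, the \<open>k\<close>-th one of degree \<open>k\<close>. Its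
  generating series at a point of the tangent bundle lies in a commutative ring, in spite of
  the infinitely many degrees.
\<close>

type_synonym ('m, 'n) field = "nat \<Rightarrow> 'm \<Rightarrow> 'n list \<Rightarrow> real"

definition gen :: "('m, 'n::finite) field \<Rightarrow> 'm \<times> ('n \<Rightarrow> real) \<Rightarrow> real fps"
  where "gen \<phi> w = Abs_fps (\<lambda>k. ev k (\<phi> k (fst w)) (snd w))"

text \<open>
  The derivatives \<open>\<partial>/\<partial>x\<^sup>i\<close> (for \<open>Inl i\<close>) and \<open>\<partial>/\<partial>y\<^sup>p\<close> (for \<open>Inr p\<close>). The latter lowers the degree by one.
\<close>

definition dd :: "('m, 'n::finite) chart \<Rightarrow> 'n + 'n \<Rightarrow> ('m, 'n) field \<Rightarrow> ('m, 'n) field"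
  where "dd c a \<phi> = (case a of
    Inl i \<Rightarrow> (\<lambda>k x is. pd c i (\<lambda>z. \<phi> k z is) x)
  | Inr p \<Rightarrow> (\<lambda>k x is. real (Suc k) * \<phi> (Suc k) x (p # is)))"

definition local_field :: "('m, 'n::finite) chart \<Rightarrow> ('m, 'n) field \<Rightarrow> bool"
  where "local_field c \<phi> \<longleftrightarrow>
    (\<forall>k is. length is = k \<longrightarrow> smooth_in_chart c (\<lambda>x. \<phi> k x is)) \<and> (\<forall>k x. sym_fun (\<phi> k x))"

definition fps_deriv_at_0 :: "(real \<Rightarrow> real fps) \<Rightarrow> real fps \<Rightarrow> bool"
  where "fps_deriv_at_0 F D \<longleftrightarrow>
    (\<forall>n. ((\<lambda>t. fps_nth (F t) n) has_real_derivative fps_nth D n) (at 0))"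

definition shift :: "('m, 'n::finite) chart \<Rightarrow> 'n + 'n \<Rightarrow> 'm \<times> ('n \<Rightarrow> real) \<Rightarrow> real \<Rightarrow> 'm \<times> ('n \<Rightarrow> real)"
  where "shift c a w t = (case a of
    Inl i \<Rightarrow> (coord_line c i (fst w) t, snd w)
  | Inr p \<Rightarrow> (fst w, (snd w)(p := snd w p + t)))"

text \<open>
  The coefficientwise derivative of a series along \<open>y\<^sup>p\<close> keeps the exponents, whereas \<open>dd c (Inr p)\<close>
  lowers them by one. The weight \<open>fps_X\<close> accounts for the difference.
\<close>

definition weight :: "'n + 'n \<Rightarrow> real fps"
  where "weight a = (case a of Inl _ \<Rightarrow> 1 | Inr _ \<Rightarrow> fps_X)"

definition has_d :: "('m, 'n::finite) chart \<Rightarrow> 'n + 'n \<Rightarrow> ('m \<times> ('n \<Rightarrow> real) \<Rightarrow> real fps) \<Rightarrow>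
    'm \<times> ('n \<Rightarrow> real) \<Rightarrow> real fps \<Rightarrow> bool"
  where "has_d c a \<Phi> w D \<longleftrightarrow> fps_deriv_at_0 (\<lambda>t. \<Phi> (shift c a w t)) (weight a * D)"

lemma fps_deriv_at_0_unique: "fps_deriv_at_0 F D \<Longrightarrow> fps_deriv_at_0 F D' \<Longrightarrow> D = D'"
  unfolding fps_deriv_at_0_def by (meson DERIV_unique fps_ext)

lemma fps_deriv_at_0_add:
  "fps_deriv_at_0 F D \<Longrightarrow> fps_deriv_at_0 G D' \<Longrightarrow> fps_deriv_at_0 (\<lambda>t. F t + G t) (D + D')"
  unfolding fps_deriv_at_0_def by (auto intro: DERIV_add)

lemma fps_deriv_at_0_mult:
  assumes "fps_deriv_at_0 F D" "fps_deriv_at_0 G D'"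
  shows "fps_deriv_at_0 (\<lambda>t. F t * G t) (D * G 0 + F 0 * D')"
  unfolding fps_deriv_at_0_def
proof
  fix n
  have "((\<lambda>t. \<Sum>i=0..n. fps_nth (F t) i * fps_nth (G t) (n - i)) has_real_derivative
      (\<Sum>i=0..n. fps_nth D i * fps_nth (G 0) (n - i) + fps_nth D' (n - i) * fps_nth (F 0) i)) (at 0)"
    using assms unfolding fps_deriv_at_0_def by (intro DERIV_sum DERIV_mult) auto
  then show "((\<lambda>t. fps_nth (F t * G t) n) has_real_derivative
      fps_nth (D * G 0 + F 0 * D') n) (at 0)"
    by (simp add: fps_mult_nth sum.distrib mult.commute[of "fps_nth D' j" for j])
qed

lemma fps_deriv_at_0_const: "fps_deriv_at_0 (\<lambda>t. a) 0"
  by (simp add: fps_deriv_at_0_def)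

lemma fps_deriv_at_0_fps_const:
  "(f has_real_derivative D) (at 0) \<Longrightarrow> fps_deriv_at_0 (\<lambda>t. fps_const (f t)) (fps_const D)"
  unfolding fps_deriv_at_0_def by simp

lemma gen_Inr_nth:
  "fps_nth (fps_X * gen (dd c (Inr p) \<phi>) w) k =
    real k * ev (k - 1) (\<lambda>is. \<phi> k (fst w) (p # is)) (snd w)"
  by (cases k) (simp_all add: gen_def dd_def ev_scale)

lemma fps_deriv_at_0_gen:
  assumes "\<And>k is. length is = k \<Longrightarrow> ((\<lambda>t. \<phi> k (x t) is) has_real_derivative \<phi>' k is) (at 0)"
    and "\<And>b. ((\<lambda>t. y t b) has_real_derivative y' b) (at 0)"
    and "\<And>k. sym_fun (\<phi> k (x 0))"
  shows "fps_deriv_at_0 (\<lambda>t. gen \<phi> (x t, y t)) (gen (\<lambda>k z. \<phi>' k) (x 0, y 0) +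
    (\<Sum>b. fps_const (y' b) * (fps_X * gen (dd c (Inr b) \<phi>) (x 0, y 0))))"
  unfolding fps_deriv_at_0_def
proof
  fix k
  have "((\<lambda>t. ev k (\<phi> k (x t)) (y t)) has_real_derivative
      ev k (\<phi>' k) (y 0) + (\<Sum>b. y' b * (real k * ev (k - 1) (\<lambda>is. \<phi> k (x 0) (b # is)) (y 0)))) (at 0)"
    by (rule DERIV_ev) (use assms in auto)
  then show "((\<lambda>t. fps_nth (gen \<phi> (x t, y t)) k) has_real_derivative
      fps_nth (gen (\<lambda>k z. \<phi>' k) (x 0, y 0) +
        (\<Sum>b. fps_const (y' b) * (fps_X * gen (dd c (Inr b) \<phi>) (x 0, y 0)))) k) (at 0)"
    unfolding fps_add_nth fps_sum_nth fps_mult_left_const_nth gen_Inr_nth by (simp add: gen_def)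
qed

text \<open>
  Uniqueness is what turns the rules for \<open>has_d\<close> into formulas for \<open>dd\<close> of a compound expression: the
  rules give one derivative of the series, \<open>has_d_gen\<close> gives another, and the weight may be cancelled.
\<close>

lemma has_d_unique: "has_d c a \<Phi> w D \<Longrightarrow> has_d c a \<Phi> w D' \<Longrightarrow> D = D'"
  unfolding has_d_def by (drule (1) fps_deriv_at_0_unique) (auto simp: weight_def split: sum.splits)

lemma has_d_add: "has_d c a \<Phi> w D \<Longrightarrow> has_d c a \<Psi> w D' \<Longrightarrow> has_d c a (\<lambda>w. \<Phi> w + \<Psi> w) w (D + D')"
  unfolding has_d_def distrib_left by (rule fps_deriv_at_0_add)

lemma has_d_const: "has_d c a (\<lambda>w. r) w 0"
  unfolding has_d_def by (simp add: fps_deriv_at_0_const)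

lemma has_d_sum:
  "(\<And>i. i \<in> I \<Longrightarrow> has_d c a (\<Phi> i) w (D i)) \<Longrightarrow> has_d c a (\<lambda>w. \<Sum>i\<in>I. \<Phi> i w) w (\<Sum>i\<in>I. D i)"
  by (induction I rule: infinite_finite_induct) (simp_all add: has_d_const has_d_add)

text \<open>
  The coordinate \<open>y\<^sup>j\<close> is a tensor of degree one, which explains the factor \<open>fps_X\<close>.
\<close>

lemma has_d_fibre_coordinate:
  "has_d c a (\<lambda>w. fps_X * fps_const (snd w j)) w (if a = Inr j then 1 else 0)"
  unfolding has_d_def fps_deriv_at_0_def
proof
  fix n
  have "((\<lambda>t. snd (shift c a w t) j) has_real_derivative (if a = Inr j then 1 else 0)) (at 0)"
    by (cases a) (auto simp: shift_def intro!: derivative_eq_intros)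
  from DERIV_cmult[OF this, of "if n = Suc 0 then 1 else 0"]
  show "((\<lambda>t. fps_nth (fps_X * fps_const (snd (shift c a w t) j)) n) has_real_derivative
      fps_nth (weight a * (if a = Inr j then 1 else 0)) n) (at 0)"
    by (auto simp: weight_def fps_X_nth split: sum.splits if_splits)
qed

context smooth_manifold
begin

lemma shift_0 [simp]: "c \<in> A \<Longrightarrow> fst w \<in> chart_dom c \<Longrightarrow> shift c a w 0 = w"
  by (auto simp: shift_def split: sum.splits)

lemma has_d_mult:
  assumes "c \<in> A" "fst w \<in> chart_dom c" "has_d c a \<Phi> w D" "has_d c a \<Psi> w D'"
  shows "has_d c a (\<lambda>w. \<Phi> w * \<Psi> w) w (D * \<Psi> w + \<Phi> w * D')"
  using fps_deriv_at_0_mult[OF assms(3,4)[unfolded has_d_def]] assms(1,2)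
  unfolding has_d_def by (simp add: algebra_simps)

lemma has_d_minus:
  assumes "c \<in> A" "fst w \<in> chart_dom c" "has_d c a \<Phi> w D"
  shows "has_d c a (\<lambda>w. - \<Phi> w) w (- D)"
  using has_d_mult[OF assms(1,2) has_d_const[of c a "-1" w] assms(3)] by simp

lemma has_d_diff:
  assumes "c \<in> A" "fst w \<in> chart_dom c" "has_d c a \<Phi> w D" "has_d c a \<Psi> w D'"
  shows "has_d c a (\<lambda>w. \<Phi> w - \<Psi> w) w (D - D')"
  using has_d_add[OF assms(3) has_d_minus[OF assms(1,2,4)]] by simp

lemma has_d_cong:
  assumes "c \<in> A" "fst w \<in> chart_dom c" "has_d c a \<Phi> w D"
    and "\<And>w. fst w \<in> chart_dom c \<Longrightarrow> \<Phi> w = \<Psi> w"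
  shows "has_d c a \<Psi> w D"
proof -
  have "\<forall>\<^sub>F t in nhds 0. fst (shift c a w t) \<in> chart_dom c"
    using eventually_coord_line_in[OF assms(1,2) open_dom[OF assms(1)] assms(2)] assms(2)
    by (cases a) (auto simp: shift_def)
  then have "\<forall>\<^sub>F t in nhds 0. \<Phi> (shift c a w t) = \<Psi> (shift c a w t)"
    by (rule eventually_mono) (rule assms(4))
  then have ev: "\<forall>\<^sub>F t in nhds 0. fps_nth (\<Phi> (shift c a w t)) n = fps_nth (\<Psi> (shift c a w t)) n" for n
    by (rule eventually_mono) simp
  show ?thesis
    using assms(3) unfolding has_d_def fps_deriv_at_0_def DERIV_cong_ev[OF refl ev refl] .
qed

lemma has_d_base:
  assumes "diff_at c f (fst w)"
  shows "has_d c a (\<lambda>w. fps_const (f (fst w))) w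
    (case a of Inl i \<Rightarrow> fps_const (pd c i f (fst w)) | Inr p \<Rightarrow> 0)"
proof (cases a)
  case (Inl i)
  then show ?thesis
    using fps_deriv_at_0_fps_const[OF DERIV_coord_line[OF assms, of i]]
    by (simp add: has_d_def shift_def weight_def)
next
  case (Inr p)
  then show ?thesis by (simp add: has_d_def shift_def weight_def fps_deriv_at_0_const)
qed

lemma local_field_smooth:
  "local_field c \<phi> \<Longrightarrow> length is = k \<Longrightarrow> smooth_in_chart c (\<lambda>x. \<phi> k x is)"
  unfolding local_field_def by blast

lemma local_field_sym: "local_field c \<phi> \<Longrightarrow> sym_fun (\<phi> k x)"
  unfolding local_field_def by blast

lemma local_field_diff_at:
  "local_field c \<phi> \<Longrightarrow> x \<in> chart_dom c \<Longrightarrow> length is = k \<Longrightarrow> diff_at c (\<lambda>z. \<phi> k z is) x"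
  by (blast intro: smooth_in_chart_diff_at local_field_smooth)

lemma local_field_dd:
  assumes "c \<in> A" "local_field c \<phi>"
  shows "local_field c (dd c a \<phi>)"
proof (cases a)
  case (Inl i)
  have "(\<lambda>z. \<phi> k z is) = (\<lambda>z. \<phi> k z js)" if "mset is = mset js" for k "is" js
    using assms(2) that unfolding local_field_def by (blast intro: sym_funD)
  then have "sym_fun (\<lambda>is. pd c i (\<lambda>z. \<phi> k z is) x)" for k x
    unfolding sym_fun_def by (intro allI impI arg_cong[where f = "\<lambda>f. pd c i f x"])
  moreover have "smooth_in_chart c (\<lambda>x. pd c i (\<lambda>z. \<phi> k z is) x)" if "length is = k" for k "is"
    using assms that by (intro smooth_in_chart_pd) (auto simp: local_field_def)
  ultimately show ?thesis
    unfolding local_field_def dd_def Inl sum.case by blast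
next
  case (Inr p)
  have "smooth_in_chart c (\<lambda>x. real (Suc k) * \<phi> (Suc k) x (p # is))" if "length is = k" for k "is"
    using assms that by (intro smooth_in_chart_mult smooth_in_chart_const local_field_smooth) auto
  moreover have "sym_fun (\<lambda>is. real (Suc k) * \<phi> (Suc k) x (p # is))" for k x
    using assms(2) sym_fun_Cons unfolding local_field_def sym_fun_def by metis
  ultimately show ?thesis
    unfolding local_field_def dd_def Inr sum.case by blast
qed

lemma has_d_gen:
  assumes "c \<in> A" "local_field c \<phi>" "fst w \<in> chart_dom c"
  shows "has_d c a (gen \<phi>) w (gen (dd c a \<phi>) w)"
proof (cases a)
  case (Inl i)
  have "fps_deriv_at_0 (\<lambda>t. gen \<phi> (coord_line c i (fst w) t, snd w))
      (gen (\<lambda>k z is. pd c i (\<lambda>z. \<phi> k z is) (fst w)) (coord_line c i (fst w) 0, snd w) +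
        (\<Sum>b. fps_const 0 * (fps_X * gen (dd c (Inr b) \<phi>) (coord_line c i (fst w) 0, snd w))))"
    using assms by (intro fps_deriv_at_0_gen DERIV_coord_line local_field_diff_at DERIV_const)
      (auto simp: local_field_def)
  then show ?thesis using Inl by (simp add: has_d_def shift_def weight_def gen_def dd_def)
next
  case (Inr p)
  have "fps_deriv_at_0 (\<lambda>t. gen \<phi> (fst w, (snd w)(p := snd w p + t)))
      (gen (\<lambda>k z is. 0) (fst w, (snd w)(p := snd w p + 0)) +
        (\<Sum>b. fps_const (if b = p then 1 else 0) *
          (fps_X * gen (dd c (Inr b) \<phi>) (fst w, (snd w)(p := snd w p + 0)))))"
    using assms by (intro fps_deriv_at_0_gen)
      (auto simp: local_field_def intro!: derivative_eq_intros)
  moreover have "gen (\<lambda>k z is. 0) w' = 0" for w' :: "'m \<times> ('n \<Rightarrow> real)"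
    by (simp add: gen_def fps_eq_iff)
  moreover have "(\<Sum>b. fps_const (if b = p then 1 else 0) * f b) = f p" for f :: "'n \<Rightarrow> real fps"
    by (simp add: if_distrib if_distribR cong: if_cong)
  ultimately show ?thesis using Inr by (simp add: has_d_def shift_def weight_def)
qed

lemma pd_cmult: "diff_at c f x \<Longrightarrow> pd c i (\<lambda>z. r * f z) x = r * pd c i f x"
  by (rule pd_eqI) (auto intro!: DERIV_cmult DERIV_coord_line simp: diff_at_def o_def)

lemma gen_cong:
  "(\<And>k is. length is = k \<Longrightarrow> \<phi> k (fst w) is = \<psi> k (fst w) is) \<Longrightarrow> gen \<phi> w = gen \<psi> w"
  unfolding gen_def by (auto simp: fps_eq_iff intro!: ev_cong)

lemma gen_dd_commute:
  assumes "c \<in> A" "local_field c \<phi>" "fst w \<in> chart_dom c"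
  shows "gen (dd c a (dd c b \<phi>)) w = gen (dd c b (dd c a \<phi>)) w"
proof -
  have xy: "gen (dd c (Inl i) (dd c (Inr p) \<phi>)) w = gen (dd c (Inr p) (dd c (Inl i) \<phi>)) w" for i p
    by (rule gen_cong)
      (simp only: dd_def sum.case, rule pd_cmult, rule local_field_diff_at, use assms in auto)
  show ?thesis
  proof (cases a; cases b)
    fix i j assume "a = Inl i" "b = Inl j"
    then show ?thesis
      using assms by (auto simp: dd_def local_field_def intro!: gen_cong pd_commute)
  next
    fix p q assume "a = Inr p" "b = Inr q"
    then show ?thesis
      using assms(2) sym_fun_swap[of "\<phi> (Suc (Suc k)) x" for k x]
      by (auto simp: dd_def local_field_def intro!: gen_cong)
  qed (simp_all add: xy)
qed

end

section \<open>The operations as operations on generating series\<close>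

definition loc :: "('m, 'n::finite) chart \<Rightarrow> (nat \<Rightarrow> ('m, 'n) tensor) \<Rightarrow> ('m, 'n) field"
  where "loc c \<alpha> = (\<lambda>k x. \<alpha> k c x)"

text \<open>
  The horizontal lift \<open>\<partial>/\<partial>x\<^sup>i - \<Gamma>\<^sub>i\<^sub>j\<^sup>m y\<^sup>j \<partial>/\<partial>y\<^sup>m\<close> of the \<open>i\<close>-th coordinate vector field to the tangent bundle.
\<close>

definition nabla ::
  "('m, 'n::finite) chart \<Rightarrow> ('m, 'n) christoffel \<Rightarrow> 'n \<Rightarrow> ('m, 'n) field \<Rightarrow> 'm \<times> ('n \<Rightarrow> real) \<Rightarrow> real fps"
  where "nabla c \<Gamma> i \<phi> w = gen (dd c (Inl i) \<phi>) w -
    (\<Sum>m. (\<Sum>j. fps_const (\<Gamma> c (fst w) i j m) * (fps_X * fps_const (snd w j))) *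
      gen (dd c (Inr m) \<phi>) w)"

abbreviation ser :: "('m, 'n::finite) chart \<Rightarrow> (nat \<Rightarrow> ('m, 'n) tensor) \<Rightarrow> 'm \<times> ('n \<Rightarrow> real) \<Rightarrow> real fps"
  where "ser c \<alpha> \<equiv> gen (loc c \<alpha>)"

abbreviation der ::
  "('m, 'n::finite) chart \<Rightarrow> 'n + 'n \<Rightarrow> (nat \<Rightarrow> ('m, 'n) tensor) \<Rightarrow> 'm \<times> ('n \<Rightarrow> real) \<Rightarrow> real fps"
  where "der c a \<alpha> \<equiv> gen (dd c a (loc c \<alpha>))"

lemma sum_fun_apply: "(\<Sum>i\<in>I. f i) x = (\<Sum>i\<in>I. f i x)"
  by (induction I rule: infinite_finite_induct) auto

lemma ev_fun_sum: "ev k (\<Sum>i\<in>I. T i) y = (\<Sum>i\<in>I. ev k (T i) y)"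
proof -
  have "(\<Sum>i\<in>I. T i) = (\<lambda>is. \<Sum>i\<in>I. T i is)" by (rule ext) (rule sum_fun_apply)
  then show ?thesis by (simp add: ev_sum)
qed

lemma fps_const_sum: "fps_const (\<Sum>i\<in>I. f i) = (\<Sum>i\<in>I. fps_const (f i))"
  by (induction I rule: infinite_finite_induct) (simp_all flip: fps_const_add)

lemma gen_loc_nth: "fps_nth (ser c \<alpha> w) k = ev k (\<alpha> k c (fst w)) (snd w)"
  by (simp add: gen_def loc_def)

lemma gen_Inr_loc_nth:
  "fps_nth (fps_X * der c (Inr p) \<alpha> w) k =
    real k * ev (k - 1) (\<lambda>is. \<alpha> k c (fst w) (p # is)) (snd w)"
  by (simp only: gen_Inr_nth) (simp add: loc_def)

lemma ev_restrict_tensor: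
  "c \<in> A \<Longrightarrow> x \<in> chart_dom c \<Longrightarrow> ev k (restrict_tensor A k T c x) y = ev k (T c x) y"
  by (rule ev_cong) (simp add: restrict_tensor_def)

lemma ev_sym_prod:
  "c \<in> A \<Longrightarrow> x \<in> chart_dom c \<Longrightarrow>
    ev (k + l) (sym_prod A k l \<alpha> \<beta> c x) y = ev k (\<alpha> c x) y * ev l (\<beta> c x) y"
  by (simp add: sym_prod_def ev_restrict_tensor ev_symmetrize ev_mult)

lemma gen_hat_sym_prod:
  assumes "c \<in> A" "fst w \<in> chart_dom c"
  shows "ser c (hat_sym_prod A \<alpha> \<beta>) w = ser c \<alpha> w * ser c \<beta> w"
proof (rule fps_ext)
  fix m
  have "ev m (sym_prod A k (m - k) (\<alpha> k) (\<beta> (m - k)) c (fst w)) (snd w) =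
      ev k (\<alpha> k c (fst w)) (snd w) * ev (m - k) (\<beta> (m - k) c (fst w)) (snd w)" if "k \<le> m" for k
    using ev_sym_prod[OF assms, of k "m - k"] that by simp
  then show "fps_nth (ser c (hat_sym_prod A \<alpha> \<beta>) w) m =
      fps_nth (ser c \<alpha> w * ser c \<beta> w) m"
    by (simp add: gen_loc_nth fps_mult_nth hat_sym_prod_def sum_fun_apply ev_fun_sum atLeast0AtMost)
qed

lemma ev_contract:
  "ev (k + l) (\<lambda>is. \<Sum>p. S p (take k is) * (\<Sum>q. P p q * T q (drop k is))) y =
    (\<Sum>p q. P p q * (ev k (S p) y * ev l (T q) y))"
proof -
  have "ev (k + l) (\<lambda>is. \<Sum>p. S p (take k is) * (\<Sum>q. P p q * T q (drop k is))) y =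
      ev (k + l) (\<lambda>is. \<Sum>p q. P p q * (S p (take k is) * T q (drop k is))) y"
    by (simp add: sum_distrib_left mult_ac)
  also have "\<dots> = (\<Sum>p q. P p q * (ev k (S p) y * ev l (T q) y))"
    by (simp only: ev_sum ev_scale ev_mult)
  finally show ?thesis .
qed

lemma ev_alg_bracket:
  assumes "c \<in> A" "x \<in> chart_dom c" "sym_fun (\<beta> c x)" "m + 2 = k + l"
  shows "ev m (alg_bracket A \<Omega> k l \<alpha> \<beta> c x) y = (\<Sum>p q. form_up \<Omega> c x p q *
    ((real k * ev (k - 1) (\<lambda>is. \<alpha> c x (p # is)) y) * (real l * ev (l - 1) (\<lambda>is. \<beta> c x (q # is)) y)))"
proof (cases "k = 0 \<or> l = 0")
  case True
  have "alg_bracket A \<Omega> k l \<alpha> \<beta> c x = (\<lambda>is. 0)"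
    using True by (auto simp: alg_bracket_def restrict_tensor_def fun_eq_iff)
  then show ?thesis using True by auto
next
  case False
  then have m: "m = (k - 1) + (l - 1)" "m = k + l - 2" using assms(4) by auto
  have s: "\<beta> c x (drop (k - 1) is @ [q]) = \<beta> c x (q # drop (k - 1) is)" for "is" q
    by (rule sym_funD[OF assms(3)]) simp
  have "ev m (alg_bracket A \<Omega> k l \<alpha> \<beta> c x) y = real k * real l *
      ev ((k - 1) + (l - 1)) (\<lambda>is. \<Sum>p. \<alpha> c x (p # take (k - 1) is) *
        (\<Sum>q. form_up \<Omega> c x p q * \<beta> c x (q # drop (k - 1) is))) y"
    unfolding alg_bracket_def m(2)[symmetric] ev_restrict_tensor[OF assms(1,2)]
    unfolding ev_scale ev_symmetrize s m(1) ..
  then show ?thesis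
    unfolding ev_contract[of "k - 1" "l - 1" "\<lambda>p is. \<alpha> c x (p # is)" _ "\<lambda>q is. \<beta> c x (q # is)"]
    by (simp add: sum_distrib_left mult_ac)
qed

text \<open>
  Since \<open>fps_X * der c (Inr p) \<alpha>\<close> has the coefficients \<open>k \<alpha>\<^sub>k(p, y, \<dots>, y)\<close>, the sum over the degrees in
  \<open>hat_alg_bracket\<close> is a Cauchy product; its exponent exceeds the degree \<open>m\<close> of the result by two.
\<close>

lemma gen_hat_alg_bracket:
  assumes "c \<in> A" "fst w \<in> chart_dom c" "local_field c (loc c \<beta>)"
  shows "ser c (hat_alg_bracket A \<Omega> \<alpha> \<beta>) w =
    (\<Sum>p q. fps_const (form_up \<Omega> c (fst w) p q) *
      (der c (Inr p) \<alpha> w * der c (Inr q) \<beta> w))"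
    (is "_ = ?R")
proof (rule fps_ext)
  fix m
  let ?a = "\<lambda>p. fps_X * der c (Inr p) \<alpha> w"
  let ?b = "\<lambda>p. fps_X * der c (Inr p) \<beta> w"
  let ?P = "form_up \<Omega> c (fst w)"
  have s: "sym_fun (\<beta> k c x)" for k x
    using assms(3) unfolding local_field_def loc_def by blast
  have e: "ev m (alg_bracket A \<Omega> k (m + 2 - k) (\<alpha> k) (\<beta> (m + 2 - k)) c (fst w)) (snd w) =
      (\<Sum>p q. ?P p q * (fps_nth (?a p) k * fps_nth (?b q) (m + 2 - k)))"
    if "k \<le> m + 2" for k
    unfolding gen_Inr_loc_nth
    by (rule ev_alg_bracket[where m = m]) (use assms s that in auto)
  have "fps_nth (ser c (hat_alg_bracket A \<Omega> \<alpha> \<beta>) w) m =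
      (\<Sum>k=0..m + 2. \<Sum>p q. ?P p q * (fps_nth (?a p) k * fps_nth (?b q) (m + 2 - k)))"
    unfolding gen_loc_nth hat_alg_bracket_def sum_fun_apply ev_fun_sum atLeast0AtMost
    by (rule sum.cong) (use e in auto)
  also have "\<dots> = (\<Sum>p q. ?P p q * fps_nth (?a p * ?b q) (m + 2))"
    unfolding fps_mult_nth sum_distrib_left
    by (subst sum.swap, rule sum.cong[OF refl], subst sum.swap, rule refl)
  also have "\<dots> = fps_nth ?R m"
  proof -
    have x: "?a p * ?b q = fps_X * (fps_X *
        (der c (Inr p) \<alpha> w * der c (Inr q) \<beta> w))" for p q
      by (simp only: mult_ac)
    show ?thesis unfolding x by (simp add: fps_sum_nth)
  qed
  finally show "fps_nth (ser c (hat_alg_bracket A \<Omega> \<alpha> \<beta>) w) m = fps_nth ?R m" .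
qed

lemma ev_cov_deriv:
  assumes "sym_fun (\<alpha> c x)"
  shows "ev k (cov_deriv \<Gamma> \<alpha> c x i) y = ev k (\<lambda>is. pd c i (\<lambda>z. \<alpha> c z is) x) y -
    (\<Sum>m. (\<Sum>j. y j * \<Gamma> c x i j m) * (real k * ev (k - 1) (\<lambda>is. \<alpha> c x (m # is)) y))"
  using ev_derivation[OF assms, of k "\<Gamma> c x i" y] by (simp add: cov_deriv_def[abs_def] ev_diff)

lemma nabla_alt:
  "nabla c \<Gamma> i \<phi> w = gen (dd c (Inl i) \<phi>) w -
    (\<Sum>m. fps_const (\<Sum>j. snd w j * \<Gamma> c (fst w) i j m) *
      (fps_X * gen (dd c (Inr m) \<phi>) w))"
proof -
  have "(\<Sum>j. fps_const (\<Gamma> c (fst w) i j m) * (fps_X * fps_const (snd w j))) =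
      fps_const (\<Sum>j. snd w j * \<Gamma> c (fst w) i j m) * fps_X" for m
    by (simp add: fps_const_sum sum_distrib_left mult_ac flip: fps_const_mult)
  then show ?thesis unfolding nabla_def by (simp add: mult.assoc)
qed

lemma nabla_nth:
  assumes "local_field c (loc c \<alpha>)"
  shows "fps_nth (nabla c \<Gamma> i (loc c \<alpha>) w) k = ev k (cov_deriv \<Gamma> (\<alpha> k) c (fst w) i) (snd w)"
proof -
  have s: "sym_fun (\<alpha> k c x)" for k x
    using assms unfolding local_field_def loc_def by blast
  show ?thesis
    unfolding nabla_alt ev_cov_deriv[of "\<alpha> k", OF s] fps_sub_nth fps_sum_nth
      fps_mult_left_const_nth gen_Inr_loc_nth
    by (simp add: gen_def dd_def loc_def)
qed

lemma gen_hat_delta_star: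
  assumes "c \<in> A" "fst w \<in> chart_dom c" "local_field c (loc c \<alpha>)"
  shows "ser c (hat_delta_star A \<Gamma> \<alpha>) w =
    - (\<Sum>i. fps_X * fps_const (snd w i) * nabla c \<Gamma> i (loc c \<alpha>) w)"
proof (rule fps_ext)
  fix k
  show "fps_nth (ser c (hat_delta_star A \<Gamma> \<alpha>) w) k =
      fps_nth (- (\<Sum>i. fps_X * fps_const (snd w i) * nabla c \<Gamma> i (loc c \<alpha>) w)) k"
  proof (cases k)
    case 0
    then show ?thesis by (simp add: gen_loc_nth fps_sum_nth mult.assoc)
  next
    case (Suc m)
    have "ev (Suc m) (delta_star A \<Gamma> m (\<alpha> m) c (fst w)) (snd w) =
        - ev (Suc m) (\<lambda>is. cov_deriv \<Gamma> (\<alpha> m) c (fst w) (hd is) (tl is)) (snd w)"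
      unfolding delta_star_def Suc_eq_plus1 ev_restrict_tensor[OF assms(1,2)] ev_minus ev_symmetrize ..
    also have "\<dots> = - (\<Sum>i. snd w i * ev m (cov_deriv \<Gamma> (\<alpha> m) c (fst w) i) (snd w))"
      by simp
    finally show ?thesis
      by (simp add: Suc gen_loc_nth fps_sum_nth mult.assoc nabla_nth[OF assms(3)] del: ev.simps)
  qed
qed

lemma ev_contract_nabla:
  assumes "k > 0" "m + 1 = k + l"
  shows "ev m (contract_nabla \<Omega> \<Gamma> k \<alpha> \<beta> c x) y = (\<Sum>p q. form_up \<Omega> c x p q *
    (ev (k - 1) (\<lambda>is. \<alpha> c x (p # is)) y * ev l (cov_deriv \<Gamma> \<beta> c x q) y))"
proof -
  have m: "m = (k - 1) + l" using assms by auto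
  show ?thesis
    unfolding contract_nabla_def ev_symmetrize m
    by (rule ev_contract[of "k - 1" l "\<lambda>p is. \<alpha> c x (p # is)"])
qed

lemma gen_hat_schouten:
  assumes "c \<in> A" "fst w \<in> chart_dom c" "local_field c (loc c \<alpha>)" "local_field c (loc c \<beta>)"
  shows "ser c (hat_schouten A \<Omega> \<Gamma> \<alpha> \<beta>) w =
    (\<Sum>p q. fps_const (form_up \<Omega> c (fst w) p q) *
      (der c (Inr p) \<beta> w * nabla c \<Gamma> q (loc c \<alpha>) w -
       der c (Inr p) \<alpha> w * nabla c \<Gamma> q (loc c \<beta>) w))"
    (is "_ = ?R")
proof (rule fps_ext)
  fix m
  let ?a = "\<lambda>p. fps_X * der c (Inr p) \<alpha> w"
  let ?b = "\<lambda>p. fps_X * der c (Inr p) \<beta> w"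
  let ?na = "\<lambda>q. nabla c \<Gamma> q (loc c \<alpha>) w" and ?nb = "\<lambda>q. nabla c \<Gamma> q (loc c \<beta>) w"
  let ?P = "form_up \<Omega> c (fst w)"
  have k: "real k * ev m (contract_nabla \<Omega> \<Gamma> k \<alpha> \<beta> c (fst w)) (snd w) =
      (\<Sum>p q. ?P p q * ((real k * ev (k - 1) (\<lambda>is. \<alpha> c (fst w) (p # is)) (snd w)) *
        ev l (cov_deriv \<Gamma> \<beta> c (fst w) q) (snd w)))"
    if "m + 1 = k + l" for k l and \<alpha> \<beta> :: "('a, 'b) tensor"
    using ev_contract_nabla[of k m l \<Omega> \<Gamma> \<alpha> \<beta>] that
    by (cases "k = 0") (simp_all add: sum_distrib_left mult_ac)
  have e: "ev m (schouten A \<Omega> \<Gamma> k (m + 1 - k) (\<alpha> k) (\<beta> (m + 1 - k)) c (fst w)) (snd w) =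
      (\<Sum>p q. ?P p q * (fps_nth (?na q) k * fps_nth (?b p) (m + 1 - k) -
        fps_nth (?a p) k * fps_nth (?nb q) (m + 1 - k)))"
    if "k \<le> m + 1" for k
  proof -
    have m: "k + (m + 1 - k) - 1 = m" using that by simp
    have "ev m (schouten A \<Omega> \<Gamma> k (m + 1 - k) (\<alpha> k) (\<beta> (m + 1 - k)) c (fst w)) (snd w) =
        - (real k * ev m (contract_nabla \<Omega> \<Gamma> k (\<alpha> k) (\<beta> (m + 1 - k)) c (fst w)) (snd w)) +
        real (m + 1 - k) * ev m (contract_nabla \<Omega> \<Gamma> (m + 1 - k) (\<beta> (m + 1 - k)) (\<alpha> k) c (fst w)) (snd w)"
      unfolding schouten_def m ev_restrict_tensor[OF assms(1,2)] ev_add ev_scale by simp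
    also have "\<dots> = - (\<Sum>p q. ?P p q * (fps_nth (?a p) k * fps_nth (?nb q) (m + 1 - k))) +
        (\<Sum>p q. ?P p q * (fps_nth (?b p) (m + 1 - k) * fps_nth (?na q) k))"
      unfolding gen_Inr_loc_nth nabla_nth[OF assms(3)] nabla_nth[OF assms(4)]
      using k[of k "m + 1 - k" "\<alpha> k" "\<beta> (m + 1 - k)"] k[of "m + 1 - k" k "\<beta> (m + 1 - k)" "\<alpha> k"] that
      by simp
    also have "\<dots> = (\<Sum>p q. ?P p q * (fps_nth (?na q) k * fps_nth (?b p) (m + 1 - k) -
        fps_nth (?a p) k * fps_nth (?nb q) (m + 1 - k)))"
      by (simp add: sum_negf[symmetric] sum.distrib[symmetric] right_diff_distrib mult.commute
          del: fps_X_mult_nth)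
    finally show ?thesis .
  qed
  have "fps_nth (ser c (hat_schouten A \<Omega> \<Gamma> \<alpha> \<beta>) w) m =
      (\<Sum>k=0..m + 1. \<Sum>p q. ?P p q * (fps_nth (?na q) k * fps_nth (?b p) (m + 1 - k) -
        fps_nth (?a p) k * fps_nth (?nb q) (m + 1 - k)))"
    unfolding gen_loc_nth hat_schouten_def sum_fun_apply ev_fun_sum atLeast0AtMost
    by (rule sum.cong) (use e in auto)
  also have "\<dots> = (\<Sum>p q. ?P p q * fps_nth (?na q * ?b p - ?a p * ?nb q) (m + 1))"
    unfolding fps_sub_nth fps_mult_nth sum_distrib_left sum_subtractf[symmetric]
    by (subst sum.swap, rule sum.cong[OF refl], subst sum.swap, rule refl)
  also have "\<dots> = fps_nth ?R m"
  proof -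
    have x: "?na q * ?b p - ?a p * ?nb q = fps_X * (der c (Inr p) \<beta> w * ?na q -
        der c (Inr p) \<alpha> w * ?nb q)" for p q
      by (simp only: mult_ac right_diff_distrib)
    show ?thesis unfolding x by (simp add: fps_sum_nth)
  qed
  finally show "fps_nth (ser c (hat_schouten A \<Omega> \<Gamma> \<alpha> \<beta>) w) m = fps_nth ?R m" .
qed

section \<open>Symmetric tensor fields\<close>

text \<open>
  The components are smooth and symmetric, but the transformation law is left out. Equations between
  series in one chart make sense at this level, which every operation preserves for simple reasons.
\<close>

definition smooth_sym :: "('m, 'n::finite) chart set \<Rightarrow> nat \<Rightarrow> ('m, 'n) tensor \<Rightarrow> bool"
  where "smooth_sym A k \<alpha> \<longleftrightarrow> restrict_tensor A k \<alpha> = \<alpha> \<and> (\<forall>c x. sym_fun (\<alpha> c x)) \<and>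
    (\<forall>c\<in>A. \<forall>is. length is = k \<longrightarrow> smooth_in_chart c (\<lambda>x. \<alpha> c x is))"

definition hat_smooth_sym :: "('m, 'n::finite) chart set \<Rightarrow> (nat \<Rightarrow> ('m, 'n) tensor) set"
  where "hat_smooth_sym A = {\<alpha>. \<forall>k. smooth_sym A k (\<alpha> k)}"

lemma smooth_symI:
  assumes "\<And>c x. sym_fun (U c x)"
    and "\<And>c is. c \<in> A \<Longrightarrow> length is = k \<Longrightarrow> smooth_in_chart c (\<lambda>x. U c x is)"
    and "smooth_manifold A"
  shows "smooth_sym A k (restrict_tensor A k U)"
proof -
  interpret smooth_manifold A by fact
  have "sym_fun (restrict_tensor A k U c x)" for c x
    using assms(1)[of c x] mset_eq_length unfolding sym_fun_def restrict_tensor_def by metis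
  moreover have "smooth_in_chart c (\<lambda>x. restrict_tensor A k U c x is)"
    if "c \<in> A" "length is = k" for c "is"
    by (rule smooth_in_chart_cong[OF that(1) _ assms(2)[OF that]])
      (simp add: restrict_tensor_def that)
  ultimately show ?thesis
    unfolding smooth_sym_def by (auto simp: restrict_tensor_def fun_eq_iff)
qed

lemma sym_fun_scale: "sym_fun T \<Longrightarrow> sym_fun (\<lambda>is. r * T is)"
  unfolding sym_fun_def by metis

lemma sym_fun_add: "sym_fun S \<Longrightarrow> sym_fun T \<Longrightarrow> sym_fun (\<lambda>is. S is + T is)"
  unfolding sym_fun_def by metis

lemma restrict_tensor_add:
  "restrict_tensor A k (\<alpha> + \<beta>) = restrict_tensor A k \<alpha> + restrict_tensor A k \<beta>"
  by (simp add: restrict_tensor_def fun_eq_iff)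

lemma restrict_tensor_scaleR:
  "restrict_tensor A k (r *\<^sub>R \<alpha>) = r *\<^sub>R restrict_tensor A k \<alpha>"
  by (simp add: restrict_tensor_def fun_eq_iff scaleR_fun_def)

context smooth_manifold
begin

lemma smooth_in_chart_symmetrize:
  assumes "c \<in> A" "\<And>js. length js = k \<Longrightarrow> smooth_in_chart c (\<lambda>x. T x js)" "length is = k"
  shows "smooth_in_chart c (\<lambda>x. symmetrize (T x) is)"
proof -
  have "smooth_in_chart c (\<lambda>x. (\<Sum>\<sigma> | \<sigma> permutes {..<length is}. T x (permute_list \<sigma> is)) *
      inverse (fact (length is)))"
    using assms by (intro smooth_in_chart_mult smooth_in_chart_sum smooth_in_chart_const) auto
  then show ?thesis by (simp add: symmetrize_def divide_inverse)
qed

lemma smooth_sym_add: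
  assumes "smooth_sym A k \<alpha>" "smooth_sym A k \<beta>"
  shows "smooth_sym A k (\<alpha> + \<beta>)"
proof -
  have "restrict_tensor A k (\<alpha> + \<beta>) = \<alpha> + \<beta>"
    using assms by (simp add: restrict_tensor_add smooth_sym_def)
  then show ?thesis
    using assms sym_fun_add smooth_in_chart_add
    unfolding smooth_sym_def plus_fun_def by blast
qed

lemma smooth_sym_scaleR:
  assumes "smooth_sym A k \<alpha>"
  shows "smooth_sym A k (r *\<^sub>R \<alpha>)"
proof -
  have "restrict_tensor A k (r *\<^sub>R \<alpha>) = r *\<^sub>R \<alpha>"
    using assms by (simp add: restrict_tensor_scaleR smooth_sym_def)
  then show ?thesis
    using assms sym_fun_scale smooth_in_chart_mult[OF _ smooth_in_chart_const]
    unfolding smooth_sym_def scaleR_fun_def real_scaleR_def by blast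
qed

lemma smooth_sym_0: "smooth_sym A k 0"
  unfolding smooth_sym_def
  by (auto simp: restrict_tensor_def fun_eq_iff sym_fun_def intro: smooth_in_chart_const)

lemma smooth_sym_sum: "(\<And>i. i \<in> I \<Longrightarrow> smooth_sym A k (f i)) \<Longrightarrow> smooth_sym A k (\<Sum>i\<in>I. f i)"
  by (induction I rule: infinite_finite_induct) (simp_all add: smooth_sym_0 smooth_sym_add)

lemma smooth_symD:
  assumes "smooth_sym A k \<alpha>"
  shows "sym_fun (\<alpha> c x)"
    and "c \<in> A \<Longrightarrow> length is = k \<Longrightarrow> smooth_in_chart c (\<lambda>x. \<alpha> c x is)"
  using assms unfolding smooth_sym_def by blast+

lemma hat_smooth_symD: "\<alpha> \<in> hat_smooth_sym A \<Longrightarrow> smooth_sym A k (\<alpha> k)"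
  by (simp add: hat_smooth_sym_def)

lemma local_field_loc: "\<alpha> \<in> hat_smooth_sym A \<Longrightarrow> c \<in> A \<Longrightarrow> local_field c (loc c \<alpha>)"
  using smooth_symD[OF hat_smooth_symD] unfolding local_field_def loc_def by blast

lemma smooth_sym_sym_prod:
  "smooth_sym A k \<alpha> \<Longrightarrow> smooth_sym A l \<beta> \<Longrightarrow> smooth_sym A (k + l) (sym_prod A k l \<alpha> \<beta>)"
  unfolding sym_prod_def
  by (intro smooth_symI sym_fun_symmetrize smooth_manifold_axioms smooth_in_chart_symmetrize
      smooth_in_chart_mult smooth_symD(2)) auto

lemma smooth_in_chart_cov_deriv:
  assumes "smooth_sym A k \<alpha>" "affine_connection A \<Gamma>" "c \<in> A" "length js = k"
  shows "smooth_in_chart c (\<lambda>x. cov_deriv \<Gamma> \<alpha> c x i js)"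
  unfolding cov_deriv_def using assms(2,3,4) smooth_symD(2)[OF assms(1,3)]
  by (intro smooth_in_chart_diff smooth_in_chart_sum smooth_in_chart_mult smooth_in_chart_pd)
    (auto simp: affine_connection_def)

lemma smooth_sym_delta_star:
  assumes "smooth_sym A k \<alpha>" "affine_connection A \<Gamma>"
  shows "smooth_sym A (k + 1) (delta_star A \<Gamma> k \<alpha>)"
  unfolding delta_star_def
proof (rule smooth_symI)
  fix c x
  show "sym_fun (\<lambda>is. - symmetrize (\<lambda>is. cov_deriv \<Gamma> \<alpha> c x (hd is) (tl is)) is)"
    using sym_fun_scale[OF sym_fun_symmetrize, of "-1"] by simp
qed (auto intro!: smooth_in_chart_minus smooth_in_chart_symmetrize[where k = "k + 1"]
    smooth_in_chart_cov_deriv assms smooth_manifold_axioms)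

lemma hat_smooth_sym_closed:
  "\<alpha> \<in> hat_smooth_sym A \<Longrightarrow> \<beta> \<in> hat_smooth_sym A \<Longrightarrow> \<alpha> + \<beta> \<in> hat_smooth_sym A"
  "\<alpha> \<in> hat_smooth_sym A \<Longrightarrow> r *\<^sub>R \<alpha> \<in> hat_smooth_sym A"
  "\<alpha> \<in> hat_smooth_sym A \<Longrightarrow> \<beta> \<in> hat_smooth_sym A \<Longrightarrow> hat_sym_prod A \<alpha> \<beta> \<in> hat_smooth_sym A"
  "\<alpha> \<in> hat_smooth_sym A \<Longrightarrow> affine_connection A \<Gamma> \<Longrightarrow> hat_delta_star A \<Gamma> \<alpha> \<in> hat_smooth_sym A"
proof -
  show "\<alpha> \<in> hat_smooth_sym A \<Longrightarrow> \<beta> \<in> hat_smooth_sym A \<Longrightarrow> \<alpha> + \<beta> \<in> hat_smooth_sym A"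
    by (simp add: hat_smooth_sym_def smooth_sym_add)
  show "\<alpha> \<in> hat_smooth_sym A \<Longrightarrow> r *\<^sub>R \<alpha> \<in> hat_smooth_sym A"
    by (simp add: hat_smooth_sym_def smooth_sym_scaleR scaleR_fun_def[of r \<alpha>])
  show "\<alpha> \<in> hat_smooth_sym A \<Longrightarrow> \<beta> \<in> hat_smooth_sym A \<Longrightarrow> hat_sym_prod A \<alpha> \<beta> \<in> hat_smooth_sym A"
  proof -
    assume *: "\<alpha> \<in> hat_smooth_sym A" "\<beta> \<in> hat_smooth_sym A"
    have "smooth_sym A m (sym_prod A k (m - k) (\<alpha> k) (\<beta> (m - k)))" if "k \<le> m" for k m
      using smooth_sym_sym_prod[OF hat_smooth_symD[OF *(1)] hat_smooth_symD[OF *(2)], of k "m - k"]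
        that by simp
    then show ?thesis
      by (auto simp: hat_smooth_sym_def hat_sym_prod_def intro!: smooth_sym_sum)
  qed
  assume *: "\<alpha> \<in> hat_smooth_sym A" "affine_connection A \<Gamma>"
  have "smooth_sym A k (hat_delta_star A \<Gamma> \<alpha> k)" for k
    using smooth_sym_delta_star[OF hat_smooth_symD[OF *(1)] *(2)] by (cases k) (simp_all add: smooth_sym_0)
  then show "hat_delta_star A \<Gamma> \<alpha> \<in> hat_smooth_sym A" by (simp add: hat_smooth_sym_def)
qed

text \<open>
  A symmetric tensor is determined by its polynomial, so equations between the operations
  may be checked on generating series.
\<close>

lemma hat_smooth_sym_eqI:
  assumes "\<alpha> \<in> hat_smooth_sym A" "\<beta> \<in> hat_smooth_sym A"
    and "\<And>c w. c \<in> A \<Longrightarrow> fst w \<in> chart_dom c \<Longrightarrow> ser c \<alpha> w = ser c \<beta> w"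
  shows "\<alpha> = \<beta>"
proof (intro ext)
  fix k c x "is"
  have r: "restrict_tensor A k (\<alpha> k) = \<alpha> k" "restrict_tensor A k (\<beta> k) = \<beta> k"
    using assms(1,2) by (auto simp: hat_smooth_sym_def smooth_sym_def)
  show "\<alpha> k c x is = \<beta> k c x is"
  proof (cases "c \<in> A \<and> x \<in> chart_dom c \<and> length is = k")
    case True
    have "sym_fun (\<lambda>is. \<alpha> k c x is + - 1 * \<beta> k c x is)"
      by (intro sym_fun_add sym_fun_scale smooth_symD[OF hat_smooth_symD] assms)
    moreover have "ev k (\<lambda>is. \<alpha> k c x is + - 1 * \<beta> k c x is) y = 0" for y
      using arg_cong[OF assms(3)[of c "(x, y)"], of "\<lambda>f. fps_nth f k"] True
      by (simp add: gen_loc_nth ev_diff)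
    ultimately have "\<alpha> k c x is + - 1 * \<beta> k c x is = 0"
      by (rule ev_eq_zeroD) (use True in auto)
    then show ?thesis by simp
  next
    case False
    then show ?thesis
      using fun_cong[OF fun_cong[OF fun_cong[OF r(1), of c], of x], of "is"]
        fun_cong[OF fun_cong[OF fun_cong[OF r(2), of c], of x], of "is"]
      by (auto simp: restrict_tensor_def split: if_splits)
  qed
qed

text \<open>
  Together with the converse \<open>hat_sym_tensorsI\<close> this says: a family of symmetric components satisfies the
  transformation law iff its series are the same function on the tangent bundle in all charts.
\<close>

lemma tensor_transformation:
  assumes "\<alpha> \<in> hat_sym_tensors A" "c \<in> A" "c' \<in> A" "x \<in> chart_dom c" "x \<in> chart_dom c'"
  shows "ser c' \<alpha> (x, y) = ser c \<alpha> (x, \<lambda>a. \<Sum>i. jac c c' a i x * y i)"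
proof (rule fps_ext)
  fix k
  have "ev k (\<alpha> k c' x) y =
      ev k (\<lambda>is. \<Sum>as | length as = k. (\<Prod>r<k. jac c c' (as ! r) (is ! r) x) * \<alpha> k c x as) y"
    using assms by (intro ev_cong) (auto simp: hat_sym_tensors_def sym_tensors_def tensor_fields_def)
  also have "\<dots> = ev k (\<alpha> k c x) (\<lambda>a. \<Sum>i. jac c c' a i x * y i)"
    by (rule ev_substitution)
  finally show "fps_nth (ser c' \<alpha> (x, y)) k =
      fps_nth (ser c \<alpha> (x, \<lambda>a. \<Sum>i. jac c c' a i x * y i)) k"
    by (simp add: gen_loc_nth)
qed

text \<open>
  A symmetric \<open>T\<close> stays symmetric under the transformation law, because a permutation of the free indices may
  be moved to the summation indices.
\<close>

lemma sym_fun_substitution: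
  fixes T :: "'i list \<Rightarrow> real" and J :: "'i \<Rightarrow> 'i \<Rightarrow> real"
  assumes "sym_fun T"
  shows "sym_fun (\<lambda>is. \<Sum>as | length as = length is. (\<Prod>r<length is. J (as ! r) (is ! r)) * T as)"
  unfolding sym_fun_def
proof (intro allI impI)
  fix "is" js :: "'i list" assume "mset is = mset js"
  then obtain \<pi> where \<pi>: "\<pi> permutes {..<length js}" "permute_list \<pi> js = is"
    using mset_eq_permutation by blast
  then have l: "length is = length js" by auto
  let ?L = "{as :: 'i list. length as = length js}"
  have bij: "bij_betw (permute_list \<pi>) ?L ?L" by (rule bij_betw_permute_list[OF \<pi>(1)])
  have "(\<Sum>as\<in>?L. (\<Prod>r<length js. J (as ! r) (is ! r)) * T as) =
      (\<Sum>as\<in>?L. (\<Prod>r<length js. J (permute_list \<pi> as ! r) (is ! r)) * T (permute_list \<pi> as))"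
    by (rule sum.reindex_bij_betw[OF bij, symmetric])
  also have "\<dots> = (\<Sum>as\<in>?L. (\<Prod>r<length js. J (as ! r) (js ! r)) * T as)"
  proof (rule sum.cong[OF refl])
    fix as assume as: "as \<in> ?L"
    have "(\<Prod>r<length js. J (permute_list \<pi> as ! r) (is ! r)) =
        (\<Prod>r<length js. J (as ! \<pi> r) (js ! \<pi> r))"
      using as \<pi> by (intro prod.cong refl) (auto simp: permute_list_nth)
    also have "\<dots> = (\<Prod>r<length js. J (as ! r) (js ! r))"
      by (rule prod.reindex_bij_betw[OF permutes_imp_bij[OF \<pi>(1)]])
    finally show "(\<Prod>r<length js. J (permute_list \<pi> as ! r) (is ! r)) * T (permute_list \<pi> as) =
        (\<Prod>r<length js. J (as ! r) (js ! r)) * T as"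
      using sym_funD[OF assms, of "permute_list \<pi> as" as] as \<pi>(1) by simp
  qed
  finally show "(\<Sum>as | length as = length is. (\<Prod>r<length is. J (as ! r) (is ! r)) * T as) =
      (\<Sum>as | length as = length js. (\<Prod>r<length js. J (as ! r) (js ! r)) * T as)"
    by (simp add: l)
qed

lemma hat_sym_tensorsI:
  assumes "\<alpha> \<in> hat_smooth_sym A"
    and "\<And>c c' x y. c \<in> A \<Longrightarrow> c' \<in> A \<Longrightarrow> x \<in> chart_dom c \<Longrightarrow> x \<in> chart_dom c' \<Longrightarrow>
      ser c' \<alpha> (x, y) = ser c \<alpha> (x, \<lambda>a. \<Sum>i. jac c c' a i x * y i)"
  shows "\<alpha> \<in> hat_sym_tensors A"
  unfolding hat_sym_tensors_def
proof (intro CollectI allI)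
  fix k
  have s: "smooth_sym A k (\<alpha> k)" by (rule hat_smooth_symD[OF assms(1)])
  have "\<alpha> k c' x is = (\<Sum>as | length as = k. (\<Prod>r<k. jac c c' (as ! r) (is ! r) x) * \<alpha> k c x as)"
    if c: "c \<in> A" "c' \<in> A" "x \<in> chart_dom c" "x \<in> chart_dom c'" and l: "length is = k" for c c' x "is"
  proof -
    let ?J = "\<lambda>a i. jac c c' a i x"
    define T where "T = (\<lambda>is. \<Sum>as | length as = length is.
      (\<Prod>r<length is. ?J (as ! r) (is ! r)) * \<alpha> k c x as)"
    have "sym_fun (\<lambda>is. \<alpha> k c' x is + - 1 * T is)"
      unfolding T_def by (intro sym_fun_add sym_fun_scale sym_fun_substitution smooth_symD(1)[OF s])
    moreover have "ev k (\<lambda>is. \<alpha> k c' x is + - 1 * T is) y = 0" for y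
    proof -
      have "ev k T y = ev k (\<lambda>is. \<Sum>as | length as = k. (\<Prod>r<k. ?J (as ! r) (is ! r)) * \<alpha> k c x as) y"
        by (rule ev_cong) (simp add: T_def)
      also have "\<dots> = ev k (\<alpha> k c x) (\<lambda>a. \<Sum>i. ?J a i * y i)"
        by (rule ev_substitution)
      also have "\<dots> = ev k (\<alpha> k c' x) y"
        using arg_cong[OF assms(2)[OF c], of "\<lambda>f. fps_nth f k"] by (simp add: gen_loc_nth)
      finally show ?thesis by (simp add: ev_diff)
    qed
    ultimately have "\<alpha> k c' x is + - 1 * T is = 0" by (rule ev_eq_zeroD) (rule l)
    then show ?thesis by (simp add: T_def l)
  qed
  then show "\<alpha> k \<in> sym_tensors A k"
    using s unfolding sym_tensors_def tensor_fields_def smooth_sym_def sym_fun_def by blast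
qed

lemma hat_sym_tensors_smooth: "\<alpha> \<in> hat_sym_tensors A \<Longrightarrow> \<alpha> \<in> hat_smooth_sym A"
proof -
  assume *: "\<alpha> \<in> hat_sym_tensors A"
  have mem: "\<alpha> k \<in> sym_tensors A k" for k using * by (simp add: hat_sym_tensors_def)
  have "smooth_sym A k (\<alpha> k)" for k
    using mem[of k]
    unfolding sym_tensors_def tensor_fields_def smooth_sym_def sym_fun_def mem_Collect_eq
    by iprover
  then show ?thesis by (simp add: hat_smooth_sym_def)
qed

end

section \<open>The symplectic form and its inverse\<close>

lemma matrix_inv_inverse:
  fixes M :: "real ^ 'n ^ 'n"
  assumes "invertible M"
  shows "M ** matrix_inv M = mat 1" "matrix_inv M ** M = mat 1"
  using someI_ex[OF assms[unfolded invertible_def]] unfolding matrix_inv_def by auto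

text \<open>
  Cramer's rule presents the entries of the inverse as quotients of polynomials in the entries of \<open>M\<close>,
  which makes them smooth functions whenever those are.
\<close>

lemma matrix_inv_cramer:
  fixes M :: "real ^ 'n ^ 'n"
  assumes "invertible M"
  shows "matrix_inv M $ p $ q = det (\<chi> i j. if j = p then (if i = q then 1 else 0) else M $ i $ j) * inverse (det M)"
proof -
  let ?b = "axis q 1 :: real ^ 'n"
  have "M *v (matrix_inv M *v ?b) = ?b"
    using matrix_inv_inverse(1)[OF assms] by (simp add: matrix_vector_mul_assoc)
  then have "matrix_inv M *v ?b = (\<chi> k. det (\<chi> i j. if j = k then ?b $ i else M $ i $ j) / det M)"
    using cramer[of M] assms by (simp add: invertible_det_nz)
  moreover have "(matrix_inv M *v ?b) $ p = matrix_inv M $ p $ q"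
    by (simp add: matrix_vector_mult_def axis_def if_distrib cong: if_cong)
  ultimately have "matrix_inv M $ p $ q =
      det (\<chi> i j. if j = p then ?b $ i else M $ i $ j) * inverse (det M)"
    by (simp add: divide_inverse)
  moreover have "?b $ i = (if i = q then 1 else 0)" for i by (simp add: axis_def)
  ultimately show ?thesis by (simp cong: if_cong)
qed

context smooth_manifold
begin

lemma smooth_in_chart_det:
  fixes F :: "'m \<Rightarrow> real ^ 'k ^ 'k"
  assumes "c \<in> A" "\<And>i j. smooth_in_chart c (\<lambda>x. F x $ i $ j)"
  shows "smooth_in_chart c (\<lambda>x. det (F x))"
  unfolding det_def
  by (intro smooth_in_chart_sum smooth_in_chart_mult smooth_in_chart_prod smooth_in_chart_const assms)

end

context symplectic_manifold
begin

abbreviation form where "form c x i j \<equiv> \<Omega> c x [i, j]"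
abbreviation upper where "upper c x i j \<equiv> form_up \<Omega> c x i j"

lemma smooth_form: "c \<in> A \<Longrightarrow> smooth_in_chart c (\<lambda>x. form c x i j)"
  using form_tensor unfolding tensor_fields_def by simp

lemma upper_form:
  assumes "c \<in> A" "x \<in> chart_dom c"
  shows "(\<Sum>q. upper c x p q * form c x q r) = (if p = r then - 1 else 0)"
    and "(\<Sum>q. form c x p q * upper c x q r) = (if p = r then - 1 else 0)"
  using arg_cong[OF matrix_inv_inverse(2)[OF form_nondegenerate[OF assms]], of "\<lambda>M. M $ p $ r"]
    arg_cong[OF matrix_inv_inverse(1)[OF form_nondegenerate[OF assms]], of "\<lambda>M. M $ p $ r"]
  by (auto simp: matrix_matrix_mult_def mat_def form_up_def form_matrix_def sum_negf)

lemma upper_skew: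
  assumes "c \<in> A" "x \<in> chart_dom c"
  shows "upper c x p q = - upper c x q p"
proof -
  have "(\<Sum>s t. upper c x p s * form c x s t * upper c x q t) =
      (\<Sum>t. (\<Sum>s. upper c x p s * form c x s t) * upper c x q t)"
    by (subst sum.swap) (simp add: sum_distrib_right)
  also have "\<dots> = - upper c x q p"
    by (simp add: upper_form(1)[OF assms] if_distrib if_distribR cong: if_cong)
  finally have 1: "(\<Sum>s t. upper c x p s * form c x s t * upper c x q t) = - upper c x q p" .
  have "(\<Sum>s t. upper c x p s * form c x s t * upper c x q t) =
      (\<Sum>s. upper c x p s * - (\<Sum>t. upper c x q t * form c x t s))"
    by (subst form_skew) (simp add: sum_distrib_left sum_negf mult_ac)
  also have "\<dots> = upper c x p q"
    by (simp add: upper_form(1)[OF assms] if_distrib if_distribR cong: if_cong)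
  finally show ?thesis using 1 by simp
qed

lemma smooth_upper:
  assumes "c \<in> A"
  shows "smooth_in_chart c (\<lambda>x. upper c x p q)"
proof (rule smooth_in_chart_cong[OF assms])
  let ?N = "\<lambda>x. \<chi> i j. if j = p then (if i = q then 1 else 0) else form_matrix \<Omega> c x $ i $ j"
  have M: "smooth_in_chart c (\<lambda>x. form_matrix \<Omega> c x $ i $ j)" for i j
    using smooth_form[OF assms] by (simp add: form_matrix_def)
  have N: "smooth_in_chart c (\<lambda>x. ?N x $ i $ j)" for i j
    by (cases "j = p"; cases "i = q") (simp_all add: M smooth_in_chart_const)
  show "smooth_in_chart c (\<lambda>x. - (det (?N x) * inverse (det (form_matrix \<Omega> c x))))"
    using M N form_nondegenerate[OF assms]
    by (intro smooth_in_chart_minus smooth_in_chart_mult smooth_in_chart_inverse smooth_in_chart_det assms)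
      (auto simp: invertible_det_nz)
qed (use matrix_inv_cramer[OF form_nondegenerate[OF assms]] in \<open>simp add: form_up_def\<close>)

lemma form_transformation:
  assumes "c \<in> A" "c' \<in> A" "x \<in> chart_dom c" "x \<in> chart_dom c'"
  shows "form c' x i j = (\<Sum>a b. jac c c' a i x * jac c c' b j x * form c x a b)"
proof -
  have "form c' x i j = (\<Sum>as | length as = Suc (Suc 0).
      (\<Prod>r<2. jac c c' (as ! r) ([i, j] ! r) x) * \<Omega> c x as)"
    using form_tensor assms unfolding tensor_fields_def by (simp add: numeral_2_eq_2)
  also have "\<dots> = (\<Sum>a b. jac c c' a i x * jac c c' b j x * form c x a b)"
    unfolding sum_lists_Suc by (simp add: numeral_2_eq_2)
  finally show ?thesis .
qed

lemma upper_transformation: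
  assumes "c \<in> A" "c' \<in> A" "x \<in> chart_dom c" "x \<in> chart_dom c'"
  shows "(\<Sum>p q. upper c' x p q * jac c c' a p x * jac c c' b q x) = upper c x a b"
proof -
  define J where "J = (\<chi> a i. jac c c' a i x)"
  define K where "K = (\<chi> a i. jac c' c a i x)"
  let ?M = "form_matrix \<Omega> c x" and ?M' = "form_matrix \<Omega> c' x"
  let ?X = "J ** (matrix_inv ?M' ** transpose J)"
  have JK: "J ** K = mat 1" and KJ: "K ** J = mat 1"
  proof -
    have "(\<Sum>a. jac c c' i a x * jac c' c a k x) = (if i = k then 1 else 0)"
      "(\<Sum>a. jac c' c i a x * jac c c' a k x) = (if i = k then 1 else 0)" for i k
      using jac_inverse[OF assms(2,1,4,3), of k i] jac_inverse[OF assms, of k i]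
      by (auto simp: mult.commute)
    then show "J ** K = mat 1" "K ** J = mat 1"
      by (simp_all add: J_def K_def matrix_matrix_mult_def mat_def vec_eq_iff)
  qed
  have M': "?M' = transpose J ** (?M ** J)"
    unfolding vec_eq_iff
    by (simp add: form_matrix_def form_transformation[OF assms] matrix_matrix_mult_def transpose_def
        J_def sum_distrib_left mult_ac)
  have tr: "transpose K ** transpose J = mat 1" "transpose J ** transpose K = mat 1"
    using arg_cong[OF JK, of transpose] arg_cong[OF KJ, of transpose]
    by (simp_all add: matrix_transpose_mul)
  have "?M = (transpose K ** transpose J) ** ?M ** (J ** K)"
    by (simp add: tr JK)
  also have "\<dots> = transpose K ** ?M' ** K"
    by (simp add: M' matrix_mul_assoc)
  finally have M: "?M = transpose K ** ?M' ** K" .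
  have "?M ** ?X = transpose K ** ?M' ** (K ** J) ** matrix_inv ?M' ** transpose J"
    by (subst M) (simp add: matrix_mul_assoc)
  also have "\<dots> = transpose K ** (?M' ** matrix_inv ?M') ** transpose J"
    by (simp add: KJ matrix_mul_assoc)
  also have "\<dots> = mat 1"
    by (simp add: matrix_inv_inverse(1)[OF form_nondegenerate[OF assms(2,4)]] tr)
  finally have "matrix_inv ?M ** (?M ** ?X) = matrix_inv ?M" by simp
  then have "?X = matrix_inv ?M"
    by (simp add: matrix_mul_assoc matrix_inv_inverse(2)[OF form_nondegenerate[OF assms(1,3)]])
  from arg_cong[OF this, of "\<lambda>M. - M $ a $ b"] show ?thesis
    by (simp add: matrix_matrix_mult_def transpose_def J_def form_up_def sum_distrib_left
        sum_negf mult_ac)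
qed

text \<open>
  This is \<open>\<nabla>\<^sub>i \<Omega>\<^sup>p\<^sup>r = 0\<close>. It follows by differentiating the constant \<open>\<Omega>\<^sup>p\<^sup>q \<Omega>\<^sub>q\<^sub>s\<close> and contracting with \<open>\<Omega>\<^sup>s\<^sup>r\<close>.
\<close>

lemma pd_upper:
  assumes "symplectic_connection A \<Omega> \<Gamma>" "c \<in> A" "x \<in> chart_dom c"
  shows "pd c i (\<lambda>z. upper c z p r) x =
    - (\<Sum>m. \<Gamma> c x i m p * upper c x m r) - (\<Sum>m. \<Gamma> c x i m r * upper c x p m)"
proof -
  let ?P = "upper c x" and ?W = "form c x" and ?G = "\<Gamma> c x i"
  let ?dP = "\<lambda>p q. pd c i (\<lambda>z. upper c z p q) x" and ?dW = "\<lambda>p q. pd c i (\<lambda>z. form c z p q) x"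
  have dW: "?dW q s = (\<Sum>m. ?G q m * ?W m s) + (\<Sum>m. ?G s m * ?W q m)" for q s
  proof -
    have "cov_deriv \<Gamma> \<Omega> c x i [q, s] = 0"
      using assms unfolding symplectic_connection_def by blast
    then show ?thesis by (simp add: cov_deriv_def numeral_2_eq_2)
  qed
  have dP: "(\<Sum>q. ?dP p q * ?W q s + ?dW q s * ?P p q) = 0" for s
  proof -
    have sum: "((\<lambda>t. \<Sum>q. upper c (coord_line c i x t) p q * form c (coord_line c i x t) q s)
        has_real_derivative (\<Sum>q. ?dP p q * form c (coord_line c i x 0) q s +
          ?dW q s * upper c (coord_line c i x 0) p q)) (at 0)"
      by (intro DERIV_sum DERIV_mult DERIV_coord_line smooth_in_chart_diff_at assms smooth_upper smooth_form)
    have ev: "\<forall>\<^sub>F t in nhds 0. (\<Sum>q. upper c (coord_line c i x t) p q * form c (coord_line c i x t) q s) =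
        (if p = s then - 1 else 0)"
      using eventually_coord_line_in[OF assms(2,3) open_dom[OF assms(2)] assms(3)]
      by (rule eventually_mono) (rule upper_form(1)[OF assms(2)])
    from DERIV_unique[OF iffD1[OF DERIV_cong_ev[OF refl ev refl] sum] DERIV_const]
    show ?thesis using assms(2,3) by simp
  qed
  have "(\<Sum>s. (\<Sum>q. ?dP p q * ?W q s + ?dW q s * ?P p q) * ?P s r) =
      (\<Sum>q. ?dP p q * (\<Sum>s. ?W q s * ?P s r)) +
      (\<Sum>s q. ?dW q s * ?P p q * ?P s r)"
  proof -
    have "(\<Sum>q. ?dP p q * (\<Sum>s. ?W q s * ?P s r)) =
        (\<Sum>s q. ?dP p q * ?W q s * ?P s r)"
      by (subst sum.swap) (simp add: sum_distrib_left mult_ac)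
    then show ?thesis by (simp add: sum_distrib_right distrib_right sum.distrib)
  qed
  also have "(\<Sum>q. ?dP p q * (\<Sum>s. ?W q s * ?P s r)) = - ?dP p r"
    by (simp add: upper_form(2)[OF assms(2,3)] if_distrib cong: if_cong)
  also have "(\<Sum>s q. ?dW q s * ?P p q * ?P s r) =
      (\<Sum>s q m. ?G q m * ?W m s * ?P p q * ?P s r) +
      (\<Sum>s q m. ?G s m * ?W q m * ?P p q * ?P s r)"
    by (simp add: dW sum_distrib_right distrib_right sum.distrib)
  also have "(\<Sum>s q m. ?G q m * ?W m s * ?P p q * ?P s r) =
      (\<Sum>q m. ?G q m * ?P p q * (\<Sum>s. ?W m s * ?P s r))"
    unfolding sum_distrib_left
    by (subst sum.swap, rule sum.cong[OF refl], subst sum.swap) (simp add: mult_ac)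
  also have "\<dots> = - (\<Sum>m. ?G m r * ?P p m)"
    by (simp add: upper_form(2)[OF assms(2,3)] if_distrib sum_negf cong: if_cong)
  also have "(\<Sum>s q m. ?G s m * ?W q m * ?P p q * ?P s r) =
      (\<Sum>s m. ?G s m * ?P s r * (\<Sum>q. ?P p q * ?W q m))"
    unfolding sum_distrib_left
    by (rule sum.cong[OF refl], subst sum.swap) (simp add: mult_ac)
  also have "\<dots> = - (\<Sum>m. ?G m p * ?P m r)"
    by (simp add: upper_form(1)[OF assms(2,3)] if_distrib sum_negf cong: if_cong)
  finally show ?thesis by (simp add: dP)
qed

end

section \<open>The operations preserve tensor fields\<close>

context symplectic_manifold
begin

lemma smooth_sym_alg_bracket:
  assumes "smooth_sym A k \<alpha>" "smooth_sym A l \<beta>"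
  shows "smooth_sym A (k + l - 2) (alg_bracket A \<Omega> k l \<alpha> \<beta>)"
  unfolding alg_bracket_def
proof (rule smooth_symI[OF sym_fun_scale[OF sym_fun_symmetrize] _ smooth_manifold_axioms])
  fix c and "is" :: "'n list" assume c: "c \<in> A" and l: "length is = k + l - 2"
  show "smooth_in_chart c (\<lambda>x. real k * real l * symmetrize (\<lambda>is. \<Sum>p. \<alpha> c x (p # take (k - 1) is) *
      (\<Sum>q. form_up \<Omega> c x p q * \<beta> c x (drop (k - 1) is @ [q]))) is)"
  proof (cases "k = 0 \<or> l = 0")
    case True
    then show ?thesis by (auto simp: smooth_in_chart_const)
  next
    case False
    then show ?thesis
      by (intro smooth_in_chart_mult smooth_in_chart_const smooth_in_chart_sum smooth_upper
          smooth_in_chart_symmetrize[OF c _ l] smooth_symD(2)[OF assms(1)] smooth_symD(2)[OF assms(2)] c)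
        auto
  qed
qed

lemma smooth_in_chart_contract_nabla:
  assumes "smooth_sym A k \<alpha>" "smooth_sym A l \<beta>" "affine_connection A \<Gamma>"
    and c: "c \<in> A" and l: "length is = k + l - 1"
  shows "smooth_in_chart c (\<lambda>x. real k * contract_nabla \<Omega> \<Gamma> k \<alpha> \<beta> c x is)"
proof (cases "k = 0")
  case True
  then show ?thesis by (simp add: smooth_in_chart_const)
next
  case False
  then show ?thesis unfolding contract_nabla_def
    by (intro smooth_in_chart_mult smooth_in_chart_const smooth_in_chart_sum smooth_upper
        smooth_in_chart_symmetrize[OF c _ l] smooth_symD(2)[OF assms(1)]
        smooth_in_chart_cov_deriv[OF assms(2,3)] c) auto
qed

lemma sym_fun_contract_nabla: "sym_fun (contract_nabla \<Omega> \<Gamma> k \<alpha> \<beta> c x)"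
  unfolding contract_nabla_def by (rule sym_fun_symmetrize)

lemma smooth_sym_schouten:
  assumes "smooth_sym A k \<alpha>" "smooth_sym A l \<beta>" "affine_connection A \<Gamma>"
  shows "smooth_sym A (k + l - 1) (schouten A \<Omega> \<Gamma> k l \<alpha> \<beta>)"
  unfolding schouten_def
proof (rule smooth_symI[OF sym_fun_add[OF sym_fun_scale[OF sym_fun_contract_nabla]
      sym_fun_scale[OF sym_fun_contract_nabla]] _ smooth_manifold_axioms])
  fix c and "is" :: "'n list" assume c: "c \<in> A" and l: "length is = k + l - 1"
  show "smooth_in_chart c (\<lambda>x. - real k * contract_nabla \<Omega> \<Gamma> k \<alpha> \<beta> c x is +
      real l * contract_nabla \<Omega> \<Gamma> l \<beta> \<alpha> c x is)"
    using smooth_in_chart_add[OF c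
      smooth_in_chart_minus[OF c smooth_in_chart_contract_nabla[OF assms c l]]
      smooth_in_chart_contract_nabla[OF assms(2,1,3) c]] l by (simp add: add.commute)
qed

lemma hat_smooth_sym_alg_bracket:
  assumes "\<alpha> \<in> hat_smooth_sym A" "\<beta> \<in> hat_smooth_sym A"
  shows "hat_alg_bracket A \<Omega> \<alpha> \<beta> \<in> hat_smooth_sym A"
proof -
  have "smooth_sym A m (alg_bracket A \<Omega> k (m + 2 - k) (\<alpha> k) (\<beta> (m + 2 - k)))" if "k \<le> m + 2" for k m
    using smooth_sym_alg_bracket[OF hat_smooth_symD[OF assms(1)] hat_smooth_symD[OF assms(2)],
      of k "m + 2 - k"] that by simp
  then show ?thesis
    unfolding hat_smooth_sym_def hat_alg_bracket_def
    by (intro CollectI allI smooth_sym_sum) (simp only: atMost_iff)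
qed

lemma hat_smooth_sym_schouten:
  assumes "\<alpha> \<in> hat_smooth_sym A" "\<beta> \<in> hat_smooth_sym A" "affine_connection A \<Gamma>"
  shows "hat_schouten A \<Omega> \<Gamma> \<alpha> \<beta> \<in> hat_smooth_sym A"
proof -
  have "smooth_sym A m (schouten A \<Omega> \<Gamma> k (m + 1 - k) (\<alpha> k) (\<beta> (m + 1 - k)))" if "k \<le> m + 1" for k m
    using smooth_sym_schouten[OF hat_smooth_symD[OF assms(1)] hat_smooth_symD[OF assms(2)] assms(3),
      of k "m + 1 - k"] that by simp
  then show ?thesis
    unfolding hat_smooth_sym_def hat_schouten_def
    by (intro CollectI allI smooth_sym_sum) (simp only: atMost_iff)
qed

end


subsection \<open>Covariance\<close>

lemma fps_deriv_at_0_cong: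
  assumes "\<forall>\<^sub>F t in nhds 0. F t = G t" "fps_deriv_at_0 F D"
  shows "fps_deriv_at_0 G D"
proof -
  have ev: "\<forall>\<^sub>F t in nhds 0. fps_nth (F t) n = fps_nth (G t) n" for n
    using assms(1) by (rule eventually_mono) simp
  show ?thesis
    using assms(2) unfolding fps_deriv_at_0_def DERIV_cong_ev[OF refl ev refl] .
qed

lemma sum_fps_const_swap:
  fixes h :: "'a \<Rightarrow> real fps"
  shows
  "(\<Sum>p\<in>I. fps_const (f p) * (\<Sum>a\<in>J. fps_const (g p a) * h a)) =
    (\<Sum>a\<in>J. fps_const (\<Sum>p\<in>I. f p * g p a) * h a)"
  unfolding sum_distrib_left fps_const_sum sum_distrib_right
  by (subst sum.swap) (simp add: mult.assoc flip: fps_const_mult)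

context smooth_manifold
begin

context
  fixes \<alpha> c c' x y y'
  assumes hat: "\<alpha> \<in> hat_sym_tensors A"
    and c: "c \<in> A" "c' \<in> A" "x \<in> chart_dom c" "x \<in> chart_dom c'"
  defines "y' \<equiv> \<lambda>a. \<Sum>i. jac c c' a i x * y i"
begin

lemma transform_Inr:
  "der c' (Inr p) \<alpha> (x, y) =
    (\<Sum>a. fps_const (jac c c' a p x) * der c (Inr a) \<alpha> (x, y'))"
proof -
  note smooth = hat_sym_tensors_smooth[OF hat]
  let ?y = "\<lambda>t. y(p := y p + t)"
  let ?Y = "\<lambda>t a. \<Sum>i. jac c c' a i x * ?y t i"
  have "fps_deriv_at_0 (\<lambda>t. ser c' \<alpha> (x, ?y t)) (fps_X * der c' (Inr p) \<alpha> (x, y))"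
    using has_d_gen[OF c(2) local_field_loc[OF smooth c(2)], of "(x, y)" "Inr p"] c
    by (simp add: has_d_def shift_def weight_def)
  moreover have "fps_deriv_at_0 (\<lambda>t. ser c \<alpha> (x, ?Y t)) (gen (\<lambda>k z is. 0) (x, ?Y 0) +
      (\<Sum>b. fps_const (\<Sum>i. jac c c' b i x * (if i = p then 1 else 0)) *
        (fps_X * der c (Inr b) \<alpha> (x, ?Y 0))))"
    using local_field_sym[OF local_field_loc[OF smooth c(1)]]
    by (intro fps_deriv_at_0_gen DERIV_sum DERIV_cmult) (auto intro!: derivative_eq_intros)
  moreover have "gen (\<lambda>k z is. 0) w = 0" for w :: "'m \<times> ('n \<Rightarrow> real)"
    by (simp add: gen_def fps_eq_iff)
  moreover have "(\<Sum>i. jac c c' b i x * (if i = p then 1 else 0)) = jac c c' b p x" for b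
    by (simp add: if_distrib cong: if_cong)
  moreover have "?Y 0 = y'" by (simp add: y'_def)
  ultimately have "fps_X * der c' (Inr p) \<alpha> (x, y) =
      (\<Sum>b. fps_const (jac c c' b p x) * (fps_X * der c (Inr b) \<alpha> (x, y')))"
    unfolding tensor_transformation[OF hat c] by (auto dest: fps_deriv_at_0_unique)
  also have "\<dots> = fps_X * (\<Sum>b. fps_const (jac c c' b p x) * der c (Inr b) \<alpha> (x, y'))"
    by (simp add: sum_distrib_left mult_ac)
  finally show ?thesis by simp
qed

text \<open>
  On the curve along which \<open>x\<close> moves and the components \<open>y\<close> in the chart \<open>c'\<close> stay fixed, the components in
  the chart \<open>c\<close> vary with the Jacobian. This is the source of the second sum.
\<close>

lemma transform_Inl:
  "der c' (Inl i) \<alpha> (x, y) =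
    (\<Sum>a. fps_const (jac c c' a i x) * der c (Inl a) \<alpha> (x, y')) +
    (\<Sum>b. fps_const (\<Sum>j. pd c' i (jac c c' b j) x * y j) *
      (fps_X * der c (Inr b) \<alpha> (x, y')))"
proof -
  note smooth = hat_sym_tensors_smooth[OF hat]
  let ?x = "coord_line c' i x"
  let ?Y = "\<lambda>t a. \<Sum>j. jac c c' a j (?x t) * y j"
  let ?\<phi> = "\<lambda>k is. \<Sum>a. jac c c' a i x * pd c a (\<lambda>z. \<alpha> k c z is) x"
  have "fps_deriv_at_0 (\<lambda>t. ser c' \<alpha> (?x t, y)) (der c' (Inl i) \<alpha> (x, y))"
    using has_d_gen[OF c(2) local_field_loc[OF smooth c(2)], of "(x, y)" "Inl i"] c
    by (simp add: has_d_def shift_def weight_def)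
  moreover have "\<forall>\<^sub>F t in nhds 0. ser c' \<alpha> (?x t, y) = ser c \<alpha> (?x t, ?Y t)"
  proof -
    have "\<forall>\<^sub>F t in nhds 0. ?x t \<in> chart_dom c \<inter> chart_dom c'"
      using c by (intro eventually_coord_line_in open_Int open_dom) auto
    then show ?thesis
      by (rule eventually_mono) (use tensor_transformation[OF hat c(1,2)] in auto)
  qed
  ultimately have 1: "fps_deriv_at_0 (\<lambda>t. ser c \<alpha> (?x t, ?Y t))
      (der c' (Inl i) \<alpha> (x, y))"
    by (rule fps_deriv_at_0_cong[rotated])
  have 2: "fps_deriv_at_0 (\<lambda>t. ser c \<alpha> (?x t, ?Y t)) (gen (\<lambda>k z. ?\<phi> k) (?x 0, ?Y 0) +
      (\<Sum>b. fps_const (\<Sum>j. pd c' i (jac c c' b j) x * y j) *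
        (fps_X * der c (Inr b) \<alpha> (?x 0, ?Y 0))))"
  proof (rule fps_deriv_at_0_gen)
    fix k and "is" :: "'n list" assume l: "length is = k"
    have d: "diff_at c (\<lambda>z. \<alpha> k c z is) x"
      using local_field_diff_at[OF local_field_loc[OF smooth c(1)] c(3) l] unfolding loc_def .
    show "((\<lambda>t. loc c \<alpha> k (?x t) is) has_real_derivative ?\<phi> k is) (at 0)"
      using DERIV_coord_line[OF chain_rule(1)[OF c d], of i] chain_rule(2)[OF c d, of i]
      by (simp add: loc_def)
  next
    fix b
    have "((\<lambda>t. \<Sum>j. jac c c' b j (?x t) * y j) has_real_derivative
        (\<Sum>j. pd c' i (jac c c' b j) x * y j)) (at 0)"
      by (intro DERIV_sum DERIV_cmult_right DERIV_coord_line diff_at_jac c)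
    then show "((\<lambda>t. ?Y t b) has_real_derivative (\<Sum>j. pd c' i (jac c c' b j) x * y j)) (at 0)" .
  next
    show "sym_fun (loc c \<alpha> k (?x 0))" for k
      by (rule local_field_sym[OF local_field_loc[OF smooth c(1)]])
  qed
  have 3: "gen (\<lambda>k z. ?\<phi> k) (x, y') =
      (\<Sum>a. fps_const (jac c c' a i x) * der c (Inl a) \<alpha> (x, y'))"
    by (rule fps_ext) (simp add: gen_def fps_sum_nth ev_linear_combination dd_def loc_def)
  have 4: "?x 0 = x" using c by simp
  show ?thesis
    using fps_deriv_at_0_unique[OF 1 2] unfolding 4 y'_def[symmetric] 3 .
qed

text \<open>
  The inhomogeneous term in the transformation law of the Christoffel symbols cancels the second sum
  of \<open>transform_Inl\<close>.
\<close>

lemma transform_nabla: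
  assumes "affine_connection A \<Gamma>"
  shows "nabla c' \<Gamma> i (loc c' \<alpha>) (x, y) =
    (\<Sum>a. fps_const (jac c c' a i x) * nabla c \<Gamma> a (loc c \<alpha>) (x, y'))"
proof -
  let ?J = "\<lambda>a i. jac c c' a i x" and ?K = "\<lambda>a i. jac c' c a i x"
  let ?H = "\<lambda>b j. pd c' i (jac c c' b j) x"
  let ?g = "\<lambda>b. fps_X * der c (Inr b) \<alpha> (x, y')"
  have \<Gamma>: "\<Gamma> c' x i j m = (\<Sum>d. ?K m d *
      ((\<Sum>a e. ?J a i * ?J e j * \<Gamma> c x a e d) + ?H d j))" for j m
    using assms c unfolding affine_connection_def by blast
  have *: "(\<Sum>m. \<Gamma> c' x i j m * ?J b m) =
      (\<Sum>a e. ?J a i * ?J e j * \<Gamma> c x a e b) + ?H b j" (is "_ = ?S b") for b j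
  proof -
    have delta: "(\<Sum>m. ?J b m * ?K m d) = (if d = b then 1 else 0)" for d
      using jac_inverse[OF c(2,1,4,3), of d b] by (simp add: mult.commute)
    have "(\<Sum>m. \<Gamma> c' x i j m * ?J b m) = (\<Sum>d. (\<Sum>m. ?J b m * ?K m d) * ?S d)"
      unfolding \<Gamma> sum_distrib_right by (subst sum.swap) (simp add: mult_ac)
    also have "\<dots> = (\<Sum>d. (if d = b then 1 else 0) * ?S d)"
      unfolding delta ..
    finally show ?thesis by (simp add: if_distrib if_distribR cong: if_cong)
  qed
  have real: "(\<Sum>m. (\<Sum>j. y j * \<Gamma> c' x i j m) * ?J b m) =
      (\<Sum>a. ?J a i * (\<Sum>e. y' e * \<Gamma> c x a e b)) + (\<Sum>j. ?H b j * y j)" for b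
  proof -
    have "(\<Sum>m. (\<Sum>j. y j * \<Gamma> c' x i j m) * ?J b m) =
        (\<Sum>j. y j * (\<Sum>m. \<Gamma> c' x i j m * ?J b m))"
      unfolding sum_distrib_left sum_distrib_right by (subst sum.swap) (simp add: mult_ac)
    also have "\<dots> = (\<Sum>j a e. y j * (?J a i * ?J e j * \<Gamma> c x a e b)) +
        (\<Sum>j. ?H b j * y j)"
      unfolding * distrib_left sum.distrib sum_distrib_left by (simp add: mult_ac)
    also have "(\<Sum>j a e. y j * (?J a i * ?J e j * \<Gamma> c x a e b)) =
        (\<Sum>a. ?J a i * (\<Sum>e. y' e * \<Gamma> c x a e b))"
      unfolding y'_def sum_distrib_left sum_distrib_right
      by (subst sum.swap, rule sum.cong[OF refl], subst sum.swap) (simp add: mult_ac)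
    finally show ?thesis .
  qed
  have "(\<Sum>m. fps_const (\<Sum>j. y j * \<Gamma> c' x i j m) *
      (fps_X * der c' (Inr m) \<alpha> (x, y))) =
      (\<Sum>m. fps_const (\<Sum>j. y j * \<Gamma> c' x i j m) * (\<Sum>b. fps_const (?J b m) * ?g b))"
    unfolding transform_Inr by (simp add: sum_distrib_left mult_ac)
  also have "\<dots> = (\<Sum>b. fps_const (\<Sum>m. (\<Sum>j. y j * \<Gamma> c' x i j m) * ?J b m) * ?g b)"
    by (rule sum_fps_const_swap)
  also have "\<dots> = (\<Sum>b. fps_const (\<Sum>a. ?J a i * (\<Sum>e. y' e * \<Gamma> c x a e b)) * ?g b) +
      (\<Sum>b. fps_const (\<Sum>j. ?H b j * y j) * ?g b)"
    unfolding real fps_const_add[symmetric] distrib_right sum.distrib ..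
  also have "(\<Sum>b. fps_const (\<Sum>a. ?J a i * (\<Sum>e. y' e * \<Gamma> c x a e b)) * ?g b) =
      (\<Sum>a. fps_const (?J a i) * (\<Sum>b. fps_const (\<Sum>e. y' e * \<Gamma> c x a e b) * ?g b))"
    by (rule sum_fps_const_swap[symmetric])
  finally show ?thesis
    unfolding nabla_alt transform_Inl right_diff_distrib sum_subtractf by simp
qed

end

end

lemma sum_fps_const_bilinear:
  fixes u v :: "'n::finite \<Rightarrow> real fps"
  shows "(\<Sum>p q. fps_const (f p q) *
      ((\<Sum>a. fps_const (J a p) * u a) * (\<Sum>b. fps_const (J b q) * v b))) =
    (\<Sum>a b. fps_const (\<Sum>p q. f p q * J a p * J b q) * (u a * v b))"
proof -
  let ?U = "\<lambda>p. \<Sum>a. fps_const (J a p) * u a"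
  let ?g = "\<lambda>p b. \<Sum>q. f p q * J b q"
  have "(\<Sum>p q. fps_const (f p q) * (?U p * (\<Sum>b. fps_const (J b q) * v b))) =
      (\<Sum>p. ?U p * (\<Sum>q. fps_const (f p q) * (\<Sum>b. fps_const (J b q) * v b)))"
    by (simp add: sum_distrib_left[of "?U p" for p] mult.left_commute)
  also have "\<dots> = (\<Sum>p. ?U p * (\<Sum>b. fps_const (?g p b) * v b))"
    by (simp only: sum_fps_const_swap)
  also have "\<dots> = (\<Sum>b. v b * (\<Sum>p. fps_const (?g p b) * ?U p))"
    unfolding sum_distrib_left[of "?U p" for p] sum_distrib_left[of "v b" for b]
    by (subst sum.swap) (simp only: mult_ac)
  also have "\<dots> = (\<Sum>b. v b * (\<Sum>a. fps_const (\<Sum>p. ?g p b * J a p) * u a))"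
    by (simp only: sum_fps_const_swap)
  also have "\<dots> = (\<Sum>a b. fps_const (\<Sum>p. ?g p b * J a p) * (u a * v b))"
    unfolding sum_distrib_left[of "v b" for b] by (subst sum.swap) (simp only: mult_ac)
  also have "\<dots> = (\<Sum>a b. fps_const (\<Sum>p q. f p q * J a p * J b q) * (u a * v b))"
    by (simp only: sum_distrib_right sum_distrib_left mult_ac)
  finally show ?thesis .
qed

context smooth_manifold
begin

lemma hat_sym_tensors_delta_star:
  assumes "\<alpha> \<in> hat_sym_tensors A" "affine_connection A \<Gamma>"
  shows "hat_delta_star A \<Gamma> \<alpha> \<in> hat_sym_tensors A"
proof (rule hat_sym_tensorsI)
  note smooth = hat_sym_tensors_smooth[OF assms(1)]
  show "hat_delta_star A \<Gamma> \<alpha> \<in> hat_smooth_sym A"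
    by (rule hat_smooth_sym_closed(4)[OF smooth assms(2)])
  fix c c' x and y :: "'n \<Rightarrow> real"
  assume c: "c \<in> A" "c' \<in> A" "x \<in> chart_dom c" "x \<in> chart_dom c'"
  let ?y' = "\<lambda>a. \<Sum>i. jac c c' a i x * y i"
  have "ser c' (hat_delta_star A \<Gamma> \<alpha>) (x, y) =
      - (fps_X * (\<Sum>i. fps_const (y i) *
        (\<Sum>a. fps_const (jac c c' a i x) * nabla c \<Gamma> a (loc c \<alpha>) (x, ?y'))))"
    using c smooth by (simp add: gen_hat_delta_star local_field_loc transform_nabla[OF assms(1) c assms(2)]
        sum_distrib_left mult.assoc)
  also have "\<dots> = - (fps_X * (\<Sum>a. fps_const (?y' a) * nabla c \<Gamma> a (loc c \<alpha>) (x, ?y')))"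
    by (simp only: sum_fps_const_swap mult.commute[of "y i" for i])
  also have "\<dots> = ser c (hat_delta_star A \<Gamma> \<alpha>) (x, ?y')"
    using c smooth by (simp add: gen_hat_delta_star local_field_loc sum_distrib_left mult.assoc)
  finally show "ser c' (hat_delta_star A \<Gamma> \<alpha>) (x, y) = ser c (hat_delta_star A \<Gamma> \<alpha>) (x, ?y')" .
qed

lemma gen_loc_linear:
  "ser c (a *\<^sub>R \<alpha> + b *\<^sub>R \<beta>) w = fps_const a * ser c \<alpha> w + fps_const b * ser c \<beta> w"
proof -
  have "(a *\<^sub>R \<alpha> + b *\<^sub>R \<beta>) k c x = (\<lambda>is. a * \<alpha> k c x is + b * \<beta> k c x is)" for k x
    by (simp add: plus_fun_def scaleR_fun_def)
  then show ?thesis by (simp add: fps_eq_iff gen_loc_nth ev_add ev_scale)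
qed

lemma gen_loc_add: "ser c (\<alpha> + \<beta>) w = ser c \<alpha> w + ser c \<beta> w"
  using gen_loc_linear[of c 1 \<alpha> 1 \<beta> w] by simp

lemma gen_loc_0: "ser c 0 w = 0"
  by (simp add: fps_eq_iff gen_loc_nth zero_fun_def)

lemma hat_smooth_sym_linear:
  "\<alpha> \<in> hat_smooth_sym A \<Longrightarrow> \<beta> \<in> hat_smooth_sym A \<Longrightarrow> a *\<^sub>R \<alpha> + b *\<^sub>R \<beta> \<in> hat_smooth_sym A"
  by (intro hat_smooth_sym_closed)

lemma hat_smooth_sym_0: "0 \<in> hat_smooth_sym A"
  by (simp add: hat_smooth_sym_def smooth_sym_0)

lemma hat_sym_tensors_linear:
  assumes "\<alpha> \<in> hat_sym_tensors A" "\<beta> \<in> hat_sym_tensors A"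
  shows "a *\<^sub>R \<alpha> + b *\<^sub>R \<beta> \<in> hat_sym_tensors A"
proof (rule hat_sym_tensorsI)
  show "a *\<^sub>R \<alpha> + b *\<^sub>R \<beta> \<in> hat_smooth_sym A"
    by (rule hat_smooth_sym_linear[OF assms[THEN hat_sym_tensors_smooth]])
next
  fix c c' x and y :: "'n \<Rightarrow> real"
  assume c: "c \<in> A" "c' \<in> A" "x \<in> chart_dom c" "x \<in> chart_dom c'"
  show "ser c' (a *\<^sub>R \<alpha> + b *\<^sub>R \<beta>) (x, y) =
      ser c (a *\<^sub>R \<alpha> + b *\<^sub>R \<beta>) (x, \<lambda>a. \<Sum>i. jac c c' a i x * y i)"
    unfolding gen_loc_linear tensor_transformation[OF assms(1) c] tensor_transformation[OF assms(2) c] ..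
qed

lemma hat_sym_tensors_0: "0 \<in> hat_sym_tensors A"
  by (rule hat_sym_tensorsI) (simp_all add: hat_smooth_sym_0 gen_loc_0)

lemma subspace_hat_sym_tensors: "subspace (hat_sym_tensors A)"
  unfolding subspace_def
  using hat_sym_tensors_0 hat_sym_tensors_linear[of _ _ 1 1] hat_sym_tensors_linear[of _ 0 _ 0]
  by simp

lemma gen_dd_linear:
  assumes "\<alpha> \<in> hat_smooth_sym A" "\<beta> \<in> hat_smooth_sym A" "c \<in> A" "fst w \<in> chart_dom c"
  shows "der c i (a *\<^sub>R \<alpha> + b *\<^sub>R \<beta>) w =
    fps_const a * der c i \<alpha> w + fps_const b * der c i \<beta> w"
proof (rule has_d_unique)
  show "has_d c i (ser c (a *\<^sub>R \<alpha> + b *\<^sub>R \<beta>)) w (der c i (a *\<^sub>R \<alpha> + b *\<^sub>R \<beta>) w)"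
    by (intro has_d_gen local_field_loc hat_smooth_sym_linear assms)
  have "has_d c i (\<lambda>w. fps_const a * ser c \<alpha> w + fps_const b * ser c \<beta> w) w
      ((0 * ser c \<alpha> w + fps_const a * der c i \<alpha> w) +
       (0 * ser c \<beta> w + fps_const b * der c i \<beta> w))"
    by (intro has_d_add has_d_mult has_d_const has_d_gen local_field_loc assms)
  then show "has_d c i (ser c (a *\<^sub>R \<alpha> + b *\<^sub>R \<beta>)) w
      (fps_const a * der c i \<alpha> w + fps_const b * der c i \<beta> w)"
    by (simp add: gen_loc_linear[abs_def])
qed

end

context symplectic_manifold
begin

lemma hat_sym_tensors_alg_bracket:
  assumes "\<alpha> \<in> hat_sym_tensors A" "\<beta> \<in> hat_sym_tensors A"
  shows "hat_alg_bracket A \<Omega> \<alpha> \<beta> \<in> hat_sym_tensors A"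
proof (rule hat_sym_tensorsI)
  note smooth = assms[THEN hat_sym_tensors_smooth]
  show "hat_alg_bracket A \<Omega> \<alpha> \<beta> \<in> hat_smooth_sym A"
    by (rule hat_smooth_sym_alg_bracket[OF smooth])
  fix c c' x and y :: "'n \<Rightarrow> real"
  assume c: "c \<in> A" "c' \<in> A" "x \<in> chart_dom c" "x \<in> chart_dom c'"
  show "ser c' (hat_alg_bracket A \<Omega> \<alpha> \<beta>) (x, y) =
      ser c (hat_alg_bracket A \<Omega> \<alpha> \<beta>) (x, \<lambda>a. \<Sum>i. jac c c' a i x * y i)"
    using c smooth
    by (simp add: gen_hat_alg_bracket local_field_loc transform_Inr[OF assms(1) c]
        transform_Inr[OF assms(2) c] sum_fps_const_bilinear upper_transformation[OF c])
qed

lemma hat_sym_tensors_schouten: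
  assumes "\<alpha> \<in> hat_sym_tensors A" "\<beta> \<in> hat_sym_tensors A" "affine_connection A \<Gamma>"
  shows "hat_schouten A \<Omega> \<Gamma> \<alpha> \<beta> \<in> hat_sym_tensors A"
proof (rule hat_sym_tensorsI)
  note smooth = assms(1,2)[THEN hat_sym_tensors_smooth]
  show "hat_schouten A \<Omega> \<Gamma> \<alpha> \<beta> \<in> hat_smooth_sym A"
    by (rule hat_smooth_sym_schouten[OF smooth assms(3)])
  fix c c' x and y :: "'n \<Rightarrow> real"
  assume c: "c \<in> A" "c' \<in> A" "x \<in> chart_dom c" "x \<in> chart_dom c'"
  show "ser c' (hat_schouten A \<Omega> \<Gamma> \<alpha> \<beta>) (x, y) =
      ser c (hat_schouten A \<Omega> \<Gamma> \<alpha> \<beta>) (x, \<lambda>a. \<Sum>i. jac c c' a i x * y i)"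
    using c smooth
    by (simp add: gen_hat_schouten local_field_loc transform_Inr[OF assms(1) c]
        transform_Inr[OF assms(2) c] transform_nabla[OF assms(1) c assms(3)]
        transform_nabla[OF assms(2) c assms(3)] right_diff_distrib sum_subtractf
        sum_fps_const_bilinear upper_transformation[OF c])
qed

end


section \<open>The Jacobi identity\<close>

lemma sum_swap_3: "(\<Sum>c\<in>C. \<Sum>d\<in>D. \<Sum>a\<in>A. F c d a) = (\<Sum>a\<in>A. \<Sum>c\<in>C. \<Sum>d\<in>D. F c d a)"
  by (subst sum.swap[of _ A D]) (rule sum.swap)

lemma sum_swap_pairs:
  "(\<Sum>c\<in>C. \<Sum>d\<in>D. \<Sum>a\<in>A. \<Sum>b\<in>B. F c d a b) = (\<Sum>a\<in>A. \<Sum>b\<in>B. \<Sum>c\<in>C. \<Sum>d\<in>D. F c d a b)"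
  by (subst sum_swap_3, rule sum.cong[OF refl], rule sum_swap_3)

text \<open>
  The general fact that a biderivation satisfies the Jacobi identity iff it does so on coordinates. The
  arguments are the first and second derivatives of three functions at one point, and \<open>db\<close> gives the
  derivatives of their brackets. Terms with a second derivative of a function cancel in pairs, because
  \<open>S\<close> is symmetric in its last two arguments; what remains is the identity for the coordinates, contracted with
  the first derivatives.
\<close>

lemma bivector_jacobi:
  fixes B :: "'i::finite \<Rightarrow> 'i \<Rightarrow> 'r::comm_ring_1"
  assumes skew: "\<And>a b. B a b = - B b a"
    and jac: "\<And>a b d. (\<Sum>c. B c d * dB c a b) + (\<Sum>c. B c a * dB c b d) +
      (\<Sum>c. B c b * dB c d a) = 0"
    and sym: "\<And>a b. f2 a b = f2 b a" "\<And>a b. g2 a b = g2 b a" "\<And>a b. h2 a b = h2 b a"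
  defines "db \<equiv> \<lambda>f f2 g g2 c. \<Sum>a b. dB c a b * (f a * g b) +
    B a b * (f2 c a * g b + f a * g2 c b)"
  shows "(\<Sum>c d. B c d * (db f f2 g g2 c * h d)) +
    (\<Sum>c d. B c d * (db g g2 h h2 c * f d)) +
    (\<Sum>c d. B c d * (db h h2 f f2 c * g d)) = 0"
proof -
  define S where "S = (\<lambda>f2 g h. \<Sum>c d a b.
    B c d * (B a b * (f2 c a * g b * h d)))"
  define T where "T = (\<lambda>f g h. \<Sum>a b d. (\<Sum>c. B c d * dB c a b) * (f a * g b * h d))"
  have S_sym: "S f2 g h = S f2 h g" if "\<And>a b. f2 a b = f2 b a" for f2 g h
  proof -
    have "S f2 g h = (\<Sum>a b c d. B c d * (B a b * (f2 c a * g b * h d)))"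
      unfolding S_def by (rule sum_swap_pairs)
    also have "\<dots> = S f2 h g"
      unfolding S_def by (simp only: that[of a c for a c]) (simp only: mult_ac)
    finally show ?thesis .
  qed
  have expand: "(\<Sum>c d. B c d * (db f f2 g g2 c * h d)) = T f g h + (S f2 g h - S g2 f h)"
    for f f2 g g2 h
  proof -
    have "(\<Sum>c d. B c d * (db f f2 g g2 c * h d)) =
        (\<Sum>c d a b. B c d * (dB c a b * (f a * g b * h d))) +
        (S f2 g h + (\<Sum>c d a b. B c d * (B a b * (f a * g2 c b * h d))))"
      unfolding db_def S_def sum_distrib_left sum_distrib_right sum.distrib[symmetric]
      by (simp only: distrib_left distrib_right mult.assoc add.assoc)
    also have "(\<Sum>c d a b. B c d * (dB c a b * (f a * g b * h d))) = T f g h"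
    proof -
      have "(\<Sum>c d a b. B c d * (dB c a b * (f a * g b * h d))) =
          (\<Sum>d a b c. B c d * (dB c a b * (f a * g b * h d)))"
        by (rule trans[OF sum.swap], rule sum.cong[OF refl], rule trans[OF sum.swap],
            rule sum.cong[OF refl], rule sum.swap)
      also have "\<dots> = (\<Sum>d a b. (\<Sum>c. B c d * dB c a b) * (f a * g b * h d))"
        by (simp only: sum_distrib_right mult.assoc)
      also have "\<dots> = T f g h"
        unfolding T_def by (subst sum.swap, rule sum.cong[OF refl], rule sum.swap)
      finally show ?thesis .
    qed
    also have "(\<Sum>c d a b. B c d * (B a b * (f a * g2 c b * h d))) = - S g2 f h"
    proof -
      have "(\<Sum>a b. B c d * (B a b * (f a * g2 c b * h d))) =
          (\<Sum>b a. - (B c d * (B b a * (g2 c b * f a * h d))))" for c d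
        by (subst sum.swap, subst skew) (simp add: mult_ac)
      then show ?thesis unfolding S_def by (simp add: sum_negf)
    qed
    finally show ?thesis by simp
  qed
  have "T f g h + T g h f + T h f g = 0"
  proof -
    have "T g h f = (\<Sum>a b d. (\<Sum>c. B c a * dB c b d) * (f a * g b * h d))"
    proof -
      have "T g h f = (\<Sum>b a d. (\<Sum>c. B c a * dB c b d) * (g b * h d * f a))"
        unfolding T_def by (rule sum.cong[OF refl], rule sum.swap)
      also have "\<dots> = (\<Sum>a b d. (\<Sum>c. B c a * dB c b d) * (f a * g b * h d))"
        by (subst sum.swap) (simp only: mult_ac)
      finally show ?thesis .
    qed
    moreover have "T h f g = (\<Sum>a b d. (\<Sum>c. B c b * dB c d a) * (f a * g b * h d))"
    proof -
      have "T h f g = (\<Sum>a d b. (\<Sum>c. B c b * dB c d a) * (h d * f a * g b))"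
        unfolding T_def by (rule sum.swap)
      also have "\<dots> = (\<Sum>a b d. (\<Sum>c. B c b * dB c d a) * (f a * g b * h d))"
        by (rule sum.cong[OF refl], subst sum.swap) (simp only: mult_ac)
      finally show ?thesis .
    qed
    moreover have "T f g h = (\<Sum>a b d. (\<Sum>c. B c d * dB c a b) * (f a * g b * h d))"
      by (simp only: T_def)
    ultimately have "T f g h + T g h f + T h f g =
        (\<Sum>a b d. ((\<Sum>c. B c d * dB c a b) + (\<Sum>c. B c a * dB c b d) +
      (\<Sum>c. B c b * dB c d a)) * (f a * g b * h d))"
      by (simp only: sum.distrib distrib_right)
    then show ?thesis by (simp add: jac)
  qed
  moreover have "S f2 g h = S f2 h g" "S g2 f h = S g2 h f" "S h2 f g = S h2 g f"
    by (rule S_sym, rule sym)+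
  ultimately show ?thesis unfolding expand by (simp add: algebra_simps)
qed

lemma sum_UNIV_Plus:
  "(\<Sum>a\<in>(UNIV :: ('a::finite + 'b::finite) set). f a) = (\<Sum>i. f (Inl i)) + (\<Sum>i. f (Inr i))"
  using sum.Plus[of UNIV UNIV f] by (simp add: o_def)

locale symplectic_manifold_connection = symplectic_manifold A \<Omega>
  for A :: "('m::{t2_space, second_countable_topology}, 'n::finite) chart set" and \<Omega> +
  fixes \<Gamma> :: "('m, 'n) christoffel"
  assumes connection: "symplectic_connection A \<Omega> \<Gamma>"
begin

abbreviation dupper where "dupper c j x p q \<equiv> pd c j (\<lambda>z. upper c z p q) x"

lemma affine: "affine_connection A \<Gamma>"
  using connection by (simp add: symplectic_connection_def)

lemma christoffel_sym: "c \<in> A \<Longrightarrow> x \<in> chart_dom c \<Longrightarrow> \<Gamma> c x i j k = \<Gamma> c x j i k"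
  using connection unfolding symplectic_connection_def torsion_free_def by blast

lemma dupper_skew:
  assumes "c \<in> A" "x \<in> chart_dom c"
  shows "dupper c j x p q = - dupper c j x q p"
proof -
  have "dupper c j x p q = pd c j (\<lambda>z. - 1 * upper c z q p) x"
    by (rule pd_local[OF assms smooth_in_chart_diff_at[OF smooth_upper[OF assms(1)] assms(2)]])
      (simp add: upper_skew[OF assms(1), of _ p q])
  also have "\<dots> = - 1 * dupper c j x q p"
    by (rule pd_cmult[OF smooth_in_chart_diff_at[OF smooth_upper[OF assms(1)] assms(2)]])
  finally show ?thesis by simp
qed

text \<open>
  By \<open>\<nabla>\<Omega> = 0\<close>, each derivative of \<open>\<Omega>\<^sup>q\<^sup>r\<close> is a sum of two terms linear in \<open>\<Gamma>\<close>. The six resulting terms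
  cancel in pairs since \<open>\<Omega>\<^sup>p\<^sup>l \<Gamma>\<^sub>l\<^sub>m\<^sup>q \<Omega>\<^sup>m\<^sup>r\<close> is symmetric in \<open>p\<close> and \<open>r\<close> for a connection without torsion.
\<close>

lemma upper_poisson:
  assumes "c \<in> A" "x \<in> chart_dom c"
  shows "(\<Sum>l. upper c x p l * dupper c l x q r) + (\<Sum>l. upper c x q l * dupper c l x r p) +
    (\<Sum>l. upper c x r l * dupper c l x p q) = 0"
proof -
  define G where "G = (\<lambda>p q r. \<Sum>l m. upper c x p l * (\<Gamma> c x l m q * upper c x m r))"
  have G: "G p q r = G r q p" for p q r
  proof -
    have "G p q r = (\<Sum>m l. upper c x l p * (\<Gamma> c x m l q * upper c x r m))"
      unfolding G_def upper_skew[OF assms, of p] upper_skew[OF assms, of _ r]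
        christoffel_sym[OF assms, of _ _ q]
      by (subst sum.swap) (simp add: christoffel_sym[OF assms])
    then show ?thesis unfolding G_def by (simp only: mult_ac)
  qed
  have "(\<Sum>l. upper c x p l * dupper c l x q r) = - G p q r + G p r q" for p q r
  proof -
    have "(\<Sum>l. upper c x p l * dupper c l x q r) =
        - G p q r - (\<Sum>l m. upper c x p l * (\<Gamma> c x l m r * upper c x q m))"
      unfolding pd_upper[OF connection assms] G_def
      by (simp add: sum_distrib_left right_diff_distrib sum_subtractf sum_negf)
    also have "(\<Sum>l m. upper c x p l * (\<Gamma> c x l m r * upper c x q m)) = - G p r q"
      unfolding G_def upper_skew[OF assms, of q] by (simp add: sum_negf)
    finally show ?thesis by simp
  qed
  then show ?thesis using G by simp
qed

lemma smooth_dupper: "c \<in> A \<Longrightarrow> smooth_in_chart c (\<lambda>z. dupper c l z q r)"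
  using smooth_in_chart_pd[OF _ smooth_upper] by blast

lemma upper_poisson_derivative:
  assumes "c \<in> A" "x \<in> chart_dom c"
  defines "d2 \<equiv> \<lambda>i l q r. pd c i (\<lambda>z. dupper c l z q r) x"
  shows "(\<Sum>l. dupper c i x p l * dupper c l x q r + upper c x p l * d2 i l q r) +
    (\<Sum>l. dupper c i x q l * dupper c l x r p + upper c x q l * d2 i l r p) +
    (\<Sum>l. dupper c i x r l * dupper c l x p q + upper c x r l * d2 i l p q) = 0"
proof -
  let ?F = "\<lambda>p q r t. \<Sum>l. upper c (coord_line c i x t) p l * dupper c l (coord_line c i x t) q r"
  let ?D = "\<lambda>p q r. \<Sum>l. dupper c i x p l * dupper c l x q r + upper c x p l * d2 i l q r"
  have D: "(?F p q r has_real_derivative ?D p q r) (at 0)" for p q r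
  proof -
    have "(?F p q r has_real_derivative (\<Sum>l. dupper c i x p l * dupper c l (coord_line c i x 0) q r +
        d2 i l q r * upper c (coord_line c i x 0) p l)) (at 0)"
      unfolding d2_def
      by (intro DERIV_sum DERIV_mult DERIV_coord_line smooth_in_chart_diff_at assms smooth_upper smooth_dupper)
    then show ?thesis using assms by (simp add: mult.commute)
  qed
  have sum: "((\<lambda>t. ?F p q r t + ?F q r p t + ?F r p q t) has_real_derivative
      ?D p q r + ?D q r p + ?D r p q) (at 0)"
    by (intro DERIV_add D)
  have ev: "\<forall>\<^sub>F t in nhds 0. ?F p q r t + ?F q r p t + ?F r p q t = 0"
    using eventually_coord_line_in[OF assms(1,2) open_dom[OF assms(1)] assms(2)]
    by (rule eventually_mono) (rule upper_poisson[OF assms(1)])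
  from DERIV_unique[OF iffD1[OF DERIV_cong_ev[OF refl ev refl] sum] DERIV_const] show ?thesis .
qed

text \<open>
  The coefficients on the tangent bundle of the bivector for \<open>s [[\<cdot>, \<cdot>]] + t (\<cdot>, \<cdot>)\<close>. For \<open>s = 1\<close> and \<open>t = 0\<close> it is, up
  to the sign, the complete lift of the Poisson bivector \<open>\<Omega>\<^sup>p\<^sup>q\<close>. The entry \<open>{y\<^sup>p, y\<^sup>r}\<close> combines the degrees
  zero and one.
\<close>

definition pencil_bivector ::
  "real \<Rightarrow> real \<Rightarrow> ('m, 'n) chart \<Rightarrow> 'm \<times> ('n \<Rightarrow> real) \<Rightarrow> 'n + 'n \<Rightarrow> 'n + 'n \<Rightarrow> real fps"
  where "pencil_bivector s t c w a b = (case a of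
    Inl q \<Rightarrow> (case b of Inl _ \<Rightarrow> 0 | Inr p \<Rightarrow> fps_const s * fps_const (upper c (fst w) p q))
  | Inr p \<Rightarrow> (case b of
      Inl q \<Rightarrow> - (fps_const s * fps_const (upper c (fst w) p q))
    | Inr r \<Rightarrow> fps_const t * fps_const (upper c (fst w) p r) -
        fps_const s * (\<Sum>j. fps_const (dupper c j (fst w) p r) * (fps_X * fps_const (snd w j)))))"

definition pencil_bivector_deriv ::
  "real \<Rightarrow> real \<Rightarrow> ('m, 'n) chart \<Rightarrow> 'm \<times> ('n \<Rightarrow> real) \<Rightarrow> 'n + 'n \<Rightarrow> 'n + 'n \<Rightarrow> 'n + 'n \<Rightarrow> real fps"
  where "pencil_bivector_deriv s t c w e a b =
    (let d = (\<lambda>f. case e of Inl i \<Rightarrow> fps_const (pd c i f (fst w)) | Inr _ \<Rightarrow> 0) in case a of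
    Inl q \<Rightarrow> (case b of Inl _ \<Rightarrow> 0 | Inr p \<Rightarrow> fps_const s * d (\<lambda>z. upper c z p q))
  | Inr p \<Rightarrow> (case b of
      Inl q \<Rightarrow> - (fps_const s * d (\<lambda>z. upper c z p q))
    | Inr r \<Rightarrow> fps_const t * d (\<lambda>z. upper c z p r) -
        fps_const s * (\<Sum>j. d (\<lambda>z. dupper c j z p r) * (fps_X * fps_const (snd w j)) +
          fps_const (dupper c j (fst w) p r) * (if e = Inr j then 1 else 0))))"

lemma has_d_pencil_bivector:
  assumes "c \<in> A" "fst w \<in> chart_dom c"
  shows "has_d c e (\<lambda>w. pencil_bivector s t c w a b) w (pencil_bivector_deriv s t c w e a b)"
proof -
  define d where "d = (\<lambda>f. case e of Inl i \<Rightarrow> fps_const (pd c i f (fst w)) | Inr _ \<Rightarrow> 0)"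
  have U: "has_d c e (\<lambda>w. fps_const (upper c (fst w) p q)) w (d (\<lambda>z. upper c z p q))" for p q
    unfolding d_def by (rule has_d_base[OF smooth_in_chart_diff_at[OF smooth_upper[OF assms(1)] assms(2)]])
  have D: "has_d c e (\<lambda>w. fps_const (dupper c j (fst w) p q)) w (d (\<lambda>z. dupper c j z p q))" for j p q
    unfolding d_def by (rule has_d_base[OF smooth_in_chart_diff_at[OF smooth_dupper[OF assms(1)] assms(2)]])
  have cm: "has_d c e (\<lambda>w. fps_const r * \<Phi> w) w (fps_const r * F)" if "has_d c e \<Phi> w F" for r \<Phi> F
    using has_d_mult[OF assms has_d_const that, of "fps_const r"] by simp
  show ?thesis
    unfolding pencil_bivector_def pencil_bivector_deriv_def Let_def d_def[symmetric]
    by (cases a; cases b; simp only: sum.case)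
      (intro has_d_const cm U D has_d_minus[OF assms] has_d_diff[OF assms] has_d_sum has_d_mult[OF assms]
        has_d_fibre_coordinate)+
qed

lemma pencil_bivector_skew:
  assumes "c \<in> A" "fst w \<in> chart_dom c"
  shows "pencil_bivector s t c w a b = - pencil_bivector s t c w b a"
proof -
  have 1: "fps_const (upper c (fst w) p r) = - fps_const (upper c (fst w) r p)" for p r
    using upper_skew[OF assms, of p r] by simp
  have 2: "fps_const (dupper c j (fst w) p r) = - fps_const (dupper c j (fst w) r p)" for j p r
    using dupper_skew[OF assms, of j p r] by simp
  show ?thesis
  proof (cases a; cases b)
    fix p r assume ab: "a = Inr p" "b = Inr r"
    show ?thesis unfolding ab pencil_bivector_def sum.case 1[of p r] 2[of _ p r]
      by (simp add: sum_negf del: fps_const_neg fps_const_mult)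
  qed (simp_all add: pencil_bivector_def)
qed

text \<open>
  Only triples with two or three fibre coordinates contribute. For two of them the sum is \<open>- s\<^sup>2\<close> times the Poisson
  condition for \<open>\<Omega>\<^sup>p\<^sup>q\<close>. For three, the Poisson condition appears with the factor \<open>2 s t\<close>, and its
  derivatives in the directions \<open>x\<^sup>j\<close>, contracted with \<open>y\<^sup>j\<close>, with the factor \<open>- s\<^sup>2\<close>.
\<close>

lemma pencil_bivector_jacobi:
  fixes s t :: real
  assumes "c \<in> A" "fst w \<in> chart_dom c"
  defines "J \<equiv> \<lambda>a b d. \<Sum>e. pencil_bivector s t c w e d * pencil_bivector_deriv s t c w e a b"
  shows "J a b d + J b d a + J d a b = 0"
proof -
  let ?P = "upper c (fst w)" and ?dP = "\<lambda>j. dupper c j (fst w)" and ?y = "snd w"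
  let ?d2 = "\<lambda>i j p q. pd c i (\<lambda>z. dupper c j z p q) (fst w)"
  define P where "P p q = fps_const (?P p q)" for p q
  define dP where "dP j p q = fps_const (?dP j p q)" for j p q
  define d2P where "d2P i j p q = fps_const (?d2 i j p q)" for i j p q
  define Y where "Y j = fps_X * fps_const (?y j)" for j
  define S where "S = fps_const s"
  define T where "T = fps_const t"
  note defs = P_def[symmetric] dP_def[symmetric] d2P_def[symmetric] Y_def[symmetric]
    S_def[symmetric] T_def[symmetric]
  have Psk: "P p q = - P q p" for p q
    using upper_skew[OF assms(1,2), of p q] by (simp add: P_def)
  have dPsk: "dP j p q = - dP j q p" for j p q
    using dupper_skew[OF assms(1,2), of j p q] by (simp add: dP_def)
  have J: "J a b d = (\<Sum>i. pencil_bivector s t c w (Inl i) d * pencil_bivector_deriv s t c w (Inl i) a b) +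
      (\<Sum>i. pencil_bivector s t c w (Inr i) d * pencil_bivector_deriv s t c w (Inr i) a b)" for a b d
    unfolding J_def by (rule sum_UNIV_Plus)
  have Bs: "pencil_bivector s t c w (Inl i) (Inl j) = 0"
    "pencil_bivector s t c w (Inl i) (Inr p) = S * P p i"
    "pencil_bivector s t c w (Inr p) (Inl i) = - (S * P p i)"
    "pencil_bivector s t c w (Inr p) (Inr q) = T * P p q - S * (\<Sum>j. dP j p q * Y j)" for i j p q
    by (simp_all add: pencil_bivector_def defs)
  have dBs: "pencil_bivector_deriv s t c w e (Inl i) (Inl j) = 0"
    "pencil_bivector_deriv s t c w (Inl e') (Inl i) (Inr p) = S * dP e' p i"
    "pencil_bivector_deriv s t c w (Inl e') (Inr p) (Inl i) = - (S * dP e' p i)"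
    "pencil_bivector_deriv s t c w (Inl e') (Inr p) (Inr q) =
      T * dP e' p q - S * (\<Sum>j. d2P e' j p q * Y j)"
    "pencil_bivector_deriv s t c w (Inr e') (Inl i) (Inr p) = 0"
    "pencil_bivector_deriv s t c w (Inr e') (Inr p) (Inl i) = 0"
    "pencil_bivector_deriv s t c w (Inr e') (Inr p) (Inr q) = - (S * dP e' p q)" for e e' i j p q
    by (simp_all add: pencil_bivector_deriv_def defs if_distrib cong: if_cong)
  have po: "(\<Sum>l. P p l * dP l q r) + (\<Sum>l. P q l * dP l r p) +
      (\<Sum>l. P r l * dP l p q) = 0" for p q r
    using arg_cong[OF upper_poisson[OF assms(1,2), of p q r], of fps_const]
    by (simp add: fps_const_sum P_def dP_def flip: fps_const_add)
  have dpo: "(\<Sum>l. dP i p l * dP l q r + P p l * d2P i l q r) +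
    (\<Sum>l. dP i q l * dP l r p + P q l * d2P i l r p) +
    (\<Sum>l. dP i r l * dP l p q + P r l * d2P i l p q) = 0" for i p q r
    using arg_cong[OF upper_poisson_derivative[OF assms(1,2), of i p q r], of fps_const]
    by (simp add: fps_const_sum P_def dP_def d2P_def flip: fps_const_add)
  have d2sym: "d2P i j p q = d2P j i p q" for i j p q
    unfolding d2P_def using pd_commute[OF assms(1,2) smooth_upper[OF assms(1)]] by simp
  have two: "J (Inl i) (Inr p) (Inr r) + J (Inr p) (Inr r) (Inl i) + J (Inr r) (Inl i) (Inr p) = 0" for i p r
  proof -
    have "J (Inl i) (Inr p) (Inr r) + J (Inr p) (Inr r) (Inl i) + J (Inr r) (Inl i) (Inr p) =
        S * S * ((\<Sum>l. P r l * dP l p i) + (\<Sum>l. P l i * dP l p r) - (\<Sum>l. P p l * dP l r i))"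
      unfolding J Bs dBs by (simp add: sum_distrib_left sum_negf mult_ac distrib_left right_diff_distrib)
    also have "(\<Sum>l. P l i * dP l p r) = - (\<Sum>l. P i l * dP l p r)"
      unfolding Psk[of _ i] by (simp add: sum_negf)
    also have "(\<Sum>l. P r l * dP l p i) = - (\<Sum>l. P r l * dP l i p)"
      unfolding dPsk[of _ p i] by (simp add: sum_negf)
    also have "S * S * (- (\<Sum>l. P r l * dP l i p) + - (\<Sum>l. P i l * dP l p r) -
        (\<Sum>l. P p l * dP l r i)) = - (S * S * ((\<Sum>l. P i l * dP l p r) +
        (\<Sum>l. P p l * dP l r i) + (\<Sum>l. P r l * dP l i p)))"
      by (simp add: algebra_simps)
    finally show ?thesis by (simp only: po mult_zero_right minus_zero)
  qed
  have three: "J (Inr p) (Inr q) (Inr r) + J (Inr q) (Inr r) (Inr p) + J (Inr r) (Inr p) (Inr q) = 0" for p q r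
  proof -
    have e: "J (Inr p) (Inr q) (Inr r) = 2 * S * T * (\<Sum>l. P r l * dP l p q) -
        S * S * (\<Sum>j. Y j * (\<Sum>l. dP j r l * dP l p q + P r l * d2P j l p q))" for p q r
    proof -
      have 1: "(\<Sum>l. P r l * (\<Sum>j. d2P l j p q * Y j)) =
          (\<Sum>j. Y j * (\<Sum>l. P r l * d2P j l p q))"
        unfolding sum_distrib_left by (subst sum.swap) (simp only: d2sym[of _ _ p q] mult_ac)
      have 2: "(\<Sum>l. (\<Sum>j. dP j l r * Y j) * dP l p q) =
          - (\<Sum>j. Y j * (\<Sum>l. dP j r l * dP l p q))"
        unfolding dPsk[of _ _ r] sum_distrib_left sum_distrib_right
        by (subst sum.swap) (simp add: sum_negf mult_ac)
      have 3: "(\<Sum>l. P l r * dP l p q) = - (\<Sum>l. P r l * dP l p q)"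
        unfolding Psk[of _ r] by (simp add: sum_negf)
      have "J (Inr p) (Inr q) (Inr r) =
          S * T * (\<Sum>l. P r l * dP l p q) - S * S * (\<Sum>l. P r l * (\<Sum>j. d2P l j p q * Y j)) -
          S * T * (\<Sum>l. P l r * dP l p q) + S * S * (\<Sum>l. (\<Sum>j. dP j l r * Y j) * dP l p q)"
      proof -
        have "(\<Sum>i. S * P r i * (T * dP i p q - S * (\<Sum>j. d2P i j p q * Y j))) =
            S * T * (\<Sum>l. P r l * dP l p q) - S * S * (\<Sum>l. P r l * (\<Sum>j. d2P l j p q * Y j))"
          unfolding sum_distrib_left[of "S * T"] sum_distrib_left[of "S * S"] sum_subtractf[symmetric]
          by (rule sum.cong[OF refl]) (simp add: algebra_simps)
        moreover have "(\<Sum>i. (T * P i r - S * (\<Sum>j. dP j i r * Y j)) * - (S * dP i p q)) =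
            S * S * (\<Sum>l. (\<Sum>j. dP j l r * Y j) * dP l p q) - S * T * (\<Sum>l. P l r * dP l p q)"
          unfolding sum_distrib_left[of "S * T"] sum_distrib_left[of "S * S"] sum_subtractf[symmetric]
          by (rule sum.cong[OF refl]) (simp add: algebra_simps)
        ultimately show ?thesis unfolding J Bs dBs by simp
      qed
      then show ?thesis unfolding 1 2 3
        by (simp add: sum.distrib distrib_left algebra_simps)
    qed
    have z: "(\<Sum>j. Y j * (\<Sum>l. dP j p l * dP l q r + P p l * d2P j l q r)) +
        (\<Sum>j. Y j * (\<Sum>l. dP j q l * dP l r p + P q l * d2P j l r p)) +
        (\<Sum>j. Y j * (\<Sum>l. dP j r l * dP l p q + P r l * d2P j l p q)) = 0" (is "?a + ?b + ?c = 0")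
    proof -
      have "?a + ?b + ?c = (\<Sum>j. Y j * ((\<Sum>l. dP j p l * dP l q r + P p l * d2P j l q r) +
          (\<Sum>l. dP j q l * dP l r p + P q l * d2P j l r p) +
          (\<Sum>l. dP j r l * dP l p q + P r l * d2P j l p q)))"
        by (simp only: distrib_left sum.distrib)
      then show ?thesis by (simp only: dpo) simp
    qed
    have "J (Inr p) (Inr q) (Inr r) + J (Inr q) (Inr r) (Inr p) + J (Inr r) (Inr p) (Inr q) =
        2 * S * T * ((\<Sum>l. P p l * dP l q r) + (\<Sum>l. P q l * dP l r p) +
          (\<Sum>l. P r l * dP l p q)) - S * S * (?a + ?b + ?c)"
      unfolding e by (simp add: algebra_simps)
    then show ?thesis by (simp only: po z) simp
  qed
  \<comment> \<open>With at most one fibre coordinate among the three, every summand has a vanishing factor.\<close>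
  have one: "J (Inl i) (Inl j) e = 0" "J (Inl i) (Inr p) (Inl j) = 0" "J (Inr p) (Inl i) (Inl j) = 0" for i j p e
    unfolding J Bs dBs by simp_all
  have rotate: "J (Inr p) (Inr r) (Inl i) + J (Inr r) (Inl i) (Inr p) + J (Inl i) (Inr p) (Inr r) = 0"
    "J (Inr r) (Inl i) (Inr p) + J (Inl i) (Inr p) (Inr r) + J (Inr p) (Inr r) (Inl i) = 0" for i p r
    using two[of i p r] by (simp_all add: add_ac)
  show ?thesis
    by (cases a; cases b; cases d) (simp_all only: two rotate three one add_0_left)
qed

end

context symplectic_manifold_connection
begin

definition pencil :: "real \<Rightarrow> real \<Rightarrow> (nat \<Rightarrow> ('m, 'n) tensor) \<Rightarrow> (nat \<Rightarrow> ('m, 'n) tensor) \<Rightarrow> nat \<Rightarrow> ('m, 'n) tensor"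
  where "pencil s t \<alpha> \<beta> = s *\<^sub>R hat_schouten A \<Omega> \<Gamma> \<alpha> \<beta> + t *\<^sub>R hat_alg_bracket A \<Omega> \<alpha> \<beta>"

lemma hat_smooth_sym_pencil:
  "\<alpha> \<in> hat_smooth_sym A \<Longrightarrow> \<beta> \<in> hat_smooth_sym A \<Longrightarrow> pencil s t \<alpha> \<beta> \<in> hat_smooth_sym A"
  unfolding pencil_def
  by (intro hat_smooth_sym_linear hat_smooth_sym_schouten hat_smooth_sym_alg_bracket affine)

text \<open>
  The only combination of Christoffel symbols in the Schouten bracket is antisymmetric in \<open>p\<close> and \<open>r\<close>. By
  \<open>pd_upper\<close> and the symmetry of \<open>\<Gamma>\<close> in its lower indices it is a derivative of \<open>\<Omega>\<^sup>p\<^sup>r\<close>.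
\<close>

lemma upper_christoffel:
  assumes "c \<in> A" "fst w \<in> chart_dom c"
  defines "g \<equiv> \<lambda>q m. \<Sum>j. fps_const (\<Gamma> c (fst w) q j m) * (fps_X * fps_const (snd w j))"
  shows "(\<Sum>q. fps_const (upper c (fst w) r q) * g q p) - (\<Sum>q. fps_const (upper c (fst w) p q) * g q r) =
    (\<Sum>j. fps_const (dupper c j (fst w) p r) * (fps_X * fps_const (snd w j)))"
proof -
  let ?P = "upper c (fst w)" and ?G = "\<Gamma> c (fst w)" and ?Y = "\<lambda>j. fps_X * fps_const (snd w j)"
  have swap: "(\<Sum>q. fps_const (?P r q) * g q p) = (\<Sum>j. fps_const (\<Sum>q. ?P r q * ?G q j p) * ?Y j)" for r p
    unfolding g_def by (rule sum_fps_const_swap)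
  have real: "(\<Sum>q. ?P r q * ?G q j p) - (\<Sum>q. ?P p q * ?G q j r) = dupper c j (fst w) p r" for j
    unfolding pd_upper[OF connection assms(1,2)] upper_skew[OF assms(1,2), of _ r]
      christoffel_sym[OF assms(1,2), of _ j]
    by (simp add: sum_negf mult.commute)
  have diff: "(\<Sum>j. fps_const (u j) * ?Y j) - (\<Sum>j. fps_const (v j) * ?Y j) =
      (\<Sum>j. fps_const (u j - v j) * ?Y j)" for u v
    by (simp add: sum_subtractf left_diff_distrib flip: fps_const_sub)
  show ?thesis unfolding swap diff real ..
qed

lemma gen_pencil:
  assumes "\<alpha> \<in> hat_smooth_sym A" "\<beta> \<in> hat_smooth_sym A" "c \<in> A" "fst w \<in> chart_dom c"
  shows "ser c (pencil s t \<alpha> \<beta>) w = (\<Sum>a b. pencil_bivector s t c w a b *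
    (der c a \<alpha> w * der c b \<beta> w))"
proof -
  define P where "P p q = fps_const (upper c (fst w) p q)" for p q
  define S where "S = fps_const s"
  define T where "T = fps_const t"
  define a where "a p = der c (Inr p) \<alpha> w" for p
  define b where "b p = der c (Inr p) \<beta> w" for p
  define da where "da p = der c (Inl p) \<alpha> w" for p
  define db where "db p = der c (Inl p) \<beta> w" for p
  define g where "g q m = (\<Sum>j. fps_const (\<Gamma> c (fst w) q j m) * (fps_X * fps_const (snd w j)))" for q m
  define E where "E p r = (\<Sum>j. fps_const (dupper c j (fst w) p r) * (fps_X * fps_const (snd w j)))" for p r
  note defs = P_def[symmetric] S_def[symmetric] T_def[symmetric] a_def[symmetric] b_def[symmetric]
    da_def[symmetric] db_def[symmetric] g_def[symmetric] E_def[symmetric]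
  have E: "E p r = (\<Sum>q. P r q * g q p) - (\<Sum>q. P p q * g q r)" for p r
    using upper_christoffel[OF assms(3,4), of r p] by (simp add: defs)
  have 1: "(\<Sum>p q. P p q * (b p * (\<Sum>m. g q m * a m))) =
      (\<Sum>p r. (\<Sum>q. P r q * g q p) * (a p * b r))"
    unfolding sum_distrib_left sum_distrib_right
    by (subst sum_swap_3) (simp only: mult_ac)
  have 2: "(\<Sum>p q. P p q * (a p * (\<Sum>m. g q m * b m))) =
      (\<Sum>p r. (\<Sum>q. P p q * g q r) * (a p * b r))"
    unfolding sum_distrib_left sum_distrib_right
    by (rule sum.cong[OF refl], subst sum.swap) (simp only: mult_ac)
  have 3: "(\<Sum>p q. P p q * (b p * (\<Sum>m. g q m * a m))) -
      (\<Sum>p q. P p q * (a p * (\<Sum>m. g q m * b m))) =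
      (\<Sum>p r. E p r * (a p * b r))"
    unfolding 1 2 E left_diff_distrib sum_subtractf ..
  have "ser c (pencil s t \<alpha> \<beta>) w =
      S * (\<Sum>p q. P p q * (b p * (da q - (\<Sum>m. g q m * a m)) -
        a p * (db q - (\<Sum>m. g q m * b m)))) +
      T * (\<Sum>p q. P p q * (a p * b q))"
    unfolding pencil_def gen_loc_linear
    using assms by (simp add: gen_hat_schouten gen_hat_alg_bracket local_field_loc nabla_def defs)
  also have "(\<Sum>p q. P p q * (b p * (da q - (\<Sum>m. g q m * a m)) -
        a p * (db q - (\<Sum>m. g q m * b m)))) =
      (\<Sum>p q. P p q * (da q * b p)) - (\<Sum>p q. P p q * (a p * db q)) -
      ((\<Sum>p q. P p q * (b p * (\<Sum>m. g q m * a m))) -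
       (\<Sum>p q. P p q * (a p * (\<Sum>m. g q m * b m))))"
    by (simp only: right_diff_distrib sum_subtractf mult.commute[of "da q" for q]) simp
  also have "\<dots> = (\<Sum>q p. P p q * (da q * b p)) - (\<Sum>p q. P p q * (a p * db q)) -
      (\<Sum>p r. E p r * (a p * b r))"
    unfolding 3 by (subst sum.swap) (rule refl)
  finally have L: "ser c (pencil s t \<alpha> \<beta>) w =
      S * ((\<Sum>q p. P p q * (da q * b p)) - (\<Sum>p q. P p q * (a p * db q)) -
      (\<Sum>p r. E p r * (a p * b r))) + T * (\<Sum>p q. P p q * (a p * b q))" .
  have "(\<Sum>x y. pencil_bivector s t c w x y *
      (der c x \<alpha> w * der c y \<beta> w)) =
      (\<Sum>q p. S * P p q * (da q * b p)) +
      (\<Sum>p. (\<Sum>q. - (S * P p q) * (a p * db q)) + (\<Sum>r. (T * P p r - S * E p r) * (a p * b r)))"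
    unfolding sum_UNIV_Plus by (simp add: pencil_bivector_def defs)
  also have "\<dots> = S * ((\<Sum>q p. P p q * (da q * b p)) - (\<Sum>p q. P p q * (a p * db q)) -
      (\<Sum>p r. E p r * (a p * b r))) + T * (\<Sum>p q. P p q * (a p * b q))"
    by (simp add: sum.distrib sum_subtractf sum_negf left_diff_distrib right_diff_distrib
        sum_distrib_left mult.assoc)
  finally show ?thesis using L by simp
qed

lemma gen_dd_pencil:
  assumes "\<alpha> \<in> hat_smooth_sym A" "\<beta> \<in> hat_smooth_sym A" "c \<in> A" "fst w \<in> chart_dom c"
  shows "der c e (pencil s t \<alpha> \<beta>) w = (\<Sum>a b.
    pencil_bivector_deriv s t c w e a b * (der c a \<alpha> w * der c b \<beta> w) +
    pencil_bivector s t c w a b * (gen (dd c e (dd c a (loc c \<alpha>))) w * der c b \<beta> w +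
      der c a \<alpha> w * gen (dd c e (dd c b (loc c \<beta>))) w))"
    (is "_ = ?R")
proof (rule has_d_unique)
  show "has_d c e (ser c (pencil s t \<alpha> \<beta>)) w (der c e (pencil s t \<alpha> \<beta>) w)"
    by (intro has_d_gen local_field_loc hat_smooth_sym_pencil assms)
  have "has_d c e (\<lambda>w. \<Sum>a b. pencil_bivector s t c w a b *
      (der c a \<alpha> w * der c b \<beta> w)) w ?R"
    by (intro has_d_sum has_d_mult has_d_pencil_bivector has_d_gen local_field_dd local_field_loc assms)
  then show "has_d c e (ser c (pencil s t \<alpha> \<beta>)) w ?R"
    by (rule has_d_cong[OF assms(3,4)]) (rule gen_pencil[OF assms(1-3), symmetric])
qed

lemma pencil_jacobi:
  assumes "\<alpha> \<in> hat_smooth_sym A" "\<beta> \<in> hat_smooth_sym A" "\<gamma> \<in> hat_smooth_sym A"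
  shows "pencil s t (pencil s t \<alpha> \<beta>) \<gamma> + pencil s t (pencil s t \<beta> \<gamma>) \<alpha> + pencil s t (pencil s t \<gamma> \<alpha>) \<beta> = 0"
proof (rule hat_smooth_sym_eqI)
  show "pencil s t (pencil s t \<alpha> \<beta>) \<gamma> + pencil s t (pencil s t \<beta> \<gamma>) \<alpha> + pencil s t (pencil s t \<gamma> \<alpha>) \<beta>
      \<in> hat_smooth_sym A"
    by (intro hat_smooth_sym_closed(1) hat_smooth_sym_pencil assms)
  fix c and w :: "'m \<times> ('n \<Rightarrow> real)" assume c: "c \<in> A" "fst w \<in> chart_dom c"
  have g: "ser c (pencil s t \<xi> \<eta>) w = (\<Sum>a b. pencil_bivector s t c w a b *
      (der c a \<xi> w * der c b \<eta> w))"
    if "\<xi> \<in> hat_smooth_sym A" "\<eta> \<in> hat_smooth_sym A" for \<xi> \<eta>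
    by (rule gen_pencil[OF that c])
  show "ser c (pencil s t (pencil s t \<alpha> \<beta>) \<gamma> + pencil s t (pencil s t \<beta> \<gamma>) \<alpha> +
      pencil s t (pencil s t \<gamma> \<alpha>) \<beta>) w = ser c 0 w"
    unfolding gen_loc_add gen_loc_0 g[OF hat_smooth_sym_pencil[OF assms(1,2)] assms(3)]
      g[OF hat_smooth_sym_pencil[OF assms(2,3)] assms(1)] g[OF hat_smooth_sym_pencil[OF assms(3,1)] assms(2)]
      gen_dd_pencil[OF assms(1,2) c] gen_dd_pencil[OF assms(2,3) c] gen_dd_pencil[OF assms(3,1) c]
    by (rule bivector_jacobi[OF pencil_bivector_skew[OF c] pencil_bivector_jacobi[OF c]])
      (intro gen_dd_commute local_field_loc assms c)+
qed (rule hat_smooth_sym_0)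

lemma pencil_skew:
  assumes "\<alpha> \<in> hat_smooth_sym A" "\<beta> \<in> hat_smooth_sym A"
  shows "pencil s t \<alpha> \<beta> = (- 1) *\<^sub>R pencil s t \<beta> \<alpha> + 0 *\<^sub>R 0"
proof (rule hat_smooth_sym_eqI)
  fix c and w :: "'m \<times> ('n \<Rightarrow> real)" assume c: "c \<in> A" "fst w \<in> chart_dom c"
  have skew: "(\<Sum>a b. pencil_bivector s t c w a b *
      (der c a \<alpha> w * der c b \<beta> w)) =
      - (\<Sum>a b. pencil_bivector s t c w a b *
      (der c a \<beta> w * der c b \<alpha> w))"
    by (subst sum.swap, subst pencil_bivector_skew[OF c]) (simp add: sum_negf mult.commute)
  have minus: "fps_const (- 1 :: real) = - 1" by (metis fps_const_neg fps_const_1_eq_1)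
  show "ser c (pencil s t \<alpha> \<beta>) w = ser c ((- 1) *\<^sub>R pencil s t \<beta> \<alpha> + 0 *\<^sub>R 0) w"
    unfolding gen_loc_linear gen_pencil[OF assms c] gen_pencil[OF assms(2,1) c] skew minus
    by (simp del: fps_const_neg)
qed (intro hat_smooth_sym_linear hat_smooth_sym_pencil hat_smooth_sym_0 assms)+

lemma pencil_linear_left:
  assumes "\<alpha> \<in> hat_smooth_sym A" "\<beta> \<in> hat_smooth_sym A" "\<gamma> \<in> hat_smooth_sym A"
  shows "pencil s t (x *\<^sub>R \<alpha> + y *\<^sub>R \<beta>) \<gamma> = x *\<^sub>R pencil s t \<alpha> \<gamma> + y *\<^sub>R pencil s t \<beta> \<gamma>"
proof (rule hat_smooth_sym_eqI)
  fix c and w :: "'m \<times> ('n \<Rightarrow> real)" assume c: "c \<in> A" "fst w \<in> chart_dom c"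
  show "ser c (pencil s t (x *\<^sub>R \<alpha> + y *\<^sub>R \<beta>) \<gamma>) w =
      ser c (x *\<^sub>R pencil s t \<alpha> \<gamma> + y *\<^sub>R pencil s t \<beta> \<gamma>) w"
    unfolding gen_loc_linear gen_pencil[OF assms(1,3) c] gen_pencil[OF assms(2,3) c]
      gen_pencil[OF hat_smooth_sym_linear[OF assms(1,2)] assms(3) c] gen_dd_linear[OF assms(1,2) c]
    unfolding sum_distrib_left sum.distrib[symmetric]
    by (intro sum.cong refl) (simp add: algebra_simps)
qed (intro hat_smooth_sym_linear hat_smooth_sym_pencil assms)+

lemma pencil_linear_right:
  assumes "\<alpha> \<in> hat_smooth_sym A" "\<beta> \<in> hat_smooth_sym A" "\<gamma> \<in> hat_smooth_sym A"
  shows "pencil s t \<gamma> (x *\<^sub>R \<alpha> + y *\<^sub>R \<beta>) = x *\<^sub>R pencil s t \<gamma> \<alpha> + y *\<^sub>R pencil s t \<gamma> \<beta>"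
  unfolding pencil_skew[OF assms(3) hat_smooth_sym_linear[OF assms(1,2)]] pencil_linear_left[OF assms]
    pencil_skew[OF assms(3,1)] pencil_skew[OF assms(3,2)] by simp

lemma lie_bracket_pencil: "lie_bracket_on (hat_sym_tensors A) (pencil s t)"
  unfolding lie_bracket_on_def bilinear_on_def
proof (intro conjI ballI allI)
  show "subspace (hat_sym_tensors A)" by (rule subspace_hat_sym_tensors)
  fix \<alpha> \<beta> assume h: "\<alpha> \<in> hat_sym_tensors A" "\<beta> \<in> hat_sym_tensors A"
  show "pencil s t \<alpha> \<beta> \<in> hat_sym_tensors A"
    unfolding pencil_def
    by (intro hat_sym_tensors_linear hat_sym_tensors_schouten hat_sym_tensors_alg_bracket affine h)
  note s = h[THEN hat_sym_tensors_smooth]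
  show "pencil s t \<alpha> \<alpha> = 0"
  proof -
    have "2 *\<^sub>R pencil s t \<alpha> \<alpha> = 0"
      using pencil_skew[OF s(1) s(1), of s t] by (simp add: scaleR_2 eq_neg_iff_add_eq_0)
    then show ?thesis by (simp only: scaleR_eq_0_iff) simp
  qed
  fix \<gamma> assume "\<gamma> \<in> hat_sym_tensors A"
  note s' = hat_sym_tensors_smooth[OF this]
  show "pencil s t (pencil s t \<alpha> \<beta>) \<gamma> + pencil s t (pencil s t \<beta> \<gamma>) \<alpha> + pencil s t (pencil s t \<gamma> \<alpha>) \<beta> = 0"
    by (rule pencil_jacobi[OF s s'])
  fix x y
  show "pencil s t (x *\<^sub>R \<alpha> + y *\<^sub>R \<beta>) \<gamma> = x *\<^sub>R pencil s t \<alpha> \<gamma> + y *\<^sub>R pencil s t \<beta> \<gamma>"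
    by (rule pencil_linear_left[OF s s'])
  show "pencil s t \<gamma> (x *\<^sub>R \<alpha> + y *\<^sub>R \<beta>) = x *\<^sub>R pencil s t \<gamma> \<alpha> + y *\<^sub>R pencil s t \<gamma> \<beta>"
    by (rule pencil_linear_right[OF s s'])
qed

text \<open>
  The mixed terms are the difference between the Jacobi identity for the sum of the two brackets
  and those for the single brackets.
\<close>

lemma mixed_jacobi:
  assumes "\<alpha> \<in> hat_smooth_sym A" "\<beta> \<in> hat_smooth_sym A" "\<gamma> \<in> hat_smooth_sym A"
  shows "hat_alg_bracket A \<Omega> (hat_schouten A \<Omega> \<Gamma> \<alpha> \<beta>) \<gamma> +
    hat_alg_bracket A \<Omega> (hat_schouten A \<Omega> \<Gamma> \<beta> \<gamma>) \<alpha> +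
    hat_alg_bracket A \<Omega> (hat_schouten A \<Omega> \<Gamma> \<gamma> \<alpha>) \<beta> +
    hat_schouten A \<Omega> \<Gamma> (hat_alg_bracket A \<Omega> \<alpha> \<beta>) \<gamma> +
    hat_schouten A \<Omega> \<Gamma> (hat_alg_bracket A \<Omega> \<beta> \<gamma>) \<alpha> +
    hat_schouten A \<Omega> \<Gamma> (hat_alg_bracket A \<Omega> \<gamma> \<alpha>) \<beta> = 0"
proof -
  let ?S = "pencil 1 0" and ?G = "pencil 0 1"
  have S: "hat_schouten A \<Omega> \<Gamma> \<xi> \<eta> = ?S \<xi> \<eta>" and G: "hat_alg_bracket A \<Omega> \<xi> \<eta> = ?G \<xi> \<eta>" for \<xi> \<eta>
    by (simp_all add: pencil_def)
  have split: "pencil 1 1 (pencil 1 1 \<xi> \<eta>) \<zeta> =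
      ?S (?S \<xi> \<eta>) \<zeta> + ?G (?G \<xi> \<eta>) \<zeta> + (?G (?S \<xi> \<eta>) \<zeta> + ?S (?G \<xi> \<eta>) \<zeta>)"
    if h: "\<xi> \<in> hat_smooth_sym A" "\<eta> \<in> hat_smooth_sym A" "\<zeta> \<in> hat_smooth_sym A" for \<xi> \<eta> \<zeta>
  proof -
    have 1: "pencil 1 1 \<xi> \<eta> = ?S \<xi> \<eta> + ?G \<xi> \<eta>" for \<xi> \<eta> by (simp add: pencil_def)
    have 2: "pencil s t (?S \<xi> \<eta> + ?G \<xi> \<eta>) \<zeta> = pencil s t (?S \<xi> \<eta>) \<zeta> + pencil s t (?G \<xi> \<eta>) \<zeta>" for s t
      using pencil_linear_left[OF hat_smooth_sym_pencil[OF h(1,2)] hat_smooth_sym_pencil[OF h(1,2)] h(3), of s t 1 1 0 1 0 1]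
      by simp
    show ?thesis unfolding 1 2 by (simp add: add_ac)
  qed
  let ?J = "\<lambda>s t. pencil s t (pencil s t \<alpha> \<beta>) \<gamma> + pencil s t (pencil s t \<beta> \<gamma>) \<alpha> + pencil s t (pencil s t \<gamma> \<alpha>) \<beta>"
  have "?G (?S \<alpha> \<beta>) \<gamma> + ?G (?S \<beta> \<gamma>) \<alpha> + ?G (?S \<gamma> \<alpha>) \<beta> + ?S (?G \<alpha> \<beta>) \<gamma> + ?S (?G \<beta> \<gamma>) \<alpha> + ?S (?G \<gamma> \<alpha>) \<beta> =
      ?J 1 1 - ?J 1 0 - ?J 0 1"
    unfolding split[OF assms] split[OF assms(2,3,1)] split[OF assms(3,1,2)]
    by (simp add: algebra_simps)
  also have "\<dots> = 0" by (simp only: pencil_jacobi[OF assms]) simp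
  finally show ?thesis unfolding S G .
qed

end

section \<open>The derivation property and the coboundary formula\<close>

lemma sum_leibniz:
  fixes g :: "'i \<Rightarrow> 'r::comm_ring_1"
  shows "(\<Sum>m\<in>I. g m * (u m * b + a * v m)) = (\<Sum>m\<in>I. g m * u m) * b + a * (\<Sum>m\<in>I. g m * v m)"
  by (simp add: sum.distrib sum_distrib_left sum_distrib_right algebra_simps)

lemma sum_pull_inside:
  fixes g :: "'i \<Rightarrow> 'r::comm_ring_1"
  shows "(\<Sum>m\<in>I. g m * (\<Sum>p\<in>J. \<Sum>q\<in>K. P p q * u m p q)) = (\<Sum>p\<in>J. \<Sum>q\<in>K. P p q * (\<Sum>m\<in>I. g m * u m p q))"
  unfolding sum_distrib_left by (rule trans[OF _ sum_swap_3[symmetric]]) (simp only: mult.left_commute)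

text \<open>
  The coboundary formula at one point. The letters stand for \<open>a = \<partial>\<^sub>p\<alpha>\<close>, \<open>b = \<partial>\<^sub>p\<beta>\<close>, \<open>N = \<nabla>\<^sub>p\<alpha>\<close>, \<open>M = \<nabla>\<^sub>p\<beta>\<close>,
  \<open>n = \<nabla>\<^sub>i\<partial>\<^sub>p\<alpha>\<close>, \<open>k = \<nabla>\<^sub>i\<partial>\<^sub>p\<beta>\<close>, where \<open>\<nabla>\<^sub>i\<close> in the last two does not act on the index \<open>p\<close>. The corrections
  for that index, which contain \<open>G = \<Gamma>\<close>, combine with the derivatives of \<open>P = \<Omega>\<^sup>p\<^sup>q\<close> to \<open>\<nabla>\<^sub>i \<Omega>\<^sup>p\<^sup>q = 0\<close>.
\<close>

lemma coboundary_algebra: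
  fixes P :: "'n::finite \<Rightarrow> 'n \<Rightarrow> 'r::comm_ring_1"
  assumes skew: "\<And>p q. P p q = - P q p"
    and dP: "\<And>i p q. dP i p q = - (\<Sum>m. G i m p * P m q) - (\<Sum>m. G i m q * P p m)"
  shows "(\<Sum>p q. P p q * (b p * N q - a p * M q)) =
    (\<Sum>p q. P p q * ((- N p - (\<Sum>i. Y i * (n i p - (\<Sum>m. G i p m * a m)))) * b q)) +
    (\<Sum>p q. P p q * (a p * (- M q - (\<Sum>i. Y i * (k i q - (\<Sum>m. G i q m * b m)))))) -
    (- (\<Sum>i. Y i * (\<Sum>p q. dP i p q * (a p * b q) + P p q * (n i p * b q + a p * k i q))))"
proof -
  let ?Ga = "\<lambda>i p. \<Sum>m. G i p m * a m" and ?Gb = "\<lambda>i p. \<Sum>m. G i p m * b m"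
  have pull: "(\<Sum>p q. (\<Sum>i. Y i * u i p q)) = (\<Sum>i. Y i * (\<Sum>p q. u i p q))" for u
    by (subst sum_swap_3) (simp only: sum_distrib_left)
  have A: "(\<Sum>p q. P p q * ((- N p - (\<Sum>i. Y i * (n i p - ?Ga i p))) * b q)) =
      - (\<Sum>p q. P p q * (N p * b q)) -
      (\<Sum>i. Y i * (\<Sum>p q. P p q * ((n i p - ?Ga i p) * b q)))"
  proof -
    have "P p q * ((- N p - (\<Sum>i. Y i * (n i p - ?Ga i p))) * b q) =
        - (P p q * (N p * b q)) - (\<Sum>i. Y i * (P p q * ((n i p - ?Ga i p) * b q)))" for p q
    proof -
      have "(\<Sum>i. Y i * (P p q * ((n i p - ?Ga i p) * b q))) = P p q * ((\<Sum>i. Y i * (n i p - ?Ga i p)) * b q)"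
        unfolding sum_distrib_left sum_distrib_right by (simp only: mult_ac)
      then show ?thesis by (simp add: algebra_simps)
    qed
    then show ?thesis by (simp only: sum_subtractf sum_negf pull)
  qed
  have B: "(\<Sum>p q. P p q * (a p * (- M q - (\<Sum>i. Y i * (k i q - ?Gb i q))))) =
      - (\<Sum>p q. P p q * (a p * M q)) -
      (\<Sum>i. Y i * (\<Sum>p q. P p q * (a p * (k i q - ?Gb i q))))"
  proof -
    have "P p q * (a p * (- M q - (\<Sum>i. Y i * (k i q - ?Gb i q)))) =
        - (P p q * (a p * M q)) - (\<Sum>i. Y i * (P p q * (a p * (k i q - ?Gb i q))))" for p q
    proof -
      have "(\<Sum>i. Y i * (P p q * (a p * (k i q - ?Gb i q)))) = P p q * (a p * (\<Sum>i. Y i * (k i q - ?Gb i q)))"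
        unfolding sum_distrib_left by (simp only: mult_ac)
      then show ?thesis by (simp add: algebra_simps)
    qed
    then show ?thesis by (simp only: sum_subtractf sum_negf pull)
  qed
  have H: "(\<Sum>p q. P p q * (?Ga i p * b q)) + (\<Sum>p q. P p q * (a p * ?Gb i q)) +
      (\<Sum>p q. dP i p q * (a p * b q)) = 0" for i
  proof -
    have 1: "(\<Sum>p q. P p q * (?Ga i p * b q)) =
        (\<Sum>p q. (\<Sum>m. G i m p * P m q) * (a p * b q))"
      unfolding sum_distrib_left sum_distrib_right
      by (subst sum_swap_3, rule sum.cong[OF refl], subst sum.swap) (simp only: mult_ac)
    have 2: "(\<Sum>p q. P p q * (a p * ?Gb i q)) =
        (\<Sum>p q. (\<Sum>m. G i m q * P p m) * (a p * b q))"
      unfolding sum_distrib_left sum_distrib_right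
      by (rule sum.cong[OF refl], subst sum.swap) (simp only: mult_ac)
    show ?thesis unfolding 1 2 dP
      by (simp only: left_diff_distrib sum_subtractf mult_minus_left sum_negf) simp
  qed
  have N: "(\<Sum>p q. P p q * (b p * N q)) = - (\<Sum>p q. P p q * (N p * b q))"
    by (subst sum.swap, subst skew) (simp add: sum_negf mult.commute)
  have Z: "(\<Sum>i. Y i * (\<Sum>p q. dP i p q * (a p * b q) + P p q * (n i p * b q + a p * k i q))) =
      (\<Sum>i. Y i * (\<Sum>p q. P p q * ((n i p - ?Ga i p) * b q))) +
      (\<Sum>i. Y i * (\<Sum>p q. P p q * (a p * (k i q - ?Gb i q))))"
  proof -
    have "(\<Sum>p q. dP i p q * (a p * b q) + P p q * (n i p * b q + a p * k i q)) =
        (\<Sum>p q. P p q * ((n i p - ?Ga i p) * b q)) +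
        (\<Sum>p q. P p q * (a p * (k i q - ?Gb i q)))" for i
    proof -
      have "(\<Sum>p q. dP i p q * (a p * b q) + P p q * (n i p * b q + a p * k i q)) =
          (\<Sum>p q. P p q * ((n i p - ?Ga i p) * b q)) +
          (\<Sum>p q. P p q * (a p * (k i q - ?Gb i q))) +
          ((\<Sum>p q. P p q * (?Ga i p * b q)) + (\<Sum>p q. P p q * (a p * ?Gb i q)) +
           (\<Sum>p q. dP i p q * (a p * b q)))"
        by (simp only: left_diff_distrib right_diff_distrib distrib_left sum.distrib sum_subtractf) simp
      then show ?thesis unfolding H by simp
    qed
    then show ?thesis by (simp only: distrib_left sum.distrib)
  qed
  have L: "(\<Sum>p q. P p q * (b p * N q - a p * M q)) =
      (\<Sum>p q. P p q * (b p * N q)) - (\<Sum>p q. P p q * (a p * M q))"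
    by (simp only: right_diff_distrib sum_subtractf)
  show ?thesis unfolding L N A B Z by simp
qed

context smooth_manifold
begin

lemma gen_dd_sym_prod:
  assumes "\<alpha> \<in> hat_smooth_sym A" "\<beta> \<in> hat_smooth_sym A" "c \<in> A" "fst w \<in> chart_dom c"
  shows "der c e (hat_sym_prod A \<alpha> \<beta>) w =
    der c e \<alpha> w * ser c \<beta> w + ser c \<alpha> w * der c e \<beta> w"
proof (rule has_d_unique)
  show "has_d c e (ser c (hat_sym_prod A \<alpha> \<beta>)) w (der c e (hat_sym_prod A \<alpha> \<beta>) w)"
    by (intro has_d_gen local_field_loc hat_smooth_sym_closed assms)
  have "has_d c e (\<lambda>w. ser c \<alpha> w * ser c \<beta> w) w
      (der c e \<alpha> w * ser c \<beta> w + ser c \<alpha> w * der c e \<beta> w)"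
    by (intro has_d_mult has_d_gen local_field_loc assms)
  then show "has_d c e (ser c (hat_sym_prod A \<alpha> \<beta>)) w
      (der c e \<alpha> w * ser c \<beta> w + ser c \<alpha> w * der c e \<beta> w)"
    by (rule has_d_cong[OF assms(3,4)]) (rule gen_hat_sym_prod[OF assms(3), symmetric])
qed

lemma hat_delta_star_sym_prod:
  assumes "\<alpha> \<in> hat_smooth_sym A" "\<beta> \<in> hat_smooth_sym A" "affine_connection A \<Gamma>"
  shows "hat_delta_star A \<Gamma> (hat_sym_prod A \<alpha> \<beta>) =
    hat_sym_prod A (hat_delta_star A \<Gamma> \<alpha>) \<beta> + hat_sym_prod A \<alpha> (hat_delta_star A \<Gamma> \<beta>)"
proof (rule hat_smooth_sym_eqI)
  fix c and w :: "'m \<times> ('n \<Rightarrow> real)" assume c: "c \<in> A" "fst w \<in> chart_dom c"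
  let ?a = "ser c \<alpha> w" and ?b = "ser c \<beta> w" and ?Y = "\<lambda>i. fps_X * fps_const (snd w i)"
  have n: "nabla c \<Gamma> i (loc c (hat_sym_prod A \<alpha> \<beta>)) w =
      nabla c \<Gamma> i (loc c \<alpha>) w * ?b + ?a * nabla c \<Gamma> i (loc c \<beta>) w" for i
    unfolding nabla_def gen_dd_sym_prod[OF assms(1,2) c] sum_leibniz by (simp only: algebra_simps)
  show "ser c (hat_delta_star A \<Gamma> (hat_sym_prod A \<alpha> \<beta>)) w =
      ser c (hat_sym_prod A (hat_delta_star A \<Gamma> \<alpha>) \<beta> + hat_sym_prod A \<alpha> (hat_delta_star A \<Gamma> \<beta>)) w"
    unfolding gen_loc_add gen_hat_sym_prod[OF c]
      gen_hat_delta_star[OF c local_field_loc[OF hat_smooth_sym_closed(3)[OF assms(1,2)] c(1)]]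
      gen_hat_delta_star[OF c local_field_loc[OF assms(1) c(1)]]
      gen_hat_delta_star[OF c local_field_loc[OF assms(2) c(1)]] n sum_leibniz
    by (simp add: algebra_simps)
qed (intro hat_smooth_sym_closed assms)+

lemma smooth_christoffel: "affine_connection A \<Gamma> \<Longrightarrow> c \<in> A \<Longrightarrow> smooth_in_chart c (\<lambda>x. \<Gamma> c x i j k)"
  unfolding affine_connection_def by blast

text \<open>
  The Leibniz rule for \<open>\<partial>/\<partial>y\<^sup>p\<close> applied to \<open>- y\<^sup>i \<nabla>\<^sub>i \<alpha>\<close>: the first term comes from \<open>y\<^sup>i\<close>, the last one from the
  coefficient \<open>\<Gamma>\<^sub>i\<^sub>j\<^sup>m y\<^sup>j\<close> in \<open>\<nabla>\<^sub>i\<close>.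
\<close>

lemma gen_Inr_delta_star:
  assumes "\<alpha> \<in> hat_smooth_sym A" "affine_connection A \<Gamma>" "c \<in> A" "fst w \<in> chart_dom c"
  shows "der c (Inr p) (hat_delta_star A \<Gamma> \<alpha>) w =
    - nabla c \<Gamma> p (loc c \<alpha>) w - (\<Sum>i. fps_X * fps_const (snd w i) *
      (nabla c \<Gamma> i (dd c (Inr p) (loc c \<alpha>)) w -
        (\<Sum>m. fps_const (\<Gamma> c (fst w) i p m) * der c (Inr m) \<alpha> w)))"
proof -
  let ?\<phi> = "loc c \<alpha>"
  let ?Y = "\<lambda>i w. fps_X * fps_const (snd w i) :: real fps"
  let ?D = "\<lambda>i. nabla c \<Gamma> i (dd c (Inr p) ?\<phi>) w -
        (\<Sum>m. fps_const (\<Gamma> c (fst w) i p m) * gen (dd c (Inr m) ?\<phi>) w)"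
  have \<phi>: "local_field c ?\<phi>" by (rule local_field_loc[OF assms(1,3)])
  have n: "has_d c (Inr p) (nabla c \<Gamma> i ?\<phi>) w (?D i)" for i
  proof -
    have \<Gamma>: "has_d c (Inr p) (\<lambda>w. fps_const (\<Gamma> c (fst w) i j m)) w 0" for j m
      using has_d_base[OF smooth_in_chart_diff_at[OF smooth_christoffel[OF assms(2,3)] assms(4)], of "Inr p" i j m]
      by simp
    have "has_d c (Inr p) (nabla c \<Gamma> i ?\<phi>) w (gen (dd c (Inr p) (dd c (Inl i) ?\<phi>)) w -
        (\<Sum>m. (\<Sum>j. 0 * ?Y j w + fps_const (\<Gamma> c (fst w) i j m) * (if Inr p = (Inr j :: 'n + 'n) then 1 else 0)) *
            gen (dd c (Inr m) ?\<phi>) w +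
          (\<Sum>j. fps_const (\<Gamma> c (fst w) i j m) * ?Y j w) * gen (dd c (Inr p) (dd c (Inr m) ?\<phi>)) w))"
      unfolding nabla_def[abs_def]
      by (intro has_d_diff has_d_sum has_d_mult has_d_gen local_field_dd \<Gamma> has_d_fibre_coordinate \<phi> assms)
    moreover have "(\<Sum>j. 0 * ?Y j w + fps_const (\<Gamma> c (fst w) i j m) * (if Inr p = (Inr j :: 'n + 'n) then 1 else 0)) =
        fps_const (\<Gamma> c (fst w) i p m)" for m
      by (simp add: if_distrib cong: if_cong)
    ultimately show ?thesis
      unfolding nabla_def using gen_dd_commute[OF assms(3) \<phi> assms(4), of "Inr p"]
      by (simp add: sum.distrib algebra_simps)
  qed
  have "has_d c (Inr p) (\<lambda>w. - (\<Sum>i. ?Y i w * nabla c \<Gamma> i ?\<phi> w)) w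
      (- (\<Sum>i. (if Inr p = (Inr i :: 'n + 'n) then 1 else 0) * nabla c \<Gamma> i ?\<phi> w + ?Y i w * ?D i))"
    by (intro has_d_minus has_d_sum has_d_mult has_d_fibre_coordinate n assms)
  then have "has_d c (Inr p) (ser c (hat_delta_star A \<Gamma> \<alpha>)) w
      (- (\<Sum>i. (if Inr p = (Inr i :: 'n + 'n) then 1 else 0) * nabla c \<Gamma> i ?\<phi> w + ?Y i w * ?D i))"
    by (rule has_d_cong[OF assms(3,4)]) (rule gen_hat_delta_star[OF assms(3) _ \<phi>, symmetric])
  moreover have "has_d c (Inr p) (ser c (hat_delta_star A \<Gamma> \<alpha>)) w
      (der c (Inr p) (hat_delta_star A \<Gamma> \<alpha>) w)"
    by (intro has_d_gen local_field_loc hat_smooth_sym_closed assms)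
  ultimately have "der c (Inr p) (hat_delta_star A \<Gamma> \<alpha>) w =
      - (\<Sum>i. (if Inr p = (Inr i :: 'n + 'n) then 1 else 0) * nabla c \<Gamma> i ?\<phi> w + ?Y i w * ?D i)"
    by (rule has_d_unique[rotated])
  also have "\<dots> = - (\<Sum>i. (if p = i then 1 else 0) * nabla c \<Gamma> i ?\<phi> w) - (\<Sum>i. ?Y i w * ?D i)"
    by (simp only: sum.distrib) simp
  also have "(\<Sum>i. (if p = i then 1 else 0) * nabla c \<Gamma> i ?\<phi> w) = nabla c \<Gamma> p ?\<phi> w"
    by (simp add: if_distrib if_distribR cong: if_cong)
  finally show ?thesis .
qed

end

context symplectic_manifold_connection
begin

lemma nabla_alg_bracket:
  assumes "\<alpha> \<in> hat_smooth_sym A" "\<beta> \<in> hat_smooth_sym A" "c \<in> A" "fst w \<in> chart_dom c"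
  shows "nabla c \<Gamma> i (loc c (hat_alg_bracket A \<Omega> \<alpha> \<beta>)) w = (\<Sum>p q.
    fps_const (dupper c i (fst w) p q) * (der c (Inr p) \<alpha> w * der c (Inr q) \<beta> w) +
    fps_const (upper c (fst w) p q) *
      (nabla c \<Gamma> i (dd c (Inr p) (loc c \<alpha>)) w * der c (Inr q) \<beta> w +
       der c (Inr p) \<alpha> w * nabla c \<Gamma> i (dd c (Inr q) (loc c \<beta>)) w))"
proof -
  let ?a = "\<lambda>p. dd c (Inr p) (loc c \<alpha>)" and ?b = "\<lambda>p. dd c (Inr p) (loc c \<beta>)"
  let ?P = "\<lambda>p q w. fps_const (upper c (fst w) p q)"
  let ?dP = "\<lambda>e p q. case e of Inl i \<Rightarrow> fps_const (dupper c i (fst w) p q) | Inr _ \<Rightarrow> 0"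
  have d: "der c e (hat_alg_bracket A \<Omega> \<alpha> \<beta>) w = (\<Sum>p q.
      ?dP e p q * (gen (?a p) w * gen (?b q) w) +
      ?P p q w * (gen (dd c e (?a p)) w * gen (?b q) w + gen (?a p) w * gen (dd c e (?b q)) w))" (is "_ = ?R e") for e
  proof (rule has_d_unique)
    show "has_d c e (ser c (hat_alg_bracket A \<Omega> \<alpha> \<beta>)) w (der c e (hat_alg_bracket A \<Omega> \<alpha> \<beta>) w)"
      by (intro has_d_gen local_field_loc hat_smooth_sym_alg_bracket assms)
    have "has_d c e (\<lambda>w. \<Sum>p q. ?P p q w * (gen (?a p) w * gen (?b q) w)) w (?R e)"
      by (intro has_d_sum has_d_mult has_d_base has_d_gen local_field_dd local_field_loc assms
          smooth_in_chart_diff_at[OF smooth_upper])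
    then show "has_d c e (ser c (hat_alg_bracket A \<Omega> \<alpha> \<beta>)) w (?R e)"
      by (rule has_d_cong[OF assms(3,4)])
        (rule gen_hat_alg_bracket[OF assms(3) _ local_field_loc[OF assms(2,3)], symmetric])
  qed
  let ?g = "\<lambda>m. \<Sum>j. fps_const (\<Gamma> c (fst w) i j m) * (fps_X * fps_const (snd w j))"
  have "nabla c \<Gamma> i (loc c (hat_alg_bracket A \<Omega> \<alpha> \<beta>)) w = ?R (Inl i) -
      (\<Sum>p q. ?P p q w * ((\<Sum>m. ?g m * gen (dd c (Inr m) (?a p)) w) * gen (?b q) w +
        gen (?a p) w * (\<Sum>m. ?g m * gen (dd c (Inr m) (?b q)) w)))"
    unfolding nabla_def d sum.case mult_zero_left add_0_left sum_pull_inside sum_leibniz ..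
  also have "\<dots> = (\<Sum>p q. fps_const (dupper c i (fst w) p q) * (gen (?a p) w * gen (?b q) w) +
      ?P p q w * (nabla c \<Gamma> i (?a p) w * gen (?b q) w + gen (?a p) w * nabla c \<Gamma> i (?b q) w))"
    unfolding sum_subtractf[symmetric] sum.case nabla_def
    by (intro sum.cong refl) (simp only: algebra_simps)
  finally show ?thesis .
qed

lemma hat_schouten_coboundary:
  assumes "\<alpha> \<in> hat_smooth_sym A" "\<beta> \<in> hat_smooth_sym A"
  shows "hat_schouten A \<Omega> \<Gamma> \<alpha> \<beta> = hat_alg_bracket A \<Omega> (hat_delta_star A \<Gamma> \<alpha>) \<beta> +
    hat_alg_bracket A \<Omega> \<alpha> (hat_delta_star A \<Gamma> \<beta>) - hat_delta_star A \<Gamma> (hat_alg_bracket A \<Omega> \<alpha> \<beta>)"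
proof -
  let ?\<delta> = "hat_delta_star A \<Gamma>" and ?br = "hat_alg_bracket A \<Omega>"
  note \<delta> = hat_smooth_sym_closed(4)[OF _ affine]
  note smooth = hat_smooth_sym_schouten[OF assms affine] hat_smooth_sym_alg_bracket[OF \<delta>[OF assms(1)] assms(2)]
    hat_smooth_sym_alg_bracket[OF assms(1) \<delta>[OF assms(2)]] \<delta>[OF hat_smooth_sym_alg_bracket[OF assms]]
  have "hat_schouten A \<Omega> \<Gamma> \<alpha> \<beta> + ?\<delta> (?br \<alpha> \<beta>) = ?br (?\<delta> \<alpha>) \<beta> + ?br \<alpha> (?\<delta> \<beta>)"
  proof (rule hat_smooth_sym_eqI)
    fix c and w :: "'m \<times> ('n \<Rightarrow> real)" assume c: "c \<in> A" "fst w \<in> chart_dom c"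
    have lf: "local_field c (loc c \<alpha>)" "local_field c (loc c \<beta>)" "local_field c (loc c (?\<delta> \<beta>))"
      "local_field c (loc c (?br \<alpha> \<beta>))"
      by (intro local_field_loc assms c \<delta> hat_smooth_sym_alg_bracket)+
    have dP: "fps_const (dupper c i (fst w) p q) =
        - (\<Sum>m. fps_const (\<Gamma> c (fst w) i m p) * fps_const (upper c (fst w) m q)) -
        (\<Sum>m. fps_const (\<Gamma> c (fst w) i m q) * fps_const (upper c (fst w) p m))" for i p q
      unfolding pd_upper[OF connection c] by (simp add: fps_const_sum flip: fps_const_sub fps_const_neg)
    have skew: "fps_const (upper c (fst w) p q) = - fps_const (upper c (fst w) q p)" for p q
      using upper_skew[OF c, of p q] by simp
    show "ser c (hat_schouten A \<Omega> \<Gamma> \<alpha> \<beta> + ?\<delta> (?br \<alpha> \<beta>)) w = ser c (?br (?\<delta> \<alpha>) \<beta> + ?br \<alpha> (?\<delta> \<beta>)) w"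
      unfolding gen_loc_add gen_hat_schouten[OF c lf(1,2)] gen_hat_alg_bracket[OF c lf(2)] gen_hat_alg_bracket[OF c lf(3)]
        gen_hat_delta_star[OF c lf(4)] gen_Inr_delta_star[OF assms(1) affine c] gen_Inr_delta_star[OF assms(2) affine c]
        nabla_alg_bracket[OF assms c]
      by (rule coboundary_algebra[OF skew dP, unfolded eq_diff_eq])
  qed (intro hat_smooth_sym_closed(1) smooth)+
  then show ?thesis by (simp add: algebra_simps)
qed

end

section \<open>Homogeneous elements\<close>

definition single :: "nat \<Rightarrow> 'a::zero \<Rightarrow> nat \<Rightarrow> 'a"
  where "single k a = (\<lambda>m. if m = k then a else 0)"

text \<open>
  A homogeneous tensor is a sequence with one nonzero entry. For such sequences the sums over degrees
  collapse, which yields the statements for \<open>\<S>\<^sup>k(M)\<close> from those for the completed space.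
\<close>

lemma sum_single:
  assumes "\<And>i j b. F i j 0 b = 0" "\<And>i j a. F i j a 0 = 0"
  shows "(\<Sum>i\<le>n. F i (n - i) (single k a i) (single l b (n - i))) = (if k + l = n then F k l a b else 0)"
proof -
  have "(\<Sum>i\<le>n. F i (n - i) (single k a i) (single l b (n - i))) =
      (\<Sum>i\<le>n. if k = i then if k + l = n then F k l a b else 0 else 0)"
    by (rule sum.cong[OF refl]) (use assms in \<open>auto simp: single_def\<close>)
  then show ?thesis by auto
qed

lemma symmetrize_zero: "symmetrize (\<lambda>is. 0) = (\<lambda>is. 0)"
  by (simp add: symmetrize_def fun_eq_iff)

lemma cov_deriv_zero: "cov_deriv \<Gamma> 0 c x i js = 0"
  by (simp add: cov_deriv_def pd_def o_def)

lemma operations_zero: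
  "sym_prod A k l 0 \<beta> = 0" "sym_prod A k l \<alpha> 0 = 0"
  "alg_bracket A \<Omega> k l 0 \<beta> = 0" "alg_bracket A \<Omega> k l \<alpha> 0 = 0"
  "schouten A \<Omega> \<Gamma> k l 0 \<beta> = 0" "schouten A \<Omega> \<Gamma> k l \<alpha> 0 = 0"
  "delta_star A \<Gamma> k 0 = 0"
  by (simp_all add: sym_prod_def alg_bracket_def schouten_def contract_nabla_def delta_star_def
      restrict_tensor_def cov_deriv_zero symmetrize_zero fun_eq_iff)

lemma hat_sym_prod_single:
  "hat_sym_prod A (single k \<alpha>) (single l \<beta>) m = (if k + l = m then sym_prod A k l \<alpha> \<beta> else 0)"
  unfolding hat_sym_prod_def
  by (rule sum_single[where F = "sym_prod A"]) (simp_all add: operations_zero)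

lemma hat_alg_bracket_single:
  "hat_alg_bracket A \<Omega> (single k \<alpha>) (single l \<beta>) m = (if k + l = m + 2 then alg_bracket A \<Omega> k l \<alpha> \<beta> else 0)"
  unfolding hat_alg_bracket_def
  by (rule sum_single[where F = "alg_bracket A \<Omega>"]) (simp_all add: operations_zero)

lemma hat_schouten_single:
  "hat_schouten A \<Omega> \<Gamma> (single k \<alpha>) (single l \<beta>) m = (if k + l = m + 1 then schouten A \<Omega> \<Gamma> k l \<alpha> \<beta> else 0)"
  unfolding hat_schouten_def
  by (rule sum_single[where F = "schouten A \<Omega> \<Gamma>"]) (simp_all add: operations_zero)

lemma hat_delta_star_single:
  "hat_delta_star A \<Gamma> (single k \<alpha>) = single (Suc k) (delta_star A \<Gamma> k \<alpha>)"
proof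
  fix m
  show "hat_delta_star A \<Gamma> (single k \<alpha>) m = single (Suc k) (delta_star A \<Gamma> k \<alpha>) m"
    by (cases m) (simp_all add: single_def operations_zero)
qed

context smooth_manifold
begin

lemma single_hat_sym_tensors: "\<alpha> \<in> sym_tensors A k \<Longrightarrow> single k \<alpha> \<in> hat_sym_tensors A"
  using hat_sym_tensors_0 by (simp add: hat_sym_tensors_def single_def)

lemma delta_star_sym_prod:
  assumes "\<alpha> \<in> sym_tensors A k" "\<beta> \<in> sym_tensors A l" "affine_connection A \<Gamma>"
  shows "delta_star A \<Gamma> (k + l) (sym_prod A k l \<alpha> \<beta>) =
    sym_prod A (k + 1) l (delta_star A \<Gamma> k \<alpha>) \<beta> + sym_prod A k (l + 1) \<alpha> (delta_star A \<Gamma> l \<beta>)"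
  using fun_cong[OF hat_delta_star_sym_prod[OF single_hat_sym_tensors[OF assms(1), THEN hat_sym_tensors_smooth]
    single_hat_sym_tensors[OF assms(2), THEN hat_sym_tensors_smooth] assms(3)], of "Suc (k + l)"]
  by (simp add: hat_delta_star_single hat_sym_prod_single)

end

context symplectic_manifold_connection
begin

lemma schouten_coboundary:
  assumes "\<alpha> \<in> sym_tensors A k" "\<beta> \<in> sym_tensors A l"
  shows "schouten A \<Omega> \<Gamma> k l \<alpha> \<beta> = alg_bracket A \<Omega> (k + 1) l (delta_star A \<Gamma> k \<alpha>) \<beta> +
    alg_bracket A \<Omega> k (l + 1) \<alpha> (delta_star A \<Gamma> l \<beta>) - delta_star A \<Gamma> (k + l - 2) (alg_bracket A \<Omega> k l \<alpha> \<beta>)"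
proof -
  have zero: "alg_bracket A \<Omega> 0 l \<alpha> \<beta> = 0" "alg_bracket A \<Omega> k 0 \<alpha> \<beta> = 0" for k l \<alpha> \<beta>
    by (simp_all add: alg_bracket_def restrict_tensor_def fun_eq_iff)
  note hat = fun_cong[OF hat_schouten_coboundary[OF single_hat_sym_tensors[OF assms(1), THEN hat_sym_tensors_smooth]
    single_hat_sym_tensors[OF assms(2), THEN hat_sym_tensors_smooth]], of "k + l - 1"]
  consider "k = 0" "l = 0" | "k + l = 1" | m where "k + l = Suc (Suc m)"
    by (metis One_nat_def add_is_0 not0_implies_Suc)
  then show ?thesis
  proof cases
    case 1
    then show ?thesis
      by (simp add: zero operations_zero) (simp add: schouten_def restrict_tensor_def fun_eq_iff)
  next
    case 2
    then have "alg_bracket A \<Omega> k l \<alpha> \<beta> = 0" using zero by (cases k) auto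
    then show ?thesis
      using hat 2 by (simp add: hat_delta_star_single hat_schouten_single hat_alg_bracket_single operations_zero)
  next
    case 3
    then show ?thesis
      using hat by (simp add: hat_delta_star_single hat_schouten_single hat_alg_bracket_single)
  qed
qed

end


section \<open>Change of the symplectic connection\<close>

lemma mset_triple:
  "mset [a, b, c] = mset [a', b', c'] \<Longrightarrow>
    (a = a' \<and> b = b' \<and> c = c') \<or> (a = a' \<and> b = c' \<and> c = b') \<or> (a = b' \<and> b = a' \<and> c = c') \<or>
    (a = b' \<and> b = c' \<and> c = a') \<or> (a = c' \<and> b = a' \<and> c = b') \<or> (a = c' \<and> b = b' \<and> c = a')"
  by (auto simp: add_eq_conv_ex)

lemma sym_fun_triple:
  fixes T :: "'n list \<Rightarrow> real"
  assumes "\<And>i j k. T [i, j, k] = T [j, i, k]" "\<And>i j k. T [i, j, k] = T [i, k, j]"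
    and "\<And>is. length is \<noteq> 3 \<Longrightarrow> T is = 0"
  shows "sym_fun T"
  unfolding sym_fun_def
proof (intro allI impI)
  fix "is" js :: "'n list" assume m: "mset is = mset js"
  show "T is = T js"
  proof (cases "length is = 3")
    case False
    then show ?thesis using mset_eq_length[OF m] assms(3) by simp
  next
    case True
    then obtain a b c where "is": "is = [a, b, c]" by (auto simp: numeral_3_eq_3 length_Suc_conv)
    obtain a' b' c' where js: "js = [a', b', c']"
      using True mset_eq_length[OF m] by (auto simp: numeral_3_eq_3 length_Suc_conv)
    from mset_triple[OF m[unfolded "is" js]] show ?thesis
      unfolding "is" js using assms(1,2) by metis
  qed
qed

locale two_symplectic_connections = symplectic_manifold_connection A \<Omega> \<Gamma>
  for A :: "('m::{t2_space, second_countable_topology}, 'n::finite) chart set" and \<Omega> \<Gamma> +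
  fixes \<Gamma>' :: "('m, 'n) christoffel"
  assumes connection': "symplectic_connection A \<Omega> \<Gamma>'"
begin

abbreviation connection_diff where "connection_diff c x i j k \<equiv> \<Gamma>' c x i j k - \<Gamma> c x i j k"

lemma affine': "affine_connection A \<Gamma>'"
  using connection' by (simp add: symplectic_connection_def)

text \<open>
  The cubic form whose bracket with \<open>\<alpha>\<close> is the difference of the two operators. The factor \<open>1/3\<close>
  compensates for the three equal slots that a derivative in the fibre produces, and the sign is the one
  in \<open>\<Omega>\<^sup>i\<^sup>p \<Omega>\<^sub>p\<^sub>j = - \<delta>\<^sub>j\<^sup>i\<close>.
\<close>

definition primitive :: "('m, 'n) tensor"
  where "primitive = restrict_tensor A 3 (\<lambda>c x is.
    - 1 / 3 * (\<Sum>p. form c x (is ! 2) p * connection_diff c x (is ! 0) (is ! 1) p))"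

lemma primitive_apply:
  "c \<in> A \<Longrightarrow> x \<in> chart_dom c \<Longrightarrow>
    primitive c x [i, j, r] = - 1 / 3 * (\<Sum>p. form c x r p * connection_diff c x i j p)"
  by (simp add: primitive_def restrict_tensor_def numeral_2_eq_2)

text \<open>
  The first symmetry is the absence of torsion. The second one is the difference of the equations
  \<open>\<nabla>\<^sub>i \<Omega>\<^sub>j\<^sub>r = 0\<close> for the two connections, from which the derivatives of \<open>\<Omega>\<close> drop out.
\<close>

lemma primitive_swap:
  assumes "c \<in> A" "x \<in> chart_dom c"
  shows "primitive c x [i, j, r] = primitive c x [j, i, r]" "primitive c x [i, j, r] = primitive c x [i, r, j]"
proof -
  have \<Gamma>': "\<Gamma>' c x i j k = \<Gamma>' c x j i k" for i j k
    using connection' assms unfolding symplectic_connection_def torsion_free_def by blast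
  show "primitive c x [i, j, r] = primitive c x [j, i, r]"
    unfolding primitive_apply[OF assms] by (simp only: \<Gamma>'[of i j] christoffel_sym[OF assms, of i j])
  have cov: "pd c i (\<lambda>z. form c z j r) x = (\<Sum>m. G c x i j m * form c x m r) + (\<Sum>m. G c x i r m * form c x j m)"
    if "symplectic_connection A \<Omega> G" for G
  proof -
    have "cov_deriv G \<Omega> c x i [j, r] = 0" using that assms unfolding symplectic_connection_def by blast
    then show ?thesis by (simp add: cov_deriv_def numeral_2_eq_2)
  qed
  have "(\<Sum>m. connection_diff c x i j m * form c x m r) + (\<Sum>m. connection_diff c x i r m * form c x j m) = 0"
    using cov[OF connection] cov[OF connection'] by (simp add: left_diff_distrib sum_subtractf)
  moreover have "(\<Sum>m. connection_diff c x i j m * form c x m r) = - (\<Sum>m. connection_diff c x i j m * form c x r m)"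
    by (subst form_skew) (simp add: sum_negf)
  ultimately show "primitive c x [i, j, r] = primitive c x [i, r, j]"
    unfolding primitive_apply[OF assms] by (simp add: mult.commute)
qed

lemma smooth_sym_primitive: "smooth_sym A 3 primitive"
proof -
  have "sym_fun (primitive c x)" for c x
  proof (rule sym_fun_triple)
    fix i j k
    have outside: "primitive c x is = 0" if "\<not> (c \<in> A \<and> x \<in> chart_dom c)" for "is"
      using that by (auto simp: primitive_def restrict_tensor_def)
    show "primitive c x [i, j, k] = primitive c x [j, i, k]"
      using primitive_swap(1) outside by metis
    show "primitive c x [i, j, k] = primitive c x [i, k, j]"
      using primitive_swap(2) outside by metis
  qed (simp add: primitive_def restrict_tensor_def)
  moreover have "smooth_in_chart c (\<lambda>x. primitive c x is)" if "c \<in> A" "length is = 3" for c "is"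
  proof (rule smooth_in_chart_cong[OF that(1)])
    show "smooth_in_chart c (\<lambda>x. - 1 / 3 * (\<Sum>p. form c x (is ! 2) p * connection_diff c x (is ! 0) (is ! 1) p))"
      by (intro smooth_in_chart_mult smooth_in_chart_const smooth_in_chart_sum smooth_in_chart_diff smooth_form
          smooth_christoffel affine affine' that(1))
  qed (simp add: primitive_def restrict_tensor_def that)
  moreover have "restrict_tensor A 3 primitive = primitive"
    by (simp add: primitive_def restrict_tensor_def fun_eq_iff)
  ultimately show ?thesis by (simp add: smooth_sym_def)
qed

definition quadratic_diff :: "('m, 'n) chart \<Rightarrow> 'm \<Rightarrow> ('n \<Rightarrow> real) \<Rightarrow> 'n \<Rightarrow> real"
  where "quadratic_diff c x y p = (\<Sum>i j. y i * y j * connection_diff c x i j p)"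

lemma ev_primitive:
  assumes "c \<in> A" "x \<in> chart_dom c"
  shows "ev 3 (primitive c x) y = - 1 / 3 * (\<Sum>p. (\<Sum>r. form c x r p * y r) * quadratic_diff c x y p)"
    and "3 * ev 2 (\<lambda>is. primitive c x (q # is)) y = - (\<Sum>p. form c x q p * quadratic_diff c x y p)"
proof -
  have 2: "ev 2 (\<lambda>is. primitive c x (q # is)) y = - 1 / 3 * (\<Sum>p. form c x q p * quadratic_diff c x y p)" for q
  proof -
    \<comment> \<open>moves the contracted index to the last slot, where it meets \<open>\<Omega>\<close>\<close>
    have "primitive c x [q, i, j] = primitive c x [i, j, q]" for i j
      using primitive_swap[OF assms] by metis
    then have "ev 2 (\<lambda>is. primitive c x (q # is)) y =
        - 1 / 3 * (\<Sum>i j p. form c x q p * (y i * y j * connection_diff c x i j p))"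
      by (simp add: numeral_2_eq_2 primitive_apply[OF assms] sum_distrib_left mult_ac)
    also have "\<dots> = - 1 / 3 * (\<Sum>p. form c x q p * quadratic_diff c x y p)"
      unfolding quadratic_diff_def sum_distrib_left by (subst sum_swap_3) (rule refl)
    finally show ?thesis .
  qed
  then show "3 * ev 2 (\<lambda>is. primitive c x (q # is)) y = - (\<Sum>p. form c x q p * quadratic_diff c x y p)"
    by simp
  have "ev 3 (primitive c x) y = (\<Sum>r. y r * ev 2 (\<lambda>is. primitive c x (r # is)) y)"
    by (simp add: numeral_3_eq_3 numeral_2_eq_2)
  also have "\<dots> = - 1 / 3 * (\<Sum>p. (\<Sum>r. form c x r p * y r) * quadratic_diff c x y p)"
    unfolding 2 sum_distrib_left sum_distrib_right by (subst sum.swap) (simp only: mult_ac)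
  finally show "ev 3 (primitive c x) y = - 1 / 3 * (\<Sum>p. (\<Sum>r. form c x r p * y r) * quadratic_diff c x y p)" .
qed

lemma gen_single: "ser c (single k \<alpha>) w = fps_X ^ k * fps_const (ev k (\<alpha> c (fst w)) (snd w))"
  by (rule fps_ext) (auto simp: gen_loc_nth single_def fps_X_power_mult_nth zero_fun_def)

lemma primitive_hat_sym_tensors: "single 3 primitive \<in> hat_sym_tensors A"
proof (rule hat_sym_tensorsI)
  show "single 3 primitive \<in> hat_smooth_sym A"
    using smooth_sym_primitive by (simp add: hat_smooth_sym_def single_def smooth_sym_0)
  fix c c' x and y :: "'n \<Rightarrow> real"
  assume c: "c \<in> A" "c' \<in> A" "x \<in> chart_dom c" "x \<in> chart_dom c'"
  let ?J = "\<lambda>a i. jac c c' a i x" and ?K = "\<lambda>a i. jac c' c a i x"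
  let ?y = "\<lambda>a. \<Sum>i. ?J a i * y i"
  let ?Q = "quadratic_diff c x ?y"
  have D: "connection_diff c' x i j p = (\<Sum>d. ?K p d *
      (\<Sum>a b. ?J a i * ?J b j * connection_diff c x a b d))" for i j p
  proof -
    have "G c' x i j p = (\<Sum>d. ?K p d *
        ((\<Sum>a b. ?J a i * ?J b j * G c x a b d) + pd c' i (jac c c' d j) x))"
      if "affine_connection A G" for G
      using that c unfolding affine_connection_def by blast
    from this[OF affine] this[OF affine'] show ?thesis
      by (simp add: right_diff_distrib distrib_left sum.distrib sum_subtractf)
  qed
  have Q: "quadratic_diff c' x y p = (\<Sum>d. ?K p d * ?Q d)" for p
  proof -
    have "quadratic_diff c' x y p = (\<Sum>d. ?K p d * (\<Sum>i j. y i * y j *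
        (\<Sum>a b. ?J a i * ?J b j * connection_diff c x a b d)))"
      unfolding quadratic_diff_def D by (rule sum_pull_inside[symmetric])
    also have "(\<lambda>d. \<Sum>i j. y i * y j *
        (\<Sum>a b. ?J a i * ?J b j * connection_diff c x a b d)) = ?Q"
    proof
      fix d
      have "(\<Sum>i j. y i * y j * (\<Sum>a b. ?J a i * ?J b j * connection_diff c x a b d)) =
          (\<Sum>i j a b. (?J a i * y i) * (?J b j * y j) * connection_diff c x a b d)"
        unfolding sum_distrib_left by (simp only: mult_ac)
      also have "\<dots> = (\<Sum>a b i j. (?J a i * y i) * (?J b j * y j) * connection_diff c x a b d)"
        by (rule sum_swap_pairs)
      also have "\<dots> = ?Q d"
        unfolding quadratic_diff_def sum_product unfolding sum_distrib_right ..
      finally show "(\<Sum>i j. y i * y j *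
          (\<Sum>a b. ?J a i * ?J b j * connection_diff c x a b d)) = ?Q d" .
    qed
    finally show ?thesis .
  qed
  have W: "(\<Sum>r. form c' x r p * y r) = (\<Sum>b. ?J b p * (\<Sum>a. form c x a b * ?y a))" for p
  proof -
    have "(\<Sum>r. form c' x r p * y r) = (\<Sum>r a b. ?J b p * (form c x a b * (?J a r * y r)))"
      unfolding form_transformation[OF c] sum_distrib_right by (simp only: mult_ac)
    also have "\<dots> = (\<Sum>b. ?J b p * (\<Sum>a. form c x a b * ?y a))"
      unfolding sum_distrib_left
      by (subst sum_swap_3, rule sum.cong[OF refl], rule sum.swap)
    finally show ?thesis .
  qed
  let ?W = "\<lambda>b. \<Sum>a. form c x a b * ?y a"
  have "(\<Sum>p. (\<Sum>b. ?J b p * ?W b) * (\<Sum>d. ?K p d * ?Q d)) =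
      (\<Sum>p b d. ?J b p * ?K p d * (?W b * ?Q d))"
    unfolding sum_product by (simp only: mult_ac)
  also have "\<dots> = (\<Sum>b d. (\<Sum>p. ?J b p * ?K p d) * (?W b * ?Q d))"
    unfolding sum_distrib_right[of _ _ "?W b * ?Q d" for b d] by (rule sum_swap_3[symmetric])
  also have "\<dots> = (\<Sum>b d. (if d = b then 1 else 0) * (?W b * ?Q d))"
    using jac_inverse[OF c(2,1,4,3)] by (simp only: mult.commute[of "?J b p" "?K p d" for b p d])
  also have "\<dots> = (\<Sum>b. ?W b * ?Q b)"
    by (simp add: if_distrib if_distribR cong: if_cong)
  finally show "ser c' (single 3 primitive) (x, y) = ser c (single 3 primitive) (x, ?y)"
    unfolding gen_single fst_conv snd_conv ev_primitive(1)[OF c(2,4)] ev_primitive(1)[OF c(1,3)] W Q by simp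
qed

lemma gen_Inr_primitive:
  assumes "c \<in> A" "fst w \<in> chart_dom c"
  shows "der c (Inr q) (single 3 primitive) w =
    - (fps_X * fps_X * fps_const (\<Sum>p. form c (fst w) q p * quadratic_diff c (fst w) (snd w) p))"
proof -
  have "fps_X * der c (Inr q) (single 3 primitive) w =
      fps_X * (- (fps_X ^ 2 * fps_const (\<Sum>p. form c (fst w) q p * quadratic_diff c (fst w) (snd w) p)))"
  proof (rule fps_ext)
    fix k
    have "fps_nth (fps_X * der c (Inr q) (single 3 primitive) w) k =
        (if k = 3 then 3 * ev 2 (\<lambda>is. primitive c (fst w) (q # is)) (snd w) else 0)"
      unfolding gen_Inr_loc_nth by (simp add: single_def)
    also have "\<dots> = (if k = 3 then - (\<Sum>p. form c (fst w) q p * quadratic_diff c (fst w) (snd w) p) else 0)"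
      unfolding ev_primitive(2)[OF assms] ..
    also have "\<dots> = fps_nth (fps_X * (- (fps_X ^ 2 *
        fps_const (\<Sum>p. form c (fst w) q p * quadratic_diff c (fst w) (snd w) p)))) k"
      by (auto simp: fps_X_power_mult_nth)
    finally show "fps_nth (fps_X * der c (Inr q) (single 3 primitive) w) k = fps_nth (fps_X * (- (fps_X ^ 2 *
        fps_const (\<Sum>p. form c (fst w) q p * quadratic_diff c (fst w) (snd w) p)))) k" .
  qed
  then have "der c (Inr q) (single 3 primitive) w =
      - (fps_X ^ 2 * fps_const (\<Sum>p. form c (fst w) q p * quadratic_diff c (fst w) (snd w) p))"
    using mult_left_cancel[of "fps_X :: real fps"] fps_X_neq_zero by blast
  then show ?thesis by (simp add: power2_eq_square)
qed

text \<open>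
  The difference of the operators is \<open>y\<^sup>i y\<^sup>j \<Pi>\<^sub>i\<^sub>j\<^sup>m \<partial>\<^sub>m \<alpha>\<close> with \<open>\<Pi>\<close> the difference of the connections. Raising the
  index in \<open>\<partial>\<^sub>q h = - \<Omega>\<^sub>q\<^sub>r \<Pi>\<^sub>i\<^sub>j\<^sup>r y\<^sup>i y\<^sup>j\<close> gives the same expression.
\<close>

lemma delta_star_diff:
  assumes "\<alpha> \<in> hat_smooth_sym A"
  shows "hat_delta_star A \<Gamma>' \<alpha> = hat_delta_star A \<Gamma> \<alpha> + hat_alg_bracket A \<Omega> \<alpha> (single 3 primitive)"
proof (rule hat_smooth_sym_eqI)
  note h = hat_sym_tensors_smooth[OF primitive_hat_sym_tensors]
  show "hat_delta_star A \<Gamma>' \<alpha> \<in> hat_smooth_sym A"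
    "hat_delta_star A \<Gamma> \<alpha> + hat_alg_bracket A \<Omega> \<alpha> (single 3 primitive) \<in> hat_smooth_sym A"
    by (intro hat_smooth_sym_closed hat_smooth_sym_alg_bracket assms affine affine' h)+
  fix c and w :: "'m \<times> ('n \<Rightarrow> real)" assume c: "c \<in> A" "fst w \<in> chart_dom c"
  let ?a = "\<lambda>m. der c (Inr m) \<alpha> w" and ?Q = "quadratic_diff c (fst w) (snd w)"
  let ?y = "snd w" and ?P = "upper c (fst w)" and ?W = "form c (fst w)"
  have n: "nabla c \<Gamma>' i (loc c \<alpha>) w = nabla c \<Gamma> i (loc c \<alpha>) w -
      (\<Sum>m. fps_const (\<Sum>j. ?y j * connection_diff c (fst w) i j m) * (fps_X * ?a m))" for i
  proof -
    have "(\<Sum>m. fps_const (\<Sum>j. ?y j * connection_diff c (fst w) i j m) * (fps_X * ?a m)) =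
        (\<Sum>m. fps_const (\<Sum>j. ?y j * \<Gamma>' c (fst w) i j m) * (fps_X * ?a m)) -
        (\<Sum>m. fps_const (\<Sum>j. ?y j * \<Gamma> c (fst w) i j m) * (fps_X * ?a m))"
      by (simp add: right_diff_distrib left_diff_distrib sum_subtractf flip: fps_const_sub)
    then show ?thesis unfolding nabla_alt by simp
  qed
  have contract: "(\<Sum>i. fps_const (?y i) * (\<Sum>m. fps_const (\<Sum>j. ?y j * connection_diff c (fst w) i j m) * (fps_X * ?a m))) =
      (\<Sum>m. fps_const (?Q m) * (fps_X * ?a m))"
    unfolding sum_fps_const_swap
    unfolding quadratic_diff_def sum_distrib_left by (simp only: mult.assoc)
  have L: "(\<Sum>i. fps_X * fps_const (?y i) *
      (\<Sum>m. fps_const (\<Sum>j. ?y j * connection_diff c (fst w) i j m) * (fps_X * ?a m))) =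
      (\<Sum>m. fps_X * fps_X * (fps_const (?Q m) * ?a m))" (is "?L = _")
  proof -
    have "?L = fps_X * (\<Sum>i. fps_const (?y i) *
        (\<Sum>m. fps_const (\<Sum>j. ?y j * connection_diff c (fst w) i j m) * (fps_X * ?a m)))"
      by (simp only: sum_distrib_left[of fps_X] mult.assoc)
    then show ?thesis unfolding contract by (simp only: sum_distrib_left[of fps_X] mult_ac)
  qed
  have "(\<Sum>q. fps_const (?P p q) * (?a p * - (fps_X * fps_X * fps_const (\<Sum>r. ?W q r * ?Q r)))) =
      fps_X * fps_X * (fps_const (?Q p) * ?a p)" for p
  proof -
    have "(\<Sum>q. ?P p q * (\<Sum>r. ?W q r * ?Q r)) = (\<Sum>r. (\<Sum>q. ?P p q * ?W q r) * ?Q r)"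
      unfolding sum_distrib_left sum_distrib_right by (subst sum.swap) (simp only: mult.assoc)
    also have "\<dots> = - ?Q p"
      unfolding upper_form(1)[OF c] by (simp add: if_distrib if_distribR cong: if_cong)
    finally have r: "(\<Sum>q. ?P p q * (\<Sum>r. ?W q r * ?Q r)) = - ?Q p" .
    have "(\<Sum>q. fps_const (?P p q) * (?a p * - (fps_X * fps_X * fps_const (\<Sum>r. ?W q r * ?Q r)))) =
        - (fps_X * fps_X * ?a p) * fps_const (\<Sum>q. ?P p q * (\<Sum>r. ?W q r * ?Q r))"
      unfolding fps_const_sum[of "\<lambda>q. ?P p q * (\<Sum>r. ?W q r * ?Q r)"] sum_distrib_left[of "- (fps_X * fps_X * ?a p)"]
      by (rule sum.cong[OF refl]) (simp only: fps_const_mult[symmetric] mult_minus_left mult_minus_right mult_ac)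
    then show ?thesis unfolding r by (simp add: mult_ac flip: fps_const_neg)
  qed
  then have R: "ser c (hat_alg_bracket A \<Omega> \<alpha> (single 3 primitive)) w =
      (\<Sum>m. fps_X * fps_X * (fps_const (?Q m) * ?a m))"
    unfolding gen_hat_alg_bracket[OF c local_field_loc[OF h c(1)]] gen_Inr_primitive[OF c] by simp
  have sub: "(\<Sum>i. f i * (g i - h i)) = (\<Sum>i. f i * g i) - (\<Sum>i. f i * h i)"
    for f g h :: "'n \<Rightarrow> real fps"
    by (simp only: right_diff_distrib sum_subtractf)
  show "ser c (hat_delta_star A \<Gamma>' \<alpha>) w =
      ser c (hat_delta_star A \<Gamma> \<alpha> + hat_alg_bracket A \<Omega> \<alpha> (single 3 primitive)) w"
    unfolding gen_loc_add R gen_hat_delta_star[OF c local_field_loc[OF assms c(1)]] n sub L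
    by simp
qed

end

section \<open>Cochains of the algebraic bracket\<close>

context smooth_manifold
begin

lemma hat_delta_star_linear:
  assumes "\<alpha> \<in> hat_smooth_sym A" "\<beta> \<in> hat_smooth_sym A" "affine_connection A \<Gamma>"
  shows "hat_delta_star A \<Gamma> (a *\<^sub>R \<alpha> + b *\<^sub>R \<beta>) = a *\<^sub>R hat_delta_star A \<Gamma> \<alpha> + b *\<^sub>R hat_delta_star A \<Gamma> \<beta>"
proof (rule hat_smooth_sym_eqI)
  fix c and w :: "'m \<times> ('n \<Rightarrow> real)" assume c: "c \<in> A" "fst w \<in> chart_dom c"
  have pull: "(\<Sum>m. g m * (fps_const a * u m + fps_const b * v m)) =
      fps_const a * (\<Sum>m. g m * u m) + fps_const b * (\<Sum>m. g m * v m)"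
    for g u v :: "'n \<Rightarrow> real fps"
    by (simp only: sum_distrib_left distrib_left sum.distrib mult.left_commute)
  have n: "nabla c \<Gamma> i (loc c (a *\<^sub>R \<alpha> + b *\<^sub>R \<beta>)) w =
      fps_const a * nabla c \<Gamma> i (loc c \<alpha>) w + fps_const b * nabla c \<Gamma> i (loc c \<beta>) w" for i
    unfolding nabla_def gen_dd_linear[OF assms(1,2) c] pull by (simp only: algebra_simps)
  show "ser c (hat_delta_star A \<Gamma> (a *\<^sub>R \<alpha> + b *\<^sub>R \<beta>)) w =
      ser c (a *\<^sub>R hat_delta_star A \<Gamma> \<alpha> + b *\<^sub>R hat_delta_star A \<Gamma> \<beta>) w"
    unfolding gen_loc_linear
      gen_hat_delta_star[OF c local_field_loc[OF hat_smooth_sym_linear[OF assms(1,2)] c(1)]]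
      gen_hat_delta_star[OF c local_field_loc[OF assms(1) c(1)]]
      gen_hat_delta_star[OF c local_field_loc[OF assms(2) c(1)]] n pull by simp
qed (intro hat_smooth_sym_linear hat_smooth_sym_closed assms)+

lemma cochain1_delta_star:
  assumes "affine_connection A \<Gamma>"
  shows "cochain1 (hat_delta_star A \<Gamma>) \<in> cochains (hat_sym_tensors A) 1"
  unfolding cochains_def cochain1_def
proof (intro CollectI allI impI conjI ballI)
  fix xs :: "(nat \<Rightarrow> ('m, 'n) tensor) list"
  assume xs: "set xs \<subseteq> hat_sym_tensors A \<and> length xs = 1"
  then show "hat_delta_star A \<Gamma> (xs ! 0) \<in> hat_sym_tensors A"
    by (intro hat_sym_tensors_delta_star assms) (auto simp: subset_iff)
  fix i x y and a b :: real
  assume "i < (1 :: nat)" "x \<in> hat_sym_tensors A" "y \<in> hat_sym_tensors A"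
  then show "hat_delta_star A \<Gamma> (xs[i := a *\<^sub>R x + b *\<^sub>R y] ! 0) =
      a *\<^sub>R hat_delta_star A \<Gamma> (xs[i := x] ! 0) + b *\<^sub>R hat_delta_star A \<Gamma> (xs[i := y] ! 0)"
    using xs hat_delta_star_linear[OF _ _ assms] by (simp add: hat_sym_tensors_smooth)
qed auto

end

lemma cochain2_lie_bracket:
  assumes "lie_bracket_on V br"
  shows "cochain2 br \<in> cochains V 2"
  unfolding cochains_def cochain2_def
proof (intro CollectI allI impI conjI ballI)
  fix xs assume xs: "set xs \<subseteq> V \<and> length xs = 2"
  then obtain u v where uv: "xs = [u, v]" "u \<in> V" "v \<in> V"
    by (auto simp: numeral_2_eq_2 length_Suc_conv)
  then show "br (xs ! 0) (xs ! 1) \<in> V" using assms by (simp add: lie_bracket_on_def)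
  fix i :: nat
  assume i: "i < 2"
  then have i': "i = 0 \<or> i = 1" by auto
  show "br (xs ! 0) (xs ! 1) = 0" if "j < 2" "i \<noteq> j \<and> xs ! i = xs ! j" for j
    using that i i' uv assms by (auto simp: lie_bracket_on_def less_2_cases_iff)
  fix x y and a b :: real
  assume "x \<in> V" "y \<in> V"
  then show "br (xs[i := a *\<^sub>R x + b *\<^sub>R y] ! 0) (xs[i := a *\<^sub>R x + b *\<^sub>R y] ! 1) =
      a *\<^sub>R br (xs[i := x] ! 0) (xs[i := x] ! 1) + b *\<^sub>R br (xs[i := y] ! 0) (xs[i := y] ! 1)"
    using i' uv assms by (auto simp: lie_bracket_on_def bilinear_on_def)
qed

lemma ce_differential_cochain1:
  "ce_differential br (cochain1 f) [x, y] = br x (f y) - br y (f x) - f (br x y)"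
  by (simp add: ce_differential_def cochain1_def delete_nth_def lessThan_Suc)

lemma ce_differential_0: "ce_differential br (\<lambda>xs. h) [x] = br x h"
  by (simp add: ce_differential_def)

lemma lie_bracket_on_skew:
  assumes "lie_bracket_on V br" "x \<in> V" "y \<in> V"
  shows "br x y = - br y x"
proof -
  have add: "br (u + v) z = br u z + br v z" "br z (u + v) = br z u + br z v"
    if "u \<in> V" "v \<in> V" "z \<in> V" for u v z
  proof -
    have "br (1 *\<^sub>R u + 1 *\<^sub>R v) z = 1 *\<^sub>R br u z + 1 *\<^sub>R br v z \<and>
        br z (1 *\<^sub>R u + 1 *\<^sub>R v) = 1 *\<^sub>R br z u + 1 *\<^sub>R br z v"
      using assms(1) that unfolding lie_bracket_on_def bilinear_on_def by blast
    then show "br (u + v) z = br u z + br v z" "br z (u + v) = br z u + br z v" by simp_all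
  qed
  have xy: "x + y \<in> V" using assms unfolding lie_bracket_on_def subspace_def by blast
  have zero: "br z z = 0" if "z \<in> V" for z
    using assms(1) that unfolding lie_bracket_on_def by blast
  have "br x y + br y x = 0"
    using zero[OF xy] add(1)[OF assms(2,3) xy] add(2)[OF assms(2,3,2)] add(2)[OF assms(2,3,3)]
      zero[OF assms(2)] zero[OF assms(3)] by simp
  then show ?thesis by (simp add: eq_neg_iff_add_eq_0)
qed

theorem lemma3p5:
  fixes A :: "('m::{t2_space, second_countable_topology}, 'n::finite) chart set"
    and \<Omega> :: "('m, 'n) tensor"
    and \<Gamma> :: "('m, 'n) christoffel"
  assumes "symplectic_manifold A \<Omega>"
    and "symplectic_connection A \<Omega> \<Gamma>"
  shows "(\<forall>k l. \<forall>\<alpha>\<in>sym_tensors A k. \<forall>\<beta>\<in>sym_tensors A l.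
         delta_star A \<Gamma> (k + l) (sym_prod A k l \<alpha> \<beta>) =
           sym_prod A (k + 1) l (delta_star A \<Gamma> k \<alpha>) \<beta> +
           sym_prod A k (l + 1) \<alpha> (delta_star A \<Gamma> l \<beta>)) \<and>
    (\<forall>\<alpha>\<in>hat_sym_tensors A. \<forall>\<beta>\<in>hat_sym_tensors A.
         hat_delta_star A \<Gamma> (hat_sym_prod A \<alpha> \<beta>) =
           hat_sym_prod A (hat_delta_star A \<Gamma> \<alpha>) \<beta> + hat_sym_prod A \<alpha> (hat_delta_star A \<Gamma> \<beta>)) \<and>
    (cochain1 (hat_delta_star A \<Gamma>) \<in> cochains (hat_sym_tensors A) 1 \<and>
       cochain2 (hat_schouten A \<Omega> \<Gamma>) \<in> cochains (hat_sym_tensors A) 2 \<and>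
       (\<forall>\<alpha>\<in>hat_sym_tensors A. \<forall>\<beta>\<in>hat_sym_tensors A.
          cochain2 (hat_schouten A \<Omega> \<Gamma>) [\<alpha>, \<beta>] =
            ce_differential (hat_alg_bracket A \<Omega>) (cochain1 (hat_delta_star A \<Gamma>)) [\<alpha>, \<beta>])) \<and>
    (\<forall>k l. \<forall>\<alpha>\<in>sym_tensors A k. \<forall>\<beta>\<in>sym_tensors A l.
         schouten A \<Omega> \<Gamma> k l \<alpha> \<beta> =
           alg_bracket A \<Omega> (k + 1) l (delta_star A \<Gamma> k \<alpha>) \<beta> +
           alg_bracket A \<Omega> k (l + 1) \<alpha> (delta_star A \<Gamma> l \<beta>) -
           delta_star A \<Gamma> (k + l - 2) (alg_bracket A \<Omega> k l \<alpha> \<beta>)) \<and>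
    (compatible_lie_brackets (hat_sym_tensors A) (hat_schouten A \<Omega> \<Gamma>) (hat_alg_bracket A \<Omega>)) \<and>
    (\<forall>\<alpha>\<in>hat_sym_tensors A. \<forall>\<beta>\<in>hat_sym_tensors A. \<forall>\<gamma>\<in>hat_sym_tensors A.
         0 = hat_alg_bracket A \<Omega> (hat_schouten A \<Omega> \<Gamma> \<alpha> \<beta>) \<gamma> +
             hat_alg_bracket A \<Omega> (hat_schouten A \<Omega> \<Gamma> \<beta> \<gamma>) \<alpha> +
             hat_alg_bracket A \<Omega> (hat_schouten A \<Omega> \<Gamma> \<gamma> \<alpha>) \<beta> +
             hat_schouten A \<Omega> \<Gamma> (hat_alg_bracket A \<Omega> \<alpha> \<beta>) \<gamma> +
             hat_schouten A \<Omega> \<Gamma> (hat_alg_bracket A \<Omega> \<beta> \<gamma>) \<alpha> +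
             hat_schouten A \<Omega> \<Gamma> (hat_alg_bracket A \<Omega> \<gamma> \<alpha>) \<beta>) \<and>
    (\<forall>\<Gamma>'. symplectic_connection A \<Omega> \<Gamma>' \<longrightarrow>
         cohomologous (hat_sym_tensors A) (hat_alg_bracket A \<Omega>) 0
           (cochain1 (hat_delta_star A \<Gamma>')) (cochain1 (hat_delta_star A \<Gamma>)))"
proof -
  interpret symplectic_manifold_connection A \<Omega> \<Gamma>
    using assms by (simp add: symplectic_manifold_connection_def symplectic_manifold_connection_axioms_def)
  have pencil: "pencil s t = (\<lambda>\<alpha> \<beta>. s *\<^sub>R hat_schouten A \<Omega> \<Gamma> \<alpha> \<beta> + t *\<^sub>R hat_alg_bracket A \<Omega> \<alpha> \<beta>)" for s t
    by (intro ext) (simp add: pencil_def)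
  have schouten: "lie_bracket_on (hat_sym_tensors A) (hat_schouten A \<Omega> \<Gamma>)"
    using lie_bracket_pencil[of 1 0] unfolding pencil by simp
  have alg: "lie_bracket_on (hat_sym_tensors A) (hat_alg_bracket A \<Omega>)"
    using lie_bracket_pencil[of 0 1] unfolding pencil by simp
  have coboundary: "cochain2 (hat_schouten A \<Omega> \<Gamma>) [\<alpha>, \<beta>] =
      ce_differential (hat_alg_bracket A \<Omega>) (cochain1 (hat_delta_star A \<Gamma>)) [\<alpha>, \<beta>]"
    if h: "\<alpha> \<in> hat_sym_tensors A" "\<beta> \<in> hat_sym_tensors A" for \<alpha> \<beta>
    using lie_bracket_on_skew[OF alg h(2) hat_sym_tensors_delta_star[OF h(1) affine]]
    unfolding ce_differential_cochain1 hat_schouten_coboundary[OF h[THEN hat_sym_tensors_smooth]] cochain2_def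
    by (simp add: hat_schouten_coboundary[OF h[THEN hat_sym_tensors_smooth]])
  have cohomologous: "cohomologous (hat_sym_tensors A) (hat_alg_bracket A \<Omega>) 0
      (cochain1 (hat_delta_star A \<Gamma>')) (cochain1 (hat_delta_star A \<Gamma>))"
    if "symplectic_connection A \<Omega> \<Gamma>'" for \<Gamma>'
  proof -
    interpret two_symplectic_connections A \<Omega> \<Gamma> \<Gamma>' by unfold_locales (rule that)
    let ?h = "\<lambda>xs :: (nat \<Rightarrow> ('m, 'n) tensor) list. single 3 primitive"
    have "cochain1 (hat_delta_star A \<Gamma>') xs - cochain1 (hat_delta_star A \<Gamma>) xs =
        ce_differential (hat_alg_bracket A \<Omega>) ?h xs"
      if "set xs \<subseteq> hat_sym_tensors A" "length xs = Suc 0" for xs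
    proof -
      obtain \<alpha> where \<alpha>: "xs = [\<alpha>]" using \<open>length xs = Suc 0\<close> by (auto simp: length_Suc_conv)
      then have "\<alpha> \<in> hat_smooth_sym A" using that(1) hat_sym_tensors_smooth by simp
      then show ?thesis by (simp add: \<alpha> ce_differential_0 cochain1_def delta_star_diff)
    qed
    moreover have "?h \<in> cochains (hat_sym_tensors A) 0"
      by (simp add: cochains_def primitive_hat_sym_tensors)
    ultimately show ?thesis
      unfolding cohomologous_def using cochain1_delta_star[OF affine] cochain1_delta_star[OF affine'] by auto
  qed
  show ?thesis
    using delta_star_sym_prod[OF _ _ affine] hat_delta_star_sym_prod[OF _ _ affine, OF hat_sym_tensors_smooth hat_sym_tensors_smooth]
      cochain1_delta_star[OF affine] cochain2_lie_bracket[OF schouten] coboundary schouten_coboundary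
      lie_bracket_pencil[unfolded pencil] mixed_jacobi[OF hat_sym_tensors_smooth hat_sym_tensors_smooth hat_sym_tensors_smooth]
      cohomologous
    unfolding compatible_lie_brackets_def
    by (intro conjI allI ballI impI) (simp_all)
qed

end
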